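(* For every $\hbar\in H$, the product $\star_\hbar$ on $\mathcal{P}(D_n)$ extends continuously to $\mathcal{A}(D_n)$, making $(\mathcal{A}(D_n),\star_\hbar)$ a Fréchet algebra. For all $a,b\in\mathcal{A}(D_n)$ with Schauder expansions $a=\sum_{P,Q\in\mathbb{N}_0^n}a_{P,Q}f_{r,P,Q}$ and $b=\sum_{R,S\in\mathbb{N}_0^n}b_{R,S}f_{r,R,S}$, the extended product is given by $$a\star_\hbar b=\sum_{P,Q,R,S\in\mathbb{N}_0^n}a_{P,Q}\,b_{R,S}\,f_{r,P,Q}\star_\hbar f_{r,R,S},$$ where the series converges absolutely and locally uniformly in $\hbar\in H$ (i.e. for every compact $L\subseteq H$ and every continuous seminorm $p$ on $\mathcal{A}(D_n)$, $\sum_{P,Q,R,S}|a_{P,Q}b_{R,S}|\sup_{\hbar\in L}p(f_{r,P,Q}\star_\hbar f_{r,R,S})<\infty$). If moreover $\hbar$ is real, then $(\mathcal{A}(D_n),\star_\hbar)$ with pointwise complex conjugation as involution is a Fréchet $*$-algebra.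
   Context: Fix $n\ge1$; indices $\mu,\nu\in\{0,\dots,n\}$; $h_{\mu\nu}=\mathrm{diag}(-1,1,\dots,1)$. Multi-index conventions: $|P|=\sum P_i$, $P!=\prod P_i!$, $\binom{P}{T}=\prod\binom{P_i}{T_i}$, $\le$ and $\min$ componentwise, $P'=(P_1,\dots,P_n)$ for $P\in\mathbb{N}_0^{1+n}$. $D_n=Z/U(1)$ with $Z=\{r\in\mathbb{C}^{1+n}:-|r^0|^2+\sum_{i\ge1}|r^i|^2=-1\}$, identified with the open unit ball in $\mathbb{C}^n$ via $w^i=r^i/r^0$. $\hat D_n=\hat Z/\mathbb{C}^*$ with $\hat Z=\{(p,q): -p^0q^0+\sum_{i\ge1}p^iq^i=-1\}$ and $z\cdot(p,q)=(zp,q/z)$; $\Delta_D([r])=[r,\bar r]$. $\mathcal{A}(D_n)=\{\hat a\circ\Delta_D:\hat a\in\mathcal{O}(\hat D_n)\}$ (with $\hat a$ unique), a Fréchet space with seminorms $\|a\|_{D_n,K}=\sup_K|\hat a|$, $K\subseteq\hat D_n$ compact. For $P,Q\in\mathbb{N}_0^{1+n}$ with $|P|=|Q|$: $f_{P,Q}([r])=r^P\bar r^Q=w^{P'}\bar w^{Q'}/(1-w\cdot\bar w)^{|P|}$; $\mathcal{P}(D_n)=\mathrm{span}\{f_{P,Q}\}$. For $P,Q\in\mathbb{N}_0^n$: $f_{r,P,Q}=w^P\bar w^Q/(1-w\cdot\bar w)^{\max\{|P|,|Q|\}}$. The $f_{r,P,Q}$ form a basis of $\mathcal{P}(D_n)$,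 and (a known fact) an absolute Schauder basis of $\mathcal{A}(D_n)$: each $a\in\mathcal{A}(D_n)$ has a unique absolutely convergent expansion $a=\sum a_{P,Q}f_{r,P,Q}$. $\mathcal{P}(D_n)$ is dense in $\mathcal{A}(D_n)$. Star product: $H=\mathbb{C}\setminus(\{0\}\cup\{-1/(2m):m\in\mathbb{N}\})$; Pochhammer symbol $(z)_m=\prod_{k=0}^{m-1}(z+k)$. Let $\mathcal{P}(\mathbb{C}^{1+n})$ be the polynomials in $z^\mu,\bar z^\mu$ with basis $d_{P,Q}=z^P\bar z^Q$, and $\mathcal{P}(\mathbb{C}^{1+n})^{U(1)}$ the span of $d_{P,Q}$ with $|P|=|Q|$. The Wick product is the bilinear product $d_{P,Q}\tilde\star_\hbar d_{R,S}=\sum_{T\le\min\{P,S\}}(-1)^{T_0}(2\hbar)^{|T|}T!\binom{P}{T}\binom{S}{T}d_{P+R-T,Q+S-T}$. For $\hbar\in H$ let $\Psi_\hbar:\mathcal{P}(\mathbb{C}^{1+n})^{U(1)}\to\mathcal{P}(D_n)$ be linear with $\Psi_\hbar(d_{P,Q})=(2\hbar)^{|P|}(\tfrac{1}{2\hbar})_{|P|}f_{P,Q}$; it is surjective and its kernel is a two-sided ideal for $\tilde\star_\hbar$, so $a\star_\hbar b:=\Psi_\hbar(a'\tilde\star_\hbar b')$ for any preimages $a',b'$ is a well-defined associative product on $\mathcal{P}(D_n)$; explicitly $f_{P,Q}\star_\hbar f_{R,S}=\sum_{T\in\mathbb{N}_0^{1+n},\,T\le\min\{P,S\}}(-1)^{T_0}\frac{(\frac1{2\hbar})_{|P+S-T|}T!}{(\frac1{2\hbar})_{|P|}(\frac1{2\hbar})_{|S|}}\binom{P}{T}\binom{S}{T}f_{P+R-T,Q+S-T}$.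 *)

theory Defs
  imports "HOL-Analysis.Analysis"
begin

text \<open>The dimension n is the cardinality of the finite index type 'n.
  Points of C^{1+n} are pairs (z^0, (z^1..z^n)); multi-indices in N_0^{1+n}
  are pairs (P_0, P') with P' :: 'n => nat; multi-indices in N_0^n are 'n => nat.\<close>

type_synonym 'n pt = "complex \<times> (complex ^ 'n)"
type_synonym 'n mi = "nat \<times> ('n \<Rightarrow> nat)"
type_synonym 'n fn = "complex ^ 'n \<Rightarrow> complex"

definition mabs :: "'n::finite mi \<Rightarrow> nat" where
  "mabs P = fst P + (\<Sum>i\<in>UNIV. snd P i)"

definition nabs :: "('n::finite \<Rightarrow> nat) \<Rightarrow> nat" where
  "nabs P = (\<Sum>i\<in>UNIV. P i)"

definition mi_add :: "'n mi \<Rightarrow> 'n mi \<Rightarrow> 'n mi" where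
  "mi_add P R = (fst P + fst R, \<lambda>i. snd P i + snd R i)"

definition mi_sub :: "'n mi \<Rightarrow> 'n mi \<Rightarrow> 'n mi" where
  "mi_sub P R = (fst P - fst R, \<lambda>i. snd P i - snd R i)"

definition mi_le :: "'n mi \<Rightarrow> 'n mi \<Rightarrow> bool" where
  "mi_le T P \<longleftrightarrow> fst T \<le> fst P \<and> (\<forall>i. snd T i \<le> snd P i)"

definition mi_fact :: "'n::finite mi \<Rightarrow> nat" where
  "mi_fact P = fact (fst P) * (\<Prod>i\<in>UNIV. fact (snd P i))"

definition mi_choose :: "'n::finite mi \<Rightarrow> 'n mi \<Rightarrow> nat" where
  "mi_choose P T = (fst P choose fst T) * (\<Prod>i\<in>UNIV. (snd P i choose snd T i))"

definition cnjv :: "complex ^ 'n::finite \<Rightarrow> complex ^ 'n" where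
  "cnjv w = (\<chi> i. cnj (w $ i))"

definition wpow :: "complex ^ 'n::finite \<Rightarrow> ('n \<Rightarrow> nat) \<Rightarrow> complex" where
  "wpow w P = (\<Prod>i\<in>UNIV. (w $ i) ^ P i)"

definition wdot :: "complex ^ 'n::finite \<Rightarrow> complex" where
  "wdot w = (\<Sum>i\<in>UNIV. w $ i * cnj (w $ i))"

text \<open>Functions on D_n are represented as functions on C^n vanishing outside the ball.\<close>

definition fP :: "'n::finite mi \<Rightarrow> 'n mi \<Rightarrow> 'n fn" where
  "fP P Q = (\<lambda>w. if w \<in> ball 0 1
      then wpow w (snd P) * wpow (cnjv w) (snd Q) / (1 - wdot w) ^ mabs P else 0)"

definition fr :: "('n::finite \<Rightarrow> nat) \<Rightarrow> ('n \<Rightarrow> nat) \<Rightarrow> 'n fn" where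
  "fr P Q = (\<lambda>w. if w \<in> ball 0 1
      then wpow w P * wpow (cnjv w) Q / (1 - wdot w) ^ max (nabs P) (nabs Q) else 0)"

definition PD :: "'n::finite fn set" where
  "PD = {a. \<exists>F c. finite F \<and> (\<forall>(P,Q)\<in>F. mabs P = mabs Q) \<and>
            a = (\<lambda>w. \<Sum>(P,Q)\<in>F. c (P,Q) * fP P Q w)}"

definition bil :: "'n::finite pt \<Rightarrow> 'n pt \<Rightarrow> complex" where
  "bil p q = - fst p * fst q + (\<Sum>i\<in>UNIV. snd p $ i * snd q $ i)"

definition sc :: "complex \<Rightarrow> 'n::finite pt \<Rightarrow> 'n pt" where
  "sc z p = (z * fst p, \<chi> i. z * snd p $ i)"

text \<open>hat D_n = hat Z / C^* is identified with U / (C^* x C^*), where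
  U = {(p,q). bil p q \<noteq> 0} (open in C^{2+2n}), via (p,q) |-> [p, -q / bil p q].
  Holomorphic functions on hat D_n correspond to holomorphic functions on U
  invariant under (p,q) |-> (z p, u q); we normalize them to be 0 outside U.\<close>

definition Uset :: "('n::finite pt \<times> 'n pt) set" where
  "Uset = {(p,q). bil p q \<noteq> 0}"

definition csc :: "complex \<Rightarrow> 'n::finite pt \<times> 'n pt \<Rightarrow> 'n pt \<times> 'n pt" where
  "csc z x = (sc z (fst x), sc z (snd x))"

definition holo_on :: "('n::finite pt \<times> 'n pt \<Rightarrow> complex) \<Rightarrow> ('n pt \<times> 'n pt) set \<Rightarrow> bool" where
  "holo_on G S \<longleftrightarrow> (\<forall>x\<in>S. \<exists>L. (G has_derivative L) (at x) \<and> (\<forall>v. L (csc \<i> v) = \<i> * L v))"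

definition Ohat :: "('n::finite pt \<times> 'n pt \<Rightarrow> complex) set" where
  "Ohat = {G. holo_on G Uset \<and> (\<forall>x. x \<notin> Uset \<longrightarrow> G x = 0) \<and>
      (\<forall>p q z u. (p,q) \<in> Uset \<longrightarrow> z \<noteq> 0 \<longrightarrow> u \<noteq> 0 \<longrightarrow> G (sc z p, sc u q) = G (p,q))}"

text \<open>Delta_D([r]) = [r, conj r]; with r = (1,w)/sqrt(1-|w|^2) and invariance this is
  the class of ((1,w),(1,conj w)).\<close>

definition emb :: "('n::finite pt \<times> 'n pt \<Rightarrow> complex) \<Rightarrow> 'n fn" where
  "emb G = (\<lambda>w. if w \<in> ball 0 1 then G ((1, w), (1, cnjv w)) else 0)"

definition ADn :: "'n::finite fn set" where
  "ADn = {a. \<exists>G\<in>Ohat. a = emb G}"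

definition hat :: "'n::finite fn \<Rightarrow> ('n pt \<times> 'n pt \<Rightarrow> complex)" where
  "hat a = (THE G. G \<in> Ohat \<and> emb G = a)"

text \<open>Compact subsets of hat D_n are exactly the images of compact subsets of U.\<close>

definition cpts :: "('n::finite pt \<times> 'n pt) set set" where
  "cpts = {C. compact C \<and> C \<subseteq> Uset \<and> C \<noteq> {}}"

definition sn :: "('n::finite pt \<times> 'n pt) set \<Rightarrow> 'n fn \<Rightarrow> real" where
  "sn C a = (SUP x\<in>C. norm (hat a x))"

definition fconv :: "'n::finite fn \<Rightarrow> ('i set \<Rightarrow> 'n fn) \<Rightarrow> bool" where
  "fconv a S \<longleftrightarrow> (\<forall>C\<in>cpts. ((\<lambda>F. sn C (a - S F)) \<longlongrightarrow> 0) (finite_subsets_at_top UNIV))"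

definition schauder :: "'n::finite fn \<Rightarrow> (('n \<Rightarrow> nat) \<times> ('n \<Rightarrow> nat) \<Rightarrow> complex) \<Rightarrow> bool" where
  "schauder a c \<longleftrightarrow>
     (\<forall>C\<in>cpts. (\<lambda>(P,Q). norm (c (P,Q)) * sn C (fr P Q)) summable_on UNIV) \<and>
     fconv a (\<lambda>F. \<lambda>w. \<Sum>(P,Q)\<in>F. c (P,Q) * fr P Q w)"

definition Hset :: "complex set" where
  "Hset = {h. h \<noteq> 0 \<and> (\<forall>m::nat. m \<ge> 1 \<longrightarrow> h \<noteq> - 1 / (2 * of_nat m))}"

text \<open>Elements of P(C^{1+n})^{U(1)} as finitely supported coefficient functions
  on the basis d_{P,Q} with |P| = |Q|.\<close>

definition Upol :: "('n::finite mi \<times> 'n mi \<Rightarrow> complex) set" where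
  "Upol = {c. finite {k. c k \<noteq> 0} \<and> (\<forall>P Q. c (P,Q) \<noteq> 0 \<longrightarrow> mabs P = mabs Q)}"

definition psi :: "complex \<Rightarrow> ('n::finite mi \<times> 'n mi \<Rightarrow> complex) \<Rightarrow> 'n fn" where
  "psi h c = (\<lambda>w. \<Sum>k\<in>{k. c k \<noteq> 0}.
      c k * (2 * h) ^ mabs (fst k) * pochhammer (1 / (2 * h)) (mabs (fst k)) * fP (fst k) (snd k) w)"

definition wick :: "complex \<Rightarrow> ('n::finite mi \<times> 'n mi \<Rightarrow> complex) \<Rightarrow> ('n mi \<times> 'n mi \<Rightarrow> complex)
                     \<Rightarrow> ('n mi \<times> 'n mi \<Rightarrow> complex)" where
  "wick h c e = (\<lambda>k. \<Sum>(x, y, T) \<in> {(x, y, T). c x \<noteq> 0 \<and> e y \<noteq> 0 \<and>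
                         mi_le T (fst x) \<and> mi_le T (snd y) \<and>
                         k = (mi_sub (mi_add (fst x) (fst y)) T, mi_sub (mi_add (snd x) (snd y)) T)}.
       c x * e y * (-1) ^ fst T * (2 * h) ^ mabs T * of_nat (mi_fact T)
         * of_nat (mi_choose (fst x) T) * of_nat (mi_choose (snd y) T))"

definition starP :: "complex \<Rightarrow> 'n::finite fn \<Rightarrow> 'n fn \<Rightarrow> 'n fn" where
  "starP h a b = psi h (wick h (SOME c. c \<in> Upol \<and> psi h c = a) (SOME e. e \<in> Upol \<and> psi h e = b))"

definition cnjf :: "'n::finite fn \<Rightarrow> 'n fn" where
  "cnjf a = (\<lambda>w. cnj (a w))"

end

theory Submission
  imports Defs "HOL-Complex_Analysis.Complex_Analysis"
begin

text \<open>
  A function G on the complexified disc is entire in each of the charts (p,q) |-> [(1,p),(1+p.q,q)]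
  and (p,q) |-> [(1+p.q,p),(1,q)] of C^{2n}. On the first chart f_{r,P,Q} is the monomial p^P q^Q for
  |P| \<le> |Q|, on the second for |P| \<ge> |Q|. Hence the Schauder coefficients of G are Taylor
  coefficients in one of the two charts, and Cauchy's estimates bound them by seminorms. That the two
  halves fit together follows from the scaling (p,q) |-> (zp,q/z): the discrepancy is an entire
  function of z that is bounded at infinity, so Liouville's theorem kills it.

  On polynomials the kernel of Psi is also the kernel of the representation of the Wick algebra by
  differential operators on functions homogeneous of degree -1/(2h), hence a two-sided ideal.
  The explicit product formula grows only exponentially in the degrees, locally uniformly in h, whereas
  Schauder coefficients decay faster than any exponential; so the product series converges absolutely
  and the product is continuous. Associativity and the involution pass to the limit.
\<close>

section \<open>Power series in several variables\<close>

text \<open>Holomorphy in 2 + 2n variables is used only along complex lines: commuting with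
  multiplication by i turns the real derivative in \<open>holo_on\<close> into ordinary
  differentiability in one variable, so the one-variable theorems of Cauchy, Liouville and
  Weierstrass and the identity theorem suffice. Each chart coordinate moves along such a line,
  because 1 + p.q is affine in it.

  Two charts are forced by the exponent max(|P|, |Q|): on the wrong chart f_{r,P,Q} carries a power
  of 1 + p.q, so neither chart alone reads off all coefficients.

  All estimates are measured against R^deg, with deg the total degree. A bound against (2 R)^deg
  gives summability against R^deg, which is where radii \<open>2 * R\<close> come from; since R is
  arbitrary, exponential growth of the product coefficients is absorbed.

  \<open>starP\<close> picks arbitrary preimages, so it is inaccessible until the kernel of
  \<open>psi\<close> is understood. The relations that reduce f_{P,Q} to the basis hold for the
  values of \<open>psi\<close> and for the operator coefficients alike; one reduced coefficient
  family therefore serves both, and the two kernels can be compared through it.\<close>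

lemma summable_on_times_nonneg:
  fixes f :: "'a \<Rightarrow> real" and g :: "'b \<Rightarrow> real"
  assumes f: "f summable_on A" and g: "g summable_on B"
    and "\<And>x. x \<in> A \<Longrightarrow> f x \<ge> 0" "\<And>y. y \<in> B \<Longrightarrow> g y \<ge> 0"
  shows "(\<lambda>(x,y). f x * g y) summable_on A \<times> B"
proof (rule summable_on_SigmaI)
  fix x assume "x \<in> A"
  show "((\<lambda>y. case (x,y) of (x,y) \<Rightarrow> f x * g y) has_sum (f x * infsum g B)) B"
    using has_sum_cmult_right[OF has_sum_infsum[OF g], of "f x"] by simp
next
  show "(\<lambda>x. f x * infsum g B) summable_on A"
    using summable_on_cmult_left[OF f] by simp
qed (use assms in auto)

section \<open>Multi-indices and everywhere convergent power series\<close>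

definition mpow :: "('j::finite \<Rightarrow> complex) \<Rightarrow> ('j \<Rightarrow> nat) \<Rightarrow> complex" where
  "mpow x P = (\<Prod>j\<in>UNIV. x j ^ P j)"

text \<open>Exponents supported in J. The type of variables stays fixed while J grows, so that the
  number of variables can be the induction parameter.\<close>

definition mi_on :: "'j set \<Rightarrow> ('j \<Rightarrow> nat) set" where
  "mi_on J = {P. \<forall>j. j \<notin> J \<longrightarrow> P j = 0}"

text \<open>The coefficient families of entire functions: absolute convergence on polydiscs of every
  radius.\<close>

definition decay :: "('j::finite \<Rightarrow> nat) set \<Rightarrow> (('j \<Rightarrow> nat) \<Rightarrow> complex) \<Rightarrow> bool" where
  "decay S c \<longleftrightarrow> (\<forall>R>0. (\<lambda>P. norm (c P) * R ^ nabs P) summable_on S)"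

lemma mi_on_UNIV [simp]: "mi_on UNIV = UNIV"
  by (simp add: mi_on_def)

lemma mi_on_empty [simp]: "mi_on {} = {\<lambda>_. 0}"
  by (auto simp: mi_on_def)

lemma nabs_zero [simp]: "nabs (\<lambda>_. 0) = 0"
  by (simp add: nabs_def)

lemma mpow_zero [simp]: "mpow x (\<lambda>_. 0) = 1"
  by (simp add: mpow_def)

lemma nabs_fun_upd: "P j = 0 \<Longrightarrow> nabs (P(j := k)) = k + nabs P"
  unfolding nabs_def by (simp add: sum.remove[of UNIV j])

lemma mpow_fun_upd: "P j = 0 \<Longrightarrow> mpow x (P(j := k)) = x j ^ k * mpow x P"
  unfolding mpow_def by (simp add: prod.remove[of UNIV j])

lemma mpow_cong: "(\<And>j. P j \<noteq> 0 \<Longrightarrow> x j = y j) \<Longrightarrow> mpow x P = mpow y P"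
  unfolding mpow_def by (intro prod.cong refl) (metis power_0)

lemma norm_mpow_le:
  assumes "\<And>j. norm (x j) \<le> R"
  shows "norm (mpow x P) \<le> R ^ nabs P"
proof -
  have "norm (mpow x P) = (\<Prod>j\<in>UNIV. norm (x j) ^ P j)"
    by (simp add: mpow_def prod_norm[symmetric] norm_power)
  also have "\<dots> \<le> (\<Prod>j\<in>UNIV. R ^ P j)"
    by (intro prod_mono) (auto intro: power_mono assms)
  finally show ?thesis by (simp add: nabs_def power_sum)
qed

lemma decayD: "decay S c \<Longrightarrow> R > 0 \<Longrightarrow> (\<lambda>P. norm (c P) * R ^ nabs P) summable_on S"
  by (simp add: decay_def)

lemma finite_bound:
  fixes x :: "'j::finite \<Rightarrow> complex"
  obtains R where "R > 0" "\<And>j. norm (x j) \<le> R"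
proof
  show "1 + (\<Sum>j\<in>UNIV. norm (x j)) > 0"
    by (smt (verit) sum_nonneg norm_ge_zero)
  show "norm (x j) \<le> 1 + (\<Sum>j\<in>UNIV. norm (x j))" for j
    using member_le_sum[of j UNIV "\<lambda>j. norm (x j)"] by simp
qed

lemma decay_abs_summable:
  assumes "decay S c"
  shows "(\<lambda>P. norm (c P * mpow x P)) summable_on S"
proof -
  obtain R where R: "R > 0" "\<And>j. norm (x j) \<le> R" using finite_bound by blast
  show ?thesis
    by (rule summable_on_comparison_test[OF decayD[OF assms R(1)]])
       (auto simp: norm_mult intro!: mult_left_mono norm_mpow_le R)
qed

lemma decay_summable: "decay S c \<Longrightarrow> (\<lambda>P. c P * mpow x P) summable_on S"
  by (rule abs_summable_summable[OF decay_abs_summable])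

text \<open>Splitting off the exponent of the new variable; this is the reindexing behind the Fubini
  step of each induction over the variables.\<close>

lemma bij_betw_mi_on_insert:
  assumes "j \<notin> J"
  shows "bij_betw (\<lambda>(k,P). P(j := k)) (UNIV \<times> mi_on J) (mi_on (insert j J))"
proof (rule bij_betwI[where g = "\<lambda>P. (P j, P(j := 0))"])
qed (use assms in \<open>auto simp: mi_on_def\<close>)

lemma summable_on_mi_on_insert:
  assumes "j \<notin> J"
  shows "f summable_on mi_on (insert j J) \<longleftrightarrow> (\<lambda>(k,P). f (P(j := k))) summable_on (UNIV \<times> mi_on J)"
  using summable_on_reindex_bij_betw[OF bij_betw_mi_on_insert[OF assms], of f]
  by (simp add: case_prod_unfold)

lemma infsum_mi_on_insert:
  assumes "j \<notin> J"
  shows "infsum f (mi_on (insert j J)) = infsum (\<lambda>(k,P). f (P(j := k))) (UNIV \<times> mi_on J)"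
  using infsum_reindex_bij_betw[OF bij_betw_mi_on_insert[OF assms], of f]
  by (simp add: case_prod_unfold)

lemma mi_on_notin: "P \<in> mi_on J \<Longrightarrow> j \<notin> J \<Longrightarrow> P j = 0"
  by (simp add: mi_on_def)

lemma geometric_summable_mi:
  assumes "0 \<le> r" "r < (1::real)"
  shows "(\<lambda>P::'j::finite \<Rightarrow> nat. r ^ nabs P) summable_on UNIV"
proof -
  have "(\<lambda>P. r ^ nabs P) summable_on mi_on J" if "finite J" for J :: "'j set"
    using that
  proof (induction J)
    case (insert j J)
    have "(\<lambda>(k,P). r ^ k * r ^ nabs P) summable_on UNIV \<times> mi_on J"
    proof (rule summable_on_times_nonneg)
      show "(\<lambda>k. r ^ k) summable_on UNIV"
        using assms by (intro summable_nonneg_imp_summable_on) (auto simp: summable_geometric)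
    qed (use assms insert in auto)
    also have "?this \<longleftrightarrow> (\<lambda>(k,P). r ^ nabs (P(j := k))) summable_on UNIV \<times> mi_on J"
      using insert.hyps by (intro summable_on_cong) (auto simp: nabs_fun_upd mi_on_notin power_add)
    finally show ?case using insert.hyps by (simp add: summable_on_mi_on_insert)
  qed auto
  from this[of UNIV] show ?thesis by simp
qed

text \<open>Convergence at every radius gives the formal power series infinite convergence radius,
  so \<open>u k\<close> is the Taylor coefficient at 0 of an entire function and Cauchy's estimate
  on the circle of radius R applies.\<close>

lemma power_series_coeff_bound:
  fixes u :: "nat \<Rightarrow> complex"
  assumes sm: "\<And>r. r > 0 \<Longrightarrow> summable (\<lambda>k. norm (u k) * r ^ k)"
    and "R > 0" and M: "\<And>z. norm z = R \<Longrightarrow> norm (\<Sum>k. u k * z ^ k) \<le> M"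
  shows "norm (u k) * R ^ k \<le> M"
proof -
  define F where "F = Abs_fps u"
  have "summable (\<lambda>n. u n * z ^ n)" for z
  proof (cases "z = 0")
    case False
    then show ?thesis
      by (intro summable_norm_cancel[of "\<lambda>n. u n * z ^ n"])
         (use sm[of "norm z"] in \<open>auto simp: norm_mult norm_power\<close>)
  next
    case True
    then show ?thesis using summable_0_powser[of u] by simp
  qed
  then have rad: "fps_conv_radius F = \<infinity>"
    unfolding fps_conv_radius_def F_def by (intro conv_radius_inftyI'') auto
  have hol: "eval_fps F holomorphic_on A" for A
    by (rule holomorphic_on_eval_fps) (auto simp: rad eball_def)
  have "u k = (deriv ^^ k) (eval_fps F) 0 / fact k"
    using fps_nth_fps_expansion[OF eval_fps_has_fps_expansion, of F k] rad by (simp add: F_def)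
  moreover have "norm ((deriv ^^ k) (eval_fps F) 0) \<le> fact k * M / R ^ k"
    by (rule Cauchy_inequality[OF hol holomorphic_on_imp_continuous_on[OF hol] \<open>R > 0\<close>])
       (use M in \<open>auto simp: eval_fps_def F_def\<close>)
  ultimately have "norm (u k) \<le> (fact k * M / R ^ k) / fact k"
    by (metis norm_divide norm_fact divide_right_mono fact_ge_zero)
  then show ?thesis
    using \<open>R > 0\<close> by (simp add: field_simps)
qed

text \<open>With the other variables frozen, the sum is a one-variable series in variable j whose
  coefficients are themselves series over J. The one-variable estimate bounds the coefficient at
  exponent \<open>P j\<close> by M / R^(P j), uniformly on the polydisc, and the induction
  hypothesis is applied to that coefficient series.\<close>

lemma multi_power_series_coeff_bound:
  fixes c :: "('j::finite \<Rightarrow> nat) \<Rightarrow> complex"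
  assumes "finite J" "decay (mi_on J) c" "R > 0" "P \<in> mi_on J"
    and "\<And>x. (\<And>j. norm (x j) \<le> R) \<Longrightarrow> norm (\<Sum>\<^sub>\<infinity>P\<in>mi_on J. c P * mpow x P) \<le> M"
  shows "norm (c P) * R ^ nabs P \<le> M"
  using assms
proof (induction J arbitrary: c P M)
  case empty
  then show ?case using empty.prems(4)[of "\<lambda>_. 0"] by auto
next
  case (insert j J)
  define Q where "Q = P(j := 0)"
  have QJ: "Q \<in> mi_on J" using insert.prems(3) by (auto simp: Q_def mi_on_def)
  have PQ: "P = Q(j := P j)" by (simp add: Q_def)
  note up = mi_on_notin[OF _ insert.hyps(2)]
  have dec: "(\<lambda>(k,P). norm (c (P(j := k))) * (r ^ k * r ^ nabs P)) summable_on UNIV \<times> mi_on J" if "r > 0" for r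
    using decayD[OF insert.prems(1) that] unfolding summable_on_mi_on_insert[OF insert.hyps(2)]
    by (rule summable_on_cong[THEN iffD1, rotated]) (auto simp: nabs_fun_upd up power_add)
  have decQ: "decay (mi_on J) (\<lambda>P. c (P(j := k)))" for k
    unfolding decay_def
  proof (intro allI impI)
    fix r :: real assume "r > 0"
    have "(\<lambda>y. norm (c (y(j := k))) * (r ^ k * r ^ nabs y)) summable_on mi_on J"
      using summable_on_SigmaD1[OF dec[OF \<open>r > 0\<close>], of k] \<open>r > 0\<close> by simp
    from summable_on_cmult_right[OF this, of "inverse (r ^ k)"]
    show "(\<lambda>P. norm (c (P(j := k))) * r ^ nabs P) summable_on mi_on J"
      using \<open>r > 0\<close> by (simp add: field_simps)
  qed
  have "norm (c (Q(j := P j))) * R ^ nabs Q \<le> M / R ^ P j"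
  proof (rule insert.IH[OF decQ \<open>R > 0\<close> QJ])
    fix x :: "'j \<Rightarrow> complex" assume x: "\<And>j. norm (x j) \<le> R"
    define u where "u k = (\<Sum>\<^sub>\<infinity>P\<in>mi_on J. c (P(j := k)) * mpow x P)" for k
    have main: "((\<lambda>k. u k * z ^ k) has_sum (\<Sum>\<^sub>\<infinity>P\<in>mi_on (insert j J). c P * mpow (x(j := z)) P)) UNIV" for z
    proof -
      have eq: "c (P(j := k)) * mpow (x(j := z)) (P(j := k)) = c (P(j := k)) * mpow x P * z ^ k"
        if "P \<in> mi_on J" for P k
      proof -
        have "mpow (x(j := z)) P = mpow x P" by (rule mpow_cong) (use up[OF that] in auto)
        then show ?thesis using up[OF that] by (simp add: mpow_fun_upd)
      qed
      have "(\<lambda>P. c P * mpow (x(j := z)) P) summable_on mi_on (insert j J)"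
        by (rule decay_summable[OF insert.prems(1)])
      then have sm: "(\<lambda>(k,P). c (P(j := k)) * mpow x P * z ^ k) summable_on UNIV \<times> mi_on J"
        unfolding summable_on_mi_on_insert[OF insert.hyps(2)]
        by (rule summable_on_cong[THEN iffD1, rotated]) (auto simp: eq)
      have "(\<Sum>\<^sub>\<infinity>P\<in>mi_on (insert j J). c P * mpow (x(j := z)) P) =
            (\<Sum>\<^sub>\<infinity>(k,P)\<in>UNIV \<times> mi_on J. c (P(j := k)) * mpow x P * z ^ k)"
        unfolding infsum_mi_on_insert[OF insert.hyps(2)] by (rule infsum_cong) (auto simp: eq)
      also have "\<dots> = (\<Sum>\<^sub>\<infinity>k. \<Sum>\<^sub>\<infinity>P\<in>mi_on J. c (P(j := k)) * mpow x P * z ^ k)"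
        using infsum_Sigma'_banach[OF sm] by simp
      finally have 1: "(\<Sum>\<^sub>\<infinity>P\<in>mi_on (insert j J). c P * mpow (x(j := z)) P) = (\<Sum>\<^sub>\<infinity>k. u k * z ^ k)"
        by (simp add: u_def infsum_cmult_left')
      have "(\<lambda>k. u k * z ^ k) summable_on UNIV"
        using summable_on_Sigma_banach[OF sm] by (simp add: u_def infsum_cmult_left')
      then show ?thesis using 1 by simp
    qed
    have "norm (u (P j)) * R ^ P j \<le> M"
    proof (rule power_series_coeff_bound)
      fix r :: real assume "r > 0"
      have "(\<lambda>k. u k * of_real r ^ k) summable_on UNIV" using main[of "of_real r"] by (auto simp: has_sum_imp_summable)
      then have "(\<lambda>k. norm (u k * of_real r ^ k)) summable_on UNIV"
        by (rule summable_on_iff_abs_summable_on_complex[THEN iffD1])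
      then show "summable (\<lambda>k. norm (u k) * r ^ k)"
        using \<open>r > 0\<close> by (auto dest!: summable_on_imp_summable simp: norm_mult norm_power)
    next
      fix z :: complex assume z: "norm z = R"
      have "(\<Sum>k. u k * z ^ k) = (\<Sum>\<^sub>\<infinity>P\<in>mi_on (insert j J). c P * mpow (x(j := z)) P)"
        using has_sum_imp_sums[OF main[of z]] by (simp add: sums_iff)
      also have "norm \<dots> \<le> M"
        by (rule insert.prems(4)) (use x z in auto)
      finally show "norm (\<Sum>k. u k * z ^ k) \<le> M" .
    qed fact
    then show "norm (\<Sum>\<^sub>\<infinity>P'\<in>mi_on J. c (P'(j := P j)) * mpow x P') \<le> M / R ^ P j"
      using \<open>R > 0\<close> by (simp add: u_def field_simps)
  qed
  then have "norm (c P) * R ^ nabs Q * R ^ P j \<le> M"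
    using \<open>R > 0\<close> by (simp add: PQ[symmetric] field_simps)
  moreover have "nabs P = P j + nabs Q"
    using nabs_fun_upd[of Q j "P j"] by (simp add: Q_def)
  ultimately show ?case by (simp add: power_add mult_ac)
qed

section \<open>Separately holomorphic, locally bounded functions and their expansion\<close>

definition sep_entire :: "(('j::finite \<Rightarrow> complex) \<Rightarrow> complex) \<Rightarrow> bool" where
  "sep_entire g \<longleftrightarrow> (\<forall>x j. (\<lambda>z. g (x(j := z))) holomorphic_on UNIV) \<and>
     (\<forall>R. \<exists>M. \<forall>x. (\<forall>j. norm (x j) \<le> R) \<longrightarrow> norm (g x) \<le> M)"

definition pdiff :: "'j \<Rightarrow> (('j::finite \<Rightarrow> complex) \<Rightarrow> complex) \<Rightarrow> ('j \<Rightarrow> complex) \<Rightarrow> complex" where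
  "pdiff j g x = deriv (\<lambda>z. g (x(j := z))) (x j)"

lemma sep_entireD:
  assumes "sep_entire g"
  shows "(\<lambda>z. g (x(j := z))) holomorphic_on A"
    and "\<exists>M. \<forall>x. (\<forall>j. norm (x j) \<le> R) \<longrightarrow> norm (g x) \<le> M"
  using assms holomorphic_on_subset unfolding sep_entire_def by blast+

lemma pdiff_fun_upd: "pdiff j g (x(j := z)) = deriv (\<lambda>z. g (x(j := z))) z"
  by (simp add: pdiff_def)

lemma pdiff_funpow_fun_upd: "(pdiff j ^^ k) g (x(j := z)) = (deriv ^^ k) (\<lambda>z. g (x(j := z))) z"
proof (induction k arbitrary: z)
  case (Suc k)
  have "(\<lambda>z. (pdiff j ^^ k) g (x(j := z))) = (deriv ^^ k) (\<lambda>z. g (x(j := z)))"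
    by (intro ext Suc.IH)
  then show ?case by (simp only: pdiff_fun_upd funpow.simps o_apply)
qed simp

text \<open>The first-order Taylor remainder. Cauchy's estimate on unit circles bounds the second
  derivative by 2 M on the unit disc about a; those circles reach distance 2, which explains the
  region where M has to hold. The constant depends on the function only through M, so the bound is
  uniform in parameters.\<close>

lemma difference_quotient_bound:
  assumes hol: "\<phi> holomorphic_on UNIV" and M: "\<And>z. norm (z - a) \<le> 2 \<Longrightarrow> norm (\<phi> z) \<le> M"
    and h: "0 < norm h" "norm h \<le> 1"
  shows "norm ((\<phi> (a + h) - \<phi> a) / h - deriv \<phi> a) \<le> 2 * M * norm h"
proof -
  have "norm ((deriv ^^ 0) \<phi> (a + h) - (\<Sum>i\<le>1. (deriv ^^ i) \<phi> a * (a + h - a) ^ i / fact i))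
      \<le> (2 * M) * norm (a + h - a) ^ Suc 1 / fact 1"
  proof (rule complex_Taylor[where S = "cball a 1" and f = "\<lambda>i. (deriv ^^ i) \<phi>"])
    fix i x assume "x \<in> cball a (1::real)"
    show "((deriv ^^ i) \<phi> has_field_derivative (deriv ^^ Suc i) \<phi> x) (at x within cball a 1)"
      using holomorphic_derivI[OF holomorphic_higher_deriv[OF hol open_UNIV] open_UNIV UNIV_I]
      by (auto intro: has_field_derivative_at_within)
  next
    fix x assume x: "x \<in> cball a (1::real)"
    have "norm ((deriv ^^ 2) \<phi> x) \<le> fact 2 * M / 1 ^ 2"
    proof (rule Cauchy_inequality)
      fix y assume y: "norm (x - y) = 1"
      have "norm (y - a) \<le> norm (x - y) + norm (a - x)"
        using norm_triangle_ineq[of "x - y" "a - x"] by (simp add: norm_minus_commute)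
      then show "norm (\<phi> y) \<le> M" using x y by (intro M) (auto simp: dist_norm)
    qed (use holomorphic_on_subset[OF hol] holomorphic_on_imp_continuous_on in \<open>auto intro: continuous_on_subset\<close>)
    then show "norm ((deriv ^^ Suc 1) \<phi> x) \<le> 2 * M" by (simp add: numeral_2_eq_2)
  qed (use h in \<open>auto simp: dist_norm\<close>)
  then have "norm (\<phi> (a + h) - \<phi> a - deriv \<phi> a * h) \<le> 2 * M * norm h * norm h"
    by (simp add: algebra_simps power2_eq_square)
  moreover have "(\<phi> (a + h) - \<phi> a) / h - deriv \<phi> a = (\<phi> (a + h) - \<phi> a - deriv \<phi> a * h) / h"
    using h by (auto simp: field_simps)
  ultimately show ?thesis using h by (simp add: norm_divide field_simps)
qed

text \<open>In a variable other than j, the partial derivative is a locally uniform limit of the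
  difference quotients with step 1 / (n + 1), each of which is holomorphic there. Local boundedness
  of g makes the convergence uniform. In variable j itself the derivative of a holomorphic function
  is holomorphic.\<close>

lemma sep_entire_pdiff:
  assumes g: "sep_entire g"
  shows "sep_entire (pdiff j g)"
  unfolding sep_entire_def
proof (intro conjI allI)
  fix x :: "'a \<Rightarrow> complex" and i
  show "(\<lambda>z. pdiff j g (x(i := z))) holomorphic_on UNIV"
  proof (cases "i = j")
    case True
    then show ?thesis
      by (simp add: pdiff_fun_upd holomorphic_deriv sep_entireD[OF g])
  next
    case False
    define y where "y z = x(i := z)" for z
    define f where "f n z = (g ((y z)(j := x j + 1 / of_nat (Suc n))) - g ((y z)(j := x j))) / (1 / of_nat (Suc n))" for n :: nat and z
    have yj: "y z j = x j" for z using False by (simp add: y_def)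
    show ?thesis
    proof (rule holomorphic_uniform_sequence[where f = f])
      show "f n holomorphic_on UNIV" for n
      proof -
        have tw: "(y z)(j := w) = (x(j := w))(i := z)" for z w
          using False by (simp add: y_def fun_upd_twist)
        show ?thesis unfolding f_def tw
          by (intro holomorphic_intros sep_entireD[OF g]) auto
      qed
      fix z0 :: complex
      obtain R where R: "R > 0" "\<And>k. norm (x k) \<le> R" using finite_bound by blast
      \<comment> \<open>The arguments that occur have coordinates at most R, except coordinate i, at
        most norm z0 + 1, and coordinate j, at most R + 2; the radius chosen exceeds all
        three.\<close>
      obtain M where M: "\<And>x. (\<forall>j. norm (x j) \<le> R + norm z0 + 3) \<Longrightarrow> norm (g x) \<le> M"
        using sep_entireD(2)[OF g, of "R + norm z0 + 3"] by auto
      have bd: "norm (f n z - pdiff j g (y z)) \<le> 2 * M * (1 / real (Suc n))" if "z \<in> cball z0 1" for n z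
      proof -
        have "norm ((g ((y z)(j := x j + 1 / of_nat (Suc n))) - g ((y z)(j := x j))) / (1 / of_nat (Suc n)) -
                 deriv (\<lambda>w. g ((y z)(j := w))) (x j)) \<le> 2 * M * norm (1 / of_nat (Suc n) :: complex)"
        proof (rule difference_quotient_bound)
          fix w assume w: "norm (w - x j) \<le> 2"
          have "norm w \<le> R + 2"
            using norm_triangle_ineq[of "w - x j" "x j"] w R(2)[of j] by simp
          moreover have "norm z \<le> norm z0 + 1"
            using that norm_triangle_ineq[of "z - z0" z0] by (simp add: dist_norm norm_minus_commute)
          ultimately show "norm (g ((y z)(j := w))) \<le> M"
            using R by (intro M) (auto simp: y_def intro: order_trans[OF R(2)] order_trans[OF \<open>norm w \<le> R + 2\<close>])
        qed (use sep_entireD[OF g] in \<open>auto simp: norm_divide simp del: of_nat_Suc\<close>)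
        then show ?thesis by (simp add: f_def pdiff_def yj norm_divide del: of_nat_Suc)
      qed
      have "uniform_limit (cball z0 1) f (\<lambda>z. pdiff j g (y z)) sequentially"
      proof (rule uniform_limitI)
        fix e :: real assume "e > 0"
        have "(\<lambda>n. 2 * M * (1 / real (Suc n))) \<longlonglongrightarrow> 2 * M * 0"
          by (intro tendsto_mult tendsto_const) (use LIMSEQ_inverse_real_of_nat in \<open>simp add: inverse_eq_divide\<close>)
        then have "\<forall>\<^sub>F n in sequentially. 2 * M * (1 / real (Suc n)) < e"
          using \<open>e > 0\<close> by (intro order_tendstoD(2)) auto
        then show "\<forall>\<^sub>F n in sequentially. \<forall>z\<in>cball z0 1. dist (f n z) (pdiff j g (y z)) < e"
        proof eventually_elim
          case (elim n)
          show ?case unfolding dist_norm using bd elim by (meson le_less_trans)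
        qed
      qed
      then show "\<exists>d>0. cball z0 d \<subseteq> UNIV \<and> uniform_limit (cball z0 d) f (\<lambda>z. pdiff j g (x(i := z))) sequentially"
        by (intro exI[of _ 1]) (simp add: y_def)
    qed simp
  qed
next
  fix R :: real
  obtain M where M: "\<And>x. (\<forall>j. norm (x j) \<le> R + 1) \<Longrightarrow> norm (g x) \<le> M"
    using sep_entireD(2)[OF g, of "R + 1"] by auto
  show "\<exists>M. \<forall>x. (\<forall>j. norm (x j) \<le> R) \<longrightarrow> norm (pdiff j g x) \<le> M"
  proof (intro exI[of _ M] allI impI)
    fix x :: "'a \<Rightarrow> complex" assume x: "\<forall>j. norm (x j) \<le> R"
    have "norm ((deriv ^^ 1) (\<lambda>z. g (x(j := z))) (x j)) \<le> fact 1 * M / 1 ^ 1"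
    proof (rule Cauchy_inequality)
      fix z assume "norm (x j - z) = 1"
      then have "norm z \<le> norm (x j) + 1" using norm_triangle_ineq3[of z "x j"] by (simp add: norm_minus_commute)
      then have "norm z \<le> R + 1" using x[rule_format, of j] by linarith
      then show "norm (g (x(j := z))) \<le> M" using x by (intro M) (auto intro: order_trans[of _ R])
    qed (use sep_entireD[OF g] holomorphic_on_imp_continuous_on in \<open>(blast | simp)+\<close>)
    then show "norm (pdiff j g x) \<le> M" by (simp add: pdiff_def)
  qed
qed

lemma sep_entire_pdiff_funpow: "sep_entire g \<Longrightarrow> sep_entire ((pdiff j ^^ k) g)"
  by (induction k) (auto intro: sep_entire_pdiff)

text \<open>Taylor coefficients in variable j are of this shape, with g an iterated partial
  derivative; they are constant in variable j.\<close>

lemma sep_entire_restrict: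
  assumes g: "sep_entire g"
  shows "sep_entire (\<lambda>x. g (x(j := 0)) / fact k)"
  unfolding sep_entire_def
proof (intro conjI allI)
  fix x :: "'a \<Rightarrow> complex" and i
  show "(\<lambda>z. g ((x(i := z))(j := 0)) / fact k) holomorphic_on UNIV"
  proof (cases "i = j")
    case False
    then have "(x(i := z))(j := 0) = (x(j := 0))(i := z)" for z by (simp add: fun_upd_twist)
    then show ?thesis by (auto intro!: holomorphic_intros sep_entireD[OF g])
  qed auto
next
  fix R :: real
  obtain M where M: "\<And>x. (\<forall>j. norm (x j) \<le> max 0 R) \<Longrightarrow> norm (g x) \<le> M"
    using sep_entireD(2)[OF g, of "max 0 R"] by auto
  show "\<exists>M. \<forall>x. (\<forall>j. norm (x j) \<le> R) \<longrightarrow> norm (g (x(j := 0)) / fact k) \<le> M"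
    by (intro exI[of _ "M / fact k"]) (auto simp: norm_divide intro!: divide_right_mono M le_max_iff_disj[THEN iffD2])
qed

text \<open>The Taylor coefficients \<open>T k\<close> in the new variable are again separately
  entire and depend only on the variables in J, so they have expansions by induction. Cauchy's
  estimate is used twice, in variable j for \<open>T k\<close> and then over J for its coefficients;
  this bounds the combined family on every polydisc and yields its decay.\<close>

lemma sep_entire_expansion_on:
  fixes g :: "('j::finite \<Rightarrow> complex) \<Rightarrow> complex"
  assumes "finite J" "sep_entire g" "\<And>x y. (\<And>i. i \<in> J \<Longrightarrow> x i = y i) \<Longrightarrow> g x = g y"
  shows "\<exists>c. decay (mi_on J) c \<and> (\<forall>x. g x = (\<Sum>\<^sub>\<infinity>P\<in>mi_on J. c P * mpow x P))"
  using assms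
proof (induction J arbitrary: g)
  case empty
  show ?case
  proof (intro exI conjI allI)
    show "decay (mi_on {}) (\<lambda>_::'j \<Rightarrow> nat. g (\<lambda>_. 0))" by (simp add: decay_def)
    show "g x = (\<Sum>\<^sub>\<infinity>P\<in>mi_on {}. g (\<lambda>_. 0) * mpow x P)" for x
      using empty.prems(2)[of x "\<lambda>_. 0"] by simp
  qed
next
  case (insert j J)
  define T where "T k x = (pdiff j ^^ k) g (x(j := 0)) / fact k" for k x
  have Teq: "T k x = (deriv ^^ k) (\<lambda>z. g (x(j := z))) 0 / fact k" for k x
    by (simp add: T_def pdiff_funpow_fun_upd)
  have "\<exists>c. decay (mi_on J) c \<and> (\<forall>x. T k x = (\<Sum>\<^sub>\<infinity>P\<in>mi_on J. c P * mpow x P))" for k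
  proof (rule insert.IH)
    show "sep_entire (T k)"
      unfolding T_def by (intro sep_entire_restrict sep_entire_pdiff_funpow insert.prems)
    fix x y :: "'j \<Rightarrow> complex" assume xy: "\<And>i. i \<in> J \<Longrightarrow> x i = y i"
    have "(\<lambda>z. g (x(j := z))) = (\<lambda>z. g (y(j := z)))"
      using xy by (intro ext insert.prems(2)) auto
    then show "T k x = T k y" by (simp add: Teq)
  qed
  then obtain c where c: "\<And>k. decay (mi_on J) (c k)"
      and cs: "\<And>k x. T k x = (\<Sum>\<^sub>\<infinity>P\<in>mi_on J. c k P * mpow x P)" by metis
  note up = mi_on_notin[OF _ insert.hyps(2)]
  define e where "e P = c (P j) (P(j := 0))" for P
  have e_up: "e (P(j := k)) = c k P" if "P \<in> mi_on J" for k P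
  proof -
    have "P(j := 0) = P" using up[OF that] by auto
    then show ?thesis by (simp add: e_def)
  qed
  have ebd: "\<exists>M. \<forall>P\<in>mi_on (insert j J). norm (e P) * R ^ nabs P \<le> M" if "R > 0" for R
  proof -
    obtain M where M: "\<And>x. (\<forall>j. norm (x j) \<le> R) \<Longrightarrow> norm (g x) \<le> M"
      using sep_entireD(2)[OF insert.prems(1), of R] by auto
    show ?thesis
    proof (intro exI ballI)
      fix P assume P: "P \<in> mi_on (insert j J)"
      define Q where "Q = P(j := 0)"
      have QJ: "Q \<in> mi_on J" using P by (auto simp: Q_def mi_on_def)
      have PQ: "P = Q(j := P j)" by (simp add: Q_def)
      have "norm (c (P j) Q) * R ^ nabs Q \<le> M / R ^ P j"
      proof (rule multi_power_series_coeff_bound[OF insert.hyps(1) c that QJ])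
        fix x :: "'j \<Rightarrow> complex" assume x: "\<And>j. norm (x j) \<le> R"
        have "norm ((deriv ^^ P j) (\<lambda>z. g (x(j := z))) 0) \<le> fact (P j) * M / R ^ P j"
        proof (rule Cauchy_inequality)
          fix z :: complex assume "norm (0 - z) = R"
          then show "norm (g (x(j := z))) \<le> M" using x by (intro M) auto
        qed (use \<open>R > 0\<close> sep_entireD[OF insert.prems(1)] holomorphic_on_imp_continuous_on in \<open>(blast | simp)+\<close>)
        then have "norm (T (P j) x) \<le> M / R ^ P j"
          using \<open>R > 0\<close> by (simp add: Teq norm_divide field_simps)
        then show "norm (\<Sum>\<^sub>\<infinity>Pa\<in>mi_on J. c (P j) Pa * mpow x Pa) \<le> M / R ^ P j" by (simp add: cs)
      qed
      moreover have "nabs P = P j + nabs Q"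
        using nabs_fun_upd[of Q j "P j"] by (simp add: Q_def)
      ultimately show "norm (e P) * R ^ nabs P \<le> M"
        using \<open>R > 0\<close> by (simp add: e_def Q_def[symmetric] power_add field_simps)
    qed
  qed
  have "decay (mi_on (insert j J)) e"
    unfolding decay_def
  proof (intro allI impI)
    fix R :: real assume "R > 0"
    \<comment> \<open>Boundedness at radius \<open>2 * R\<close> leaves the factor (1/2)^|P| at
      radius R, which is summable over all multi-indices.\<close>
    then obtain M where M: "\<And>P. P \<in> mi_on (insert j J) \<Longrightarrow> norm (e P) * (2 * R) ^ nabs P \<le> M"
      using ebd[of "2 * R"] by auto
    have "(\<lambda>P. M * (1/2) ^ nabs P) summable_on mi_on (insert j J)"
      by (intro summable_on_cmult_right summable_on_subset_banach[OF geometric_summable_mi]) auto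
    then show "(\<lambda>P. norm (e P) * R ^ nabs P) summable_on mi_on (insert j J)"
    proof (rule summable_on_comparison_test)
      fix P assume "P \<in> mi_on (insert j J)"
      from M[OF this] show "norm (e P) * R ^ nabs P \<le> M * (1/2) ^ nabs P"
        by (simp add: power_mult_distrib power_divide field_simps)
    qed (use \<open>R > 0\<close> in auto)
  qed
  moreover have "g x = (\<Sum>\<^sub>\<infinity>P\<in>mi_on (insert j J). e P * mpow x P)" for x
  proof -
    have eq: "e (P(j := k)) * mpow x (P(j := k)) = x j ^ k * (c k P * mpow x P)" if "P \<in> mi_on J" for k P
      using that by (simp add: e_up mpow_fun_upd up)
    have sm: "(\<lambda>(k,P). x j ^ k * (c k P * mpow x P)) summable_on UNIV \<times> mi_on J"
      using decay_summable[OF \<open>decay (mi_on (insert j J)) e\<close>, of x]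
      unfolding summable_on_mi_on_insert[OF insert.hyps(2)]
      by (rule summable_on_cong[THEN iffD1, rotated]) (auto simp: eq)
    have "(\<Sum>\<^sub>\<infinity>P\<in>mi_on (insert j J). e P * mpow x P) = (\<Sum>\<^sub>\<infinity>(k,P)\<in>UNIV \<times> mi_on J. x j ^ k * (c k P * mpow x P))"
      unfolding infsum_mi_on_insert[OF insert.hyps(2)] by (rule infsum_cong) (auto simp: eq)
    also have "\<dots> = (\<Sum>\<^sub>\<infinity>k. x j ^ k * T k x)"
      using infsum_Sigma'_banach[OF sm] by (simp add: cs infsum_cmult_right')
    also have "\<dots> = g x"
    proof -
      have "(\<lambda>k. x j ^ k * T k x) summable_on UNIV"
        using summable_on_Sigma_banach[OF sm] by (simp add: cs infsum_cmult_right')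
      then have "(\<lambda>k. x j ^ k * T k x) sums (\<Sum>\<^sub>\<infinity>k. x j ^ k * T k x)"
        by (intro has_sum_imp_sums has_sum_infsum)
      moreover have "(\<lambda>n. (deriv ^^ n) (\<lambda>z. g (x(j := z))) 0 / fact n * (x j - 0) ^ n) sums (g (x(j := x j)))"
        by (rule holomorphic_power_series[OF sep_entireD(1)[OF insert.prems(1)], of _ _ "norm (x j) + 1"]) auto
      ultimately show ?thesis
        using sums_unique2 by (fastforce simp: Teq mult_ac)
    qed
    finally show ?thesis by simp
  qed
  ultimately show ?case by blast
qed

lemma sep_entire_expansion:
  assumes "sep_entire g"
  obtains c where "decay UNIV c" "\<And>x. g x = (\<Sum>\<^sub>\<infinity>P. c P * mpow x P)"
proof -
  have "\<exists>c. decay (mi_on UNIV) c \<and> (\<forall>x. g x = (\<Sum>\<^sub>\<infinity>P\<in>mi_on UNIV. c P * mpow x P))"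
    by (rule sep_entire_expansion_on) (use assms in \<open>auto intro: arg_cong[of _ _ g]\<close>)
  then show ?thesis using that by auto
qed

section \<open>Holomorphic functions on the complexified disc\<close>

definition cdiff :: "('n::finite pt \<times> 'n pt \<Rightarrow> complex) \<Rightarrow> 'n pt \<times> 'n pt \<Rightarrow> bool" where
  "cdiff G x \<longleftrightarrow> (\<exists>L. (G has_derivative L) (at x) \<and> (\<forall>v. L (csc \<i> v) = \<i> * L v))"

lemma holo_on_cdiff: "holo_on G S \<longleftrightarrow> (\<forall>x\<in>S. cdiff G x)"
  by (simp add: holo_on_def cdiff_def)

lemma csc_sel [simp]:
  "fst (fst (csc z v)) = z * fst (fst v)" "snd (fst (csc z v)) $ i = z * snd (fst v) $ i"
  "fst (snd (csc z v)) = z * fst (snd v)" "snd (snd (csc z v)) $ i = z * snd (snd v) $ i"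
  by (simp_all add: csc_def sc_def)

lemma pt2_eqI:
  fixes x y :: "'n::finite pt \<times> 'n pt"
  assumes "fst (fst x) = fst (fst y)" "\<And>i. snd (fst x) $ i = snd (fst y) $ i"
    "fst (snd x) = fst (snd y)" "\<And>i. snd (snd x) $ i = snd (snd y) $ i"
  shows "x = y"
  using assms by (auto simp: prod_eq_iff vec_eq_iff)

text \<open>A real linear map sees a complex multiple of v only through v and i v. This
  decomposition upgrades commutation with i to complex linearity.\<close>

lemma csc_decomp: "csc z v = Re z *\<^sub>R v + Im z *\<^sub>R csc \<i> v"
proof (rule pt2_eqI)
  have *: "z * a = Re z *\<^sub>R a + Im z *\<^sub>R (\<i> * a)" for a
    by (subst complex_eq[of z]) (simp add: algebra_simps scaleR_conv_of_real)
  show "fst (fst (csc z v)) = fst (fst (Re z *\<^sub>R v + Im z *\<^sub>R csc \<i> v))"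
    "snd (fst (csc z v)) $ i = snd (fst (Re z *\<^sub>R v + Im z *\<^sub>R csc \<i> v)) $ i"
    "fst (snd (csc z v)) = fst (snd (Re z *\<^sub>R v + Im z *\<^sub>R csc \<i> v))"
    "snd (snd (csc z v)) $ i = snd (snd (Re z *\<^sub>R v + Im z *\<^sub>R csc \<i> v)) $ i" for i
    by (simp_all add: *[symmetric])
qed

lemma bounded_linear_csc_left: "bounded_linear (\<lambda>z. csc z v)"
proof -
  have "bounded_linear (\<lambda>z. Re z *\<^sub>R v + Im z *\<^sub>R csc \<i> v)"
    by (intro bounded_linear_add bounded_linear_scaleR_const bounded_linear_Re bounded_linear_Im)
  then show ?thesis by (simp add: csc_decomp[symmetric])
qed

lemma norm_sc: "norm (sc z p) = norm z * norm p"
proof -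
  have "norm (\<chi> i. z * snd p $ i) = norm z * norm (snd p)"
    by (simp add: norm_vec_def norm_mult L2_set_right_distrib)
  then show ?thesis
    by (simp add: sc_def norm_prod_def norm_mult power_mult_distrib distrib_left[symmetric] real_sqrt_mult)
qed

lemma norm_csc: "norm (csc z v) = norm z * norm v"
  by (cases v) (simp add: csc_def norm_Pair norm_sc power_mult_distrib distrib_left[symmetric] real_sqrt_mult)

lemma csc_0 [simp]: "csc 0 v = 0" by (rule pt2_eqI) auto

text \<open>The bridge to one complex variable: by the chain rule the derivative is h |-> L (h v),
  and by \<open>csc_decomp\<close> this is multiplication by \<open>L v\<close>.\<close>

lemma has_field_derivative_along_line:
  assumes L: "(G has_derivative L) (at (x + csc z v))" "\<And>v. L (csc \<i> v) = \<i> * L v"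
  shows "((\<lambda>z. G (x + csc z v)) has_field_derivative L v) (at z)"
proof -
  have "((\<lambda>z. x + csc z v) has_derivative (\<lambda>h. csc h v)) (at z)"
    using bounded_linear_imp_has_derivative[OF bounded_linear_csc_left, of v "at z"]
    by (auto intro!: derivative_eq_intros)
  from has_derivative_compose[OF this, of G L] L(1)
  have "((\<lambda>z. G (x + csc z v)) has_derivative (\<lambda>h. L (csc h v))) (at z)" by simp
  moreover have "L (csc h v) = L v * h" for h
  proof -
    have lin: "linear L" using L(1) has_derivative_linear by blast
    have "L (csc h v) = Re h *\<^sub>R L v + Im h *\<^sub>R (\<i> * L v)"
      by (subst csc_decomp) (simp add: linear_add[OF lin] linear_scale[OF lin] L(2))
    also have "\<dots> = L v * h" by (subst (3) complex_eq[of h]) (simp add: algebra_simps scaleR_conv_of_real)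
    finally show ?thesis .
  qed
  ultimately show ?thesis by (simp add: has_field_derivative_def mult_commute_abs)
qed

lemma cdiff_line_differentiable:
  "cdiff G (x + csc z v) \<Longrightarrow> (\<lambda>z. G (x + csc z v)) field_differentiable (at z within A)"
  unfolding cdiff_def field_differentiable_def
  using has_field_derivative_along_line has_field_derivative_at_within by metis

lemma cdiff_const: "cdiff (\<lambda>_. c) x"
  unfolding cdiff_def by (intro exI[of _ "\<lambda>_. 0"]) auto

lemma cdiff_add: "cdiff f x \<Longrightarrow> cdiff g x \<Longrightarrow> cdiff (\<lambda>x. f x + g x) x"
  unfolding cdiff_def
  by (elim exE conjE, rule exI, rule conjI, erule (1) has_derivative_add) (simp add: distrib_left)

lemma cdiff_mult: "cdiff f x \<Longrightarrow> cdiff g x \<Longrightarrow> cdiff (\<lambda>x. f x * g x) x"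
  unfolding cdiff_def
  by (elim exE conjE, rule exI, rule conjI, erule (1) has_derivative_mult) (simp add: algebra_simps)

lemma cdiff_inverse:
  assumes "cdiff f x" "f x \<noteq> 0"
  shows "cdiff (\<lambda>x. inverse (f x)) x"
proof -
  obtain L where L: "(f has_derivative L) (at x)" "\<And>v. L (csc \<i> v) = \<i> * L v"
    using assms by (auto simp: cdiff_def)
  from Deriv.has_derivative_inverse[OF assms(2) L(1)] show ?thesis
    unfolding cdiff_def by (intro exI[of _ "\<lambda>h. - (inverse (f x) * L h * inverse (f x))"]) (simp add: L(2))
qed

lemma cdiff_cmult: "cdiff f x \<Longrightarrow> cdiff (\<lambda>x. c * f x) x"
  by (intro cdiff_mult cdiff_const)

lemma cdiff_power: "cdiff f x \<Longrightarrow> cdiff (\<lambda>x. f x ^ k) x"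
  by (induction k) (auto intro: cdiff_const cdiff_mult)

lemma cdiff_sum: "(\<And>i. i \<in> I \<Longrightarrow> cdiff (f i) x) \<Longrightarrow> cdiff (\<lambda>x. \<Sum>i\<in>I. f i x) x"
  by (induction I rule: infinite_finite_induct) (auto intro: cdiff_const cdiff_add)

lemma cdiff_prod: "(\<And>i. i \<in> I \<Longrightarrow> cdiff (f i) x) \<Longrightarrow> cdiff (\<lambda>x. \<Prod>i\<in>I. f i x) x"
  by (induction I rule: infinite_finite_induct) (auto intro: cdiff_const cdiff_mult)

lemma cdiff_bounded_linear:
  "bounded_linear f \<Longrightarrow> (\<And>v. f (csc \<i> v) = \<i> * f v) \<Longrightarrow> cdiff f x"
  unfolding cdiff_def by (intro exI[of _ f]) (simp add: bounded_linear_imp_has_derivative)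

lemma cdiff_coord:
  "cdiff (\<lambda>x. fst (fst x)) x" "cdiff (\<lambda>x. snd (fst x) $ i) x"
  "cdiff (\<lambda>x. fst (snd x)) x" "cdiff (\<lambda>x. snd (snd x) $ i) x"
  by (rule cdiff_bounded_linear; (intro bounded_linear_intros
      bounded_linear_compose[OF bounded_linear_vec_nth]
      bounded_linear_fst_comp bounded_linear_snd_comp bounded_linear_ident)?; simp)+

lemma cdiff_transform_open:
  "cdiff f x \<Longrightarrow> open S \<Longrightarrow> x \<in> S \<Longrightarrow> (\<And>y. y \<in> S \<Longrightarrow> f y = g y) \<Longrightarrow> cdiff g x"
  unfolding cdiff_def using has_derivative_transform_within_open by blast

lemma holo_on_imp_continuous_on: "holo_on G S \<Longrightarrow> continuous_on S G"
  unfolding holo_on_def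
  by (meson continuous_at_imp_continuous_on has_derivative_continuous)

text \<open>Cauchy's estimate for the restriction of f to the complex line through x in direction v;
  the parameter disc of radius r / norm v stays inside the ball.\<close>

lemma derivative_bound:
  assumes "holo_on f S" "cball x (r::real) \<subseteq> S" "r > 0"
    and M: "\<And>y. y \<in> cball x r \<Longrightarrow> norm (f y) \<le> M"
    and L: "(f has_derivative L) (at x)" "\<And>v. L (csc \<i> v) = \<i> * L v"
  shows "norm (L v) \<le> M / r * norm v"
proof (cases "v = 0")
  case True
  then show ?thesis using has_derivative_linear[OF L(1)] linear_0 by force
next
  case False
  define \<rho> where "\<rho> = r / norm v"
  have \<rho>: "\<rho> > 0" using False assms by (simp add: \<rho>_def)
  have inS: "x + csc z v \<in> cball x r" if "norm z \<le> \<rho>" for z :: complex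
    using that False by (simp add: dist_norm norm_csc \<rho>_def field_simps)
  have hol: "(\<lambda>z. f (x + csc z v)) holomorphic_on cball 0 \<rho>"
    unfolding holomorphic_on_def
  proof (intro ballI cdiff_line_differentiable)
    fix z :: complex assume "z \<in> cball 0 \<rho>"
    then have "x + csc z v \<in> S" using inS assms(2) by auto
    then show "cdiff f (x + csc z v)" using assms(1) by (auto simp: holo_on_cdiff)
  qed
  have "norm ((deriv ^^ 1) (\<lambda>z. f (x + csc z v)) 0) \<le> fact 1 * M / \<rho> ^ 1"
    by (rule Cauchy_inequality[OF holomorphic_on_subset[OF hol ball_subset_cball]
          holomorphic_on_imp_continuous_on[OF hol] \<rho>]) (auto intro!: M inS)
  moreover have "deriv (\<lambda>z. f (x + csc z v)) 0 = L v"
    using has_field_derivative_along_line[of f L x 0 v] L by (auto intro: DERIV_imp_deriv)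
  ultimately show ?thesis by (simp add: \<rho>_def mult_ac)
qed

text \<open>Weierstrass' convergence theorem. Applying \<open>derivative_bound\<close> to the
  differences \<open>G n - G m\<close> turns uniform convergence of the functions into uniform
  convergence of the derivatives; the limit is then differentiable, and commutation with i survives
  the limit.\<close>

lemma holo_on_uniform_limit:
  fixes G :: "nat \<Rightarrow> 'n::finite pt \<times> 'n pt \<Rightarrow> complex"
  assumes S: "open S" and hol: "\<And>n. holo_on (G n) S"
    and lim: "\<And>K. compact K \<Longrightarrow> K \<subseteq> S \<Longrightarrow> uniform_limit K G g sequentially"
  shows "holo_on g S"
  unfolding holo_on_cdiff
proof
  fix x0 assume "x0 \<in> S"
  then obtain e where e: "e > 0" "cball x0 e \<subseteq> S" using S open_contains_cball by blast
  \<comment> \<open>Half the radius, so that balls of radius r around points of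
    \<open>ball x0 r\<close> remain in the region of uniform convergence.\<close>
  define r where "r = e / 2"
  have r: "r > 0" "cball x0 (2 * r) \<subseteq> S" using e by (auto simp: r_def)
  have sub: "cball x r \<subseteq> cball x0 (2 * r)" if "x \<in> ball x0 r" for x
  proof
    fix y assume "y \<in> cball x r"
    then show "y \<in> cball x0 (2 * r)"
      using dist_triangle[of x0 y x] that by auto
  qed
  have inS: "x \<in> S" if "x \<in> ball x0 r" for x
    using sub[OF that] r by (meson centre_in_cball less_imp_le subsetD)
  have "\<forall>n. \<forall>x\<in>S. \<exists>L. (G n has_derivative L) (at x) \<and> (\<forall>v. L (csc \<i> v) = \<i> * L v)"
    using hol by (simp add: holo_on_def)
  then obtain L where L: "\<And>n x. x \<in> S \<Longrightarrow> (G n has_derivative L n x) (at x)"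
      "\<And>n x v. x \<in> S \<Longrightarrow> L n x (csc \<i> v) = \<i> * L n x v"
    by metis
  have ul: "uniform_limit (cball x0 (2 * r)) G g sequentially" by (rule lim) (use r in auto)
  have cauchy: "\<exists>N. \<forall>m\<ge>N. \<forall>n\<ge>N. \<forall>x\<in>ball x0 r. \<forall>v. norm (L n x v - L m x v) \<le> d * norm v" if d: "d > 0" for d
  proof -
    have "uniformly_Cauchy_on (cball x0 (2 * r)) G"
      using ul by (intro uniformly_convergent_Cauchy) (auto simp: uniformly_convergent_on_def)
    \<comment> \<open>The tolerance carries a factor r because \<open>derivative_bound\<close>
      divides by the radius.\<close>
    then obtain N where N: "\<And>x m n. x \<in> cball x0 (2 * r) \<Longrightarrow> m \<ge> N \<Longrightarrow> n \<ge> N \<Longrightarrow> dist (G m x) (G n x) < d * r"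
      using d r unfolding uniformly_Cauchy_on_def by (meson mult_pos_pos)
    show ?thesis
    proof (intro exI[of _ N] allI impI ballI)
      fix m n x v assume mn: "m \<ge> N" "n \<ge> N" and x: "x \<in> ball x0 r"
      have "norm ((\<lambda>v. L n x v - L m x v) v) \<le> d * r / r * norm v"
      proof (rule derivative_bound[where f = "\<lambda>x. G n x - G m x" and S = S and x = x and r = r])
        show "holo_on (\<lambda>x. G n x - G m x) S"
          using hol[of n] hol[of m] unfolding holo_on_cdiff
          by (auto intro: cdiff_add[of _ _ "\<lambda>x. - G m x", simplified] cdiff_cmult[of _ _ "-1", simplified])
        show "((\<lambda>x. G n x - G m x) has_derivative (\<lambda>v. L n x v - L m x v)) (at x)"
          by (intro has_derivative_diff L inS x)
        show "norm (G n y - G m y) \<le> d * r" if "y \<in> cball x r" for y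
          using N[of y n m] mn that sub[OF x] by (auto simp: dist_norm)
      qed (use r sub[OF x] L(2)[OF inS[OF x]] in \<open>auto simp: right_diff_distrib\<close>)
      then show "norm (L n x v - L m x v) \<le> d * norm v" using r by simp
    qed
  qed
  define g' where "g' x v = lim (\<lambda>n. L n x v)" for x v
  have limL: "(\<lambda>n. L n x v) \<longlonglongrightarrow> g' x v" if x: "x \<in> ball x0 r" for x v
  proof -
    have "Cauchy (\<lambda>n. L n x v)"
    proof (rule metric_CauchyI)
      fix d :: real assume "d > 0"
      then have "d / (norm v + 1) > 0" by (simp add: add_nonneg_pos)
      from cauchy[OF this] x obtain N where N: "\<And>m n. m \<ge> N \<Longrightarrow> n \<ge> N \<Longrightarrow> norm (L n x v - L m x v) \<le> d / (norm v + 1) * norm v"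
        by blast
      have "d / (norm v + 1) * norm v < d"
        using \<open>d > 0\<close> by (simp add: pos_divide_less_eq[OF add_nonneg_pos[OF norm_ge_zero zero_less_one]] distrib_left)
      then show "\<exists>M. \<forall>m\<ge>M. \<forall>n\<ge>M. dist (L m x v) (L n x v) < d"
        using N by (intro exI[of _ N]) (auto simp: dist_norm intro: le_less_trans)
    qed
    then show ?thesis unfolding g'_def by (simp add: Cauchy_convergent_iff convergent_LIMSEQ_iff)
  qed
  have "\<exists>h. \<forall>x\<in>ball x0 r. (\<lambda>n. G n x) \<longlonglongrightarrow> h x \<and> (h has_derivative g' x) (at x within ball x0 r)"
  proof (rule has_derivative_sequence)
    show "(G n has_derivative L n x) (at x within ball x0 r)" if "x \<in> ball x0 r" for n x
      using L(1)[OF inS[OF that]] by (rule has_derivative_at_withinI)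
    show "\<forall>\<^sub>F n in sequentially. \<forall>x\<in>ball x0 r. \<forall>v. norm (L n x v - g' x v) \<le> d * norm v" if d: "d > 0" for d
    proof -
      obtain N where N: "\<And>m n x v. m \<ge> N \<Longrightarrow> n \<ge> N \<Longrightarrow> x \<in> ball x0 r \<Longrightarrow> norm (L n x v - L m x v) \<le> d * norm v"
        using cauchy[OF d] by blast
      have "norm (L n x v - g' x v) \<le> d * norm v" if "n \<ge> N" "x \<in> ball x0 r" for n x v
      proof (rule tendsto_upperbound)
        show "(\<lambda>m. norm (L n x v - L m x v)) \<longlonglongrightarrow> norm (L n x v - g' x v)"
          by (intro tendsto_intros limL that)
        show "\<forall>\<^sub>F m in sequentially. norm (L n x v - L m x v) \<le> d * norm v"
          using eventually_ge_at_top[of N] by eventually_elim (use N that in auto)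
      qed auto
      then show ?thesis unfolding eventually_sequentially by blast
    qed
    show "(\<lambda>n. G n x0) \<longlonglongrightarrow> g x0"
      using tendsto_uniform_limitI[OF ul] r by simp
  qed (use r in auto)
  then obtain h where h: "\<And>x. x \<in> ball x0 r \<Longrightarrow> (\<lambda>n. G n x) \<longlonglongrightarrow> h x"
      "\<And>x. x \<in> ball x0 r \<Longrightarrow> (h has_derivative g' x) (at x within ball x0 r)" by blast
  have hg: "h x = g x" if "x \<in> ball x0 r" for x
  proof -
    have "x \<in> cball x0 (2 * r)" using that r by auto
    then show ?thesis using h(1)[OF that] tendsto_uniform_limitI[OF ul] LIMSEQ_unique by blast
  qed
  have x0: "x0 \<in> ball x0 r" using r by simp
  have "(h has_derivative g' x0) (at x0)" using h(2)[OF x0] at_within_open[OF x0] by simp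
  moreover have "g' x0 (csc \<i> v) = \<i> * g' x0 v" for v
  proof -
    have "(\<lambda>n. \<i> * L n x0 v) \<longlonglongrightarrow> \<i> * g' x0 v" by (intro tendsto_intros limL x0)
    moreover have "(\<lambda>n. \<i> * L n x0 v) \<longlonglongrightarrow> g' x0 (csc \<i> v)"
      using limL[OF x0, of "csc \<i> v"] by (simp add: L(2)[OF inS[OF x0]])
    ultimately show ?thesis using LIMSEQ_unique by blast
  qed
  ultimately have "cdiff h x0" unfolding cdiff_def by blast
  then show "cdiff g x0" by (rule cdiff_transform_open[OF _ open_ball x0]) (use hg in auto)
qed

section \<open>The extensions of f_{P,Q} and the space of invariant holomorphic functions\<close>

definition ptpow :: "'n::finite pt \<Rightarrow> 'n mi \<Rightarrow> complex" where
  "ptpow p P = fst p ^ fst P * wpow (snd p) (snd P)"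

text \<open>The monomial p^P q^Q evaluated at the normalised representative (p, - q / bil p q). For
  |P| = |Q| the degree of the denominator matches both scalings.\<close>

definition fPh :: "'n::finite mi \<Rightarrow> 'n mi \<Rightarrow> 'n pt \<times> 'n pt \<Rightarrow> complex" where
  "fPh P Q x = (if x \<in> Uset then ptpow (fst x) P * ptpow (snd x) Q / (- bil (fst x) (snd x)) ^ mabs P else 0)"

lemma in_Uset: "x \<in> Uset \<longleftrightarrow> bil (fst x) (snd x) \<noteq> 0"
  by (auto simp: Uset_def)

lemma cdiff_bil: "cdiff (\<lambda>x. bil (fst x) (snd x)) x"
proof -
  have "cdiff (\<lambda>x. (-1) * (fst (fst x) * fst (snd x)) + (\<Sum>i\<in>UNIV. snd (fst x) $ i * snd (snd x) $ i)) x"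
    by (intro cdiff_add cdiff_cmult cdiff_mult cdiff_sum cdiff_coord)
  then show ?thesis by (simp add: bil_def)
qed

lemma open_Uset: "open (Uset :: ('n::finite pt \<times> 'n pt) set)"
proof -
  have "holo_on (\<lambda>x::'n pt \<times> 'n pt. bil (fst x) (snd x)) UNIV" by (simp add: holo_on_cdiff cdiff_bil)
  then have "continuous_on UNIV (\<lambda>x::'n pt \<times> 'n pt. bil (fst x) (snd x))" by (rule holo_on_imp_continuous_on)
  then have "open {x::'n pt \<times> 'n pt. bil (fst x) (snd x) \<noteq> 0}"
    by (intro open_Collect_neq) (auto intro: continuous_on_const)
  then show ?thesis by (simp add: Uset_def case_prod_unfold)
qed

lemma bil_sc: "bil (sc z p) (sc u q) = z * u * bil p q"
  by (simp add: bil_def sc_def sum_distrib_left algebra_simps)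

lemma ptpow_sc: "ptpow (sc z p) P = z ^ mabs P * ptpow p P"
  by (simp add: ptpow_def sc_def wpow_def mabs_def power_mult_distrib prod.distrib power_add power_sum)

lemma OhatD:
  assumes "G \<in> Ohat"
  shows "holo_on G Uset" "x \<notin> Uset \<Longrightarrow> G x = 0"
    "(p, q) \<in> Uset \<Longrightarrow> z \<noteq> 0 \<Longrightarrow> u \<noteq> 0 \<Longrightarrow> G (sc z p, sc u q) = G (p, q)"
  using assms unfolding Ohat_def by blast+

lemma Ohat_continuous: "G \<in> Ohat \<Longrightarrow> continuous_on Uset G"
  using OhatD(1) holo_on_imp_continuous_on by blast

lemma cdiff_ptpow: "cdiff (\<lambda>x. ptpow (fst x) P) x" "cdiff (\<lambda>x. ptpow (snd x) P) x"
  unfolding ptpow_def wpow_def by (intro cdiff_mult cdiff_power cdiff_prod cdiff_coord)+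

lemma fPh_in_Ohat:
  assumes "mabs P = mabs Q"
  shows "fPh P Q \<in> Ohat"
  unfolding Ohat_def
proof (intro CollectI conjI allI impI)
  show "holo_on (fPh P Q) Uset"
    unfolding holo_on_cdiff
  proof
    fix x :: "'a pt \<times> 'a pt" assume x: "x \<in> Uset"
    have "cdiff (\<lambda>x. ptpow (fst x) P * ptpow (snd x) Q * inverse ((- 1 * bil (fst x) (snd x)) ^ mabs P)) x"
      using x by (intro cdiff_mult[of _ _ "\<lambda>x. inverse _"] cdiff_mult cdiff_ptpow cdiff_inverse cdiff_power cdiff_cmult cdiff_bil)
        (auto simp: in_Uset)
    then show "cdiff (fPh P Q) x"
      by (rule cdiff_transform_open[OF _ open_Uset x]) (simp add: fPh_def divide_inverse)
  qed
next
  fix p q :: "'a pt" and z u :: complex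
  assume "(p, q) \<in> Uset" "z \<noteq> 0" "u \<noteq> 0"
  moreover have "(- (z * u * b)) ^ k = z ^ k * u ^ k * (- b) ^ k" for b k
    by (simp add: power_mult_distrib[symmetric])
  ultimately show "fPh P Q (sc z p, sc u q) = fPh P Q (p, q)"
    using assms by (simp add: fPh_def in_Uset bil_sc ptpow_sc)
qed (simp add: fPh_def)

lemma wdot_norm: "wdot w = of_real ((norm w)\<^sup>2)"
  by (simp add: wdot_def norm_vec_def L2_set_def sum_nonneg of_real_sum complex_norm_square[symmetric] flip: of_real_power)

lemma wdot_ball:
  assumes "w \<in> ball 0 1"
  shows "wdot w \<noteq> 1"
proof -
  have "(norm w)\<^sup>2 < 1" using assms by (simp add: abs_square_less_1)
  then show ?thesis unfolding wdot_norm by (metis less_irrefl of_real_eq_1_iff)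
qed

lemma bil_emb: "bil (1, w) (1, cnjv w) = wdot w - 1"
  by (simp add: bil_def wdot_def cnjv_def)

lemma emb_in_Uset: "w \<in> ball 0 1 \<Longrightarrow> ((1, w), (1, cnjv w)) \<in> Uset"
  using wdot_ball by (auto simp: in_Uset bil_emb)

lemma emb_fPh: "emb (fPh P Q) = fP P Q"
  by (auto simp: fun_eq_iff emb_def fP_def fPh_def emb_in_Uset bil_emb ptpow_def)

lemma Ohat_add: "G \<in> Ohat \<Longrightarrow> G' \<in> Ohat \<Longrightarrow> (\<lambda>x. G x + G' x) \<in> Ohat"
  unfolding Ohat_def holo_on_cdiff by (auto intro: cdiff_add)

lemma Ohat_cmult: "G \<in> Ohat \<Longrightarrow> (\<lambda>x. c * G x) \<in> Ohat"
  unfolding Ohat_def holo_on_cdiff by (auto intro: cdiff_cmult)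

lemma Ohat_zero: "(\<lambda>_. 0) \<in> Ohat"
  unfolding Ohat_def holo_on_cdiff by (auto intro: cdiff_const)

lemma Ohat_diff: "G \<in> Ohat \<Longrightarrow> G' \<in> Ohat \<Longrightarrow> (\<lambda>x. G x - G' x) \<in> Ohat"
  using Ohat_add[OF _ Ohat_cmult[of G' "-1"], of G] by simp

lemma Ohat_sum: "(\<And>i. i \<in> I \<Longrightarrow> G i \<in> Ohat) \<Longrightarrow> (\<lambda>x. \<Sum>i\<in>I. G i x) \<in> Ohat"
  by (induction I rule: infinite_finite_induct) (auto intro: Ohat_zero Ohat_add)

text \<open>Countability of the index type provides a cofinal sequence of finite index sets. Along
  it the M-test gives uniform convergence on compact sets, and \<open>holo_on_uniform_limit\<close>
  applies.\<close>

lemma Ohat_infsum: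
  fixes G :: "'i::countable \<Rightarrow> 'n::finite pt \<times> 'n pt \<Rightarrow> complex"
  assumes G: "\<And>i. G i \<in> Ohat"
    and sm: "\<And>C. C \<in> cpts \<Longrightarrow> \<exists>M. M summable_on UNIV \<and> (\<forall>i. \<forall>x\<in>C. norm (G i x) \<le> M i)"
  shows "(\<lambda>x. \<Sum>\<^sub>\<infinity>i. G i x) \<in> Ohat"
proof -
  define F where "F n = {i::'i. to_nat i < n}" for n
  have finF: "finite (F n)" for n
    unfolding F_def by (rule finite_imageD[of to_nat]) (auto intro: finite_subset[of _ "{..<n}"] inj_on_subset[OF inj_to_nat])
  have limF: "filterlim F (finite_subsets_at_top UNIV) sequentially"
    unfolding filterlim_finite_subsets_at_top
  proof (intro allI impI)
    fix X :: "'i set" assume "finite X \<and> X \<subseteq> UNIV"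
    then have "finite (to_nat ` X)" by simp
    then obtain N where N: "\<forall>n\<in>to_nat ` X. n < N" using finite_nat_set_iff_bounded by blast
    show "\<forall>\<^sub>F n in sequentially. finite (F n) \<and> X \<subseteq> F n \<and> F n \<subseteq> UNIV"
      using eventually_ge_at_top[of N]
      by eventually_elim (use N finF in \<open>auto simp: F_def intro: less_le_trans\<close>)
  qed
  have "holo_on (\<lambda>x. \<Sum>\<^sub>\<infinity>i. G i x) Uset"
  proof (rule holo_on_uniform_limit[OF open_Uset, where G = "\<lambda>n x. \<Sum>i\<in>F n. G i x"])
    show "holo_on (\<lambda>x. \<Sum>i\<in>F n. G i x) Uset" for n
      by (rule OhatD(1)[OF Ohat_sum[OF G]])
    fix K :: "('n pt \<times> 'n pt) set" assume K: "compact K" "K \<subseteq> Uset"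
    show "uniform_limit K (\<lambda>n x. \<Sum>i\<in>F n. G i x) (\<lambda>x. \<Sum>\<^sub>\<infinity>i. G i x) sequentially"
    proof (cases "K = {}")
      case False
      then obtain M where M: "M summable_on UNIV" "\<And>i x. x \<in> K \<Longrightarrow> norm (G i x) \<le> M i"
        using K sm[of K] by (auto simp: cpts_def)
      have "uniform_limit K (\<lambda>X y. \<Sum>i\<in>X. G i y) (\<lambda>y. \<Sum>\<^sub>\<infinity>i. G i y) (finite_subsets_at_top UNIV)"
        by (rule Weierstrass_m_test_general[OF _ M(1)]) (use M(2) in auto)
      from filterlim_compose[OF this limF] show ?thesis by simp
    qed (simp add: uniform_limit_on_empty)
  qed
  then show ?thesis
    unfolding Ohat_def using OhatD(2,3)[OF G] by (auto intro!: infsum_cong)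
qed

text \<open>Adding the same small t to both zeroth coordinates makes them nonzero without leaving
  the open set U, so such points are dense and continuity finishes. Up to scaling these are the
  points in the overlap of the two charts.\<close>

lemma Ohat_eq_generic:
  fixes G G' :: "'n::finite pt \<times> 'n pt \<Rightarrow> complex"
  assumes G: "G \<in> Ohat" "G' \<in> Ohat"
    and eq: "\<And>x. x \<in> Uset \<Longrightarrow> fst (fst x) \<noteq> 0 \<Longrightarrow> fst (snd x) \<noteq> 0 \<Longrightarrow> G x = G' x"
  shows "G = G'"
proof
  fix x :: "'n pt \<times> 'n pt"
  show "G x = G' x"
  proof (cases "x \<in> Uset")
    case True
    define \<phi> where "\<phi> t = x + csc t ((1, 0), (1, 0))" for t
    have "isCont \<phi> 0"
      unfolding \<phi>_def
      by (intro continuous_intros linear_continuous_at bounded_linear_csc_left)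
    then have lim: "(\<phi> \<longlongrightarrow> x) (at 0)"
      by (simp add: isCont_def \<phi>_def)
    have ev: "\<forall>\<^sub>F t in at 0. \<phi> t \<in> Uset"
      using topological_tendstoD[OF lim open_Uset True] .
    have ne: "\<forall>\<^sub>F t in at (0::complex). a + t \<noteq> 0" for a
    proof (cases "a = 0")
      case False
      have "((\<lambda>t. a + t) \<longlongrightarrow> a + 0) (at 0)" by (intro tendsto_intros)
      then show ?thesis using False by (intro tendsto_imp_eventually_ne) auto
    qed (simp add: eventually_at_filter)
    have evG: "\<forall>\<^sub>F t in at 0. G (\<phi> t) = G' (\<phi> t)"
      using ev ne[of "fst (fst x)"] ne[of "fst (snd x)"]
      by eventually_elim (auto intro!: eq simp: \<phi>_def)
    have limH: "((\<lambda>t. H (\<phi> t)) \<longlongrightarrow> H x) (at 0)" if "H \<in> Ohat" for H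
    proof -
      have "isCont H x"
        using Ohat_continuous[OF that] True continuous_on_eq_continuous_at[OF open_Uset] by blast
      then show ?thesis using lim isCont_tendsto_compose by blast
    qed
    have "((\<lambda>t. G (\<phi> t)) \<longlongrightarrow> G' x) (at 0)"
      using limH[OF G(2)] tendsto_cong[OF evG] by simp
    then show ?thesis using tendsto_unique[OF at_neq_bot limH[OF G(1)]] by blast
  next
    case False
    then show ?thesis using OhatD(2)[OF G(1) False] OhatD(2)[OF G(2) False] by simp
  qed
qed

section \<open>The two charts\<close>

definition chart1 :: "('n::finite + 'n \<Rightarrow> complex) \<Rightarrow> 'n pt \<times> 'n pt" where
  "chart1 x = ((1, \<chi> i. x (Inl i)), (1 + (\<Sum>i\<in>UNIV. x (Inl i) * x (Inr i)), \<chi> i. x (Inr i)))"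

definition chart2 :: "('n::finite + 'n \<Rightarrow> complex) \<Rightarrow> 'n pt \<times> 'n pt" where
  "chart2 x = ((1 + (\<Sum>i\<in>UNIV. x (Inl i) * x (Inr i)), \<chi> i. x (Inl i)), (1, \<chi> i. x (Inr i)))"

lemma bil_chart: "bil (fst (chart1 x)) (snd (chart1 x)) = -1" "bil (fst (chart2 x)) (snd (chart2 x)) = -1"
  by (simp_all add: chart1_def chart2_def bil_def)

lemma chart_in_Uset: "chart1 x \<in> Uset" "chart2 x \<in> Uset"
  by (simp_all add: in_Uset bil_chart)

lemma sum_affine:
  fixes a b :: "'n::finite \<Rightarrow> complex"
  shows "(\<Sum>k\<in>UNIV. (if k = i then z else a k) * b k) = (\<Sum>k\<in>UNIV. (if k = i then 0 else a k) * b k) + z * b i"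
proof -
  have "(if k = i then z else a k) * b k = (if k = i then 0 else a k) * b k + (if k = i then z * b k else 0)" for k
    by simp
  then show ?thesis by (simp add: sum.distrib)
qed

text \<open>The pairing p.q is bilinear, hence affine in each single coordinate; varying one
  coordinate therefore traces a complex line, and \<open>cdiff_line_differentiable\<close> becomes
  applicable.\<close>

lemma chart_line:
  "\<exists>y v. \<forall>z. chart1 (x(j := z)) = y + csc z v" "\<exists>y v. \<forall>z. chart2 (x(j := z)) = y + csc z v"
proof -
  have s: "(x(Inl i := z)) (Inl k) = (if k = i then z else x (Inl k))"
       "(x(Inr i := z)) (Inr k) = (if k = i then z else x (Inr k))"
       "(x(Inl i := z)) (Inr k) = x (Inr k)" "(x(Inr i := z)) (Inl k) = x (Inl k)" for i z k by auto
  have t: "(\<Sum>k\<in>UNIV. x (Inl k) * (if k = i then z else x (Inr k))) =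
      (\<Sum>k\<in>UNIV. x (Inl k) * (if k = i then 0 else x (Inr k))) + z * x (Inl i)" for i z
    using sum_affine[of i z "\<lambda>k. x (Inr k)" "\<lambda>k. x (Inl k)"] by (simp add: mult.commute)
  note u = sum_affine[of _ _ "\<lambda>k. x (Inl k)" "\<lambda>k. x (Inr k)"]
  show "\<exists>y v. \<forall>z. chart1 (x(j := z)) = y + csc z v"
  proof (cases j)
    case (Inl i)
    have "chart1 (x(j := z)) = chart1 (x(j := 0)) + csc z (((0, axis i 1), (x (Inr i), 0)))" for z
      by (rule pt2_eqI) (simp_all add: Inl chart1_def s u[of i z] axis_def del: fun_upd_apply)
    then show ?thesis by blast
  next
    case (Inr i)
    have "chart1 (x(j := z)) = chart1 (x(j := 0)) + csc z (((0, 0), (x (Inl i), axis i 1)))" for z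
      by (rule pt2_eqI) (simp_all add: Inr chart1_def s t[of i z] axis_def del: fun_upd_apply)
    then show ?thesis by blast
  qed
  show "\<exists>y v. \<forall>z. chart2 (x(j := z)) = y + csc z v"
  proof (cases j)
    case (Inl i)
    have "chart2 (x(j := z)) = chart2 (x(j := 0)) + csc z (((x (Inr i), axis i 1), (0, 0)))" for z
      by (rule pt2_eqI) (simp_all add: Inl chart2_def s u[of i z] axis_def del: fun_upd_apply)
    then show ?thesis by blast
  next
    case (Inr i)
    have "chart2 (x(j := z)) = chart2 (x(j := 0)) + csc z (((x (Inl i), 0), (0, axis i 1)))" for z
      by (rule pt2_eqI) (simp_all add: Inr chart2_def s t[of i z] axis_def del: fun_upd_apply)
    then show ?thesis by blast
  qed
qed

text \<open>Both charts are included so that a single seminorm controls the Cauchy estimates of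
  either kind of coefficient.\<close>

definition pdisc :: "real \<Rightarrow> ('n::finite pt \<times> 'n pt) set" where
  "pdisc R = chart1 ` {x. \<forall>j. norm (x j) \<le> R} \<union> chart2 ` {x. \<forall>j. norm (x j) \<le> R}"

lemma compact_pdisc: "compact (pdisc R :: ('n::finite pt \<times> 'n pt) set)"
proof -
  \<comment> \<open>The coordinate functions are moved to a Euclidean type, where compactness is
    closedness together with boundedness.\<close>
  define D where "D = {v::complex ^ ('n + 'n). \<forall>j. norm (v $ j) \<le> R}"
  have "bounded D"
    unfolding bounded_iff
  proof (intro exI ballI)
    fix v assume "v \<in> D"
    then have "(\<Sum>j\<in>UNIV. norm (v $ j)) \<le> (\<Sum>j\<in>(UNIV :: ('n + 'n) set). R)"
      by (intro sum_mono) (auto simp: D_def)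
    then show "norm v \<le> (\<Sum>j\<in>(UNIV :: ('n + 'n) set). R)"
      unfolding norm_vec_def using L2_set_le_sum[of UNIV "\<lambda>j. norm (v $ j)"] by simp
  qed
  moreover have "closed D"
    unfolding D_def by (intro closed_Collect_all closed_Collect_le continuous_intros)
  ultimately have D: "compact D" by (simp add: compact_eq_bounded_closed)
  have "{x. \<forall>j. norm (x j) \<le> R} = vec_nth ` D"
  proof -
    have "x = vec_nth (\<chi> j. x j)" for x :: "'n + 'n \<Rightarrow> complex" by auto
    then show ?thesis unfolding D_def by (force simp: image_iff)
  qed
  then have "pdisc R = (\<lambda>v. chart1 (vec_nth v)) ` D \<union> (\<lambda>v. chart2 (vec_nth v)) ` D"
    by (simp add: pdisc_def image_image)
  moreover have "continuous_on D (\<lambda>v. chart1 (vec_nth v))" "continuous_on D (\<lambda>v. chart2 (vec_nth v))"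
    unfolding chart1_def chart2_def by (intro continuous_intros continuous_on_vec_lambda)+
  ultimately show ?thesis by (simp add: compact_Un compact_continuous_image D)
qed

lemma pdisc_cpts: "R \<ge> 0 \<Longrightarrow> pdisc R \<in> cpts"
  unfolding cpts_def using compact_pdisc chart_in_Uset
  by (auto simp: pdisc_def intro!: exI[of _ "\<lambda>_. 0"])


lemma Ohat_chart_holomorphic:
  assumes G: "G \<in> Ohat"
  shows "(\<lambda>z. G (chart1 (x(j := z)))) holomorphic_on A" "(\<lambda>z. G (chart2 (x(j := z)))) holomorphic_on A"
proof -
  have *: "(\<lambda>z. G (f z)) holomorphic_on A" if U: "\<And>z. f z \<in> Uset" and line: "\<exists>y v. \<forall>z. f z = y + csc z v" for f
  proof -
    obtain y v where f: "\<And>z. f z = y + csc z v" using line by blast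
    show ?thesis
      unfolding holomorphic_on_def f
      by (intro ballI cdiff_line_differentiable)
         (use OhatD(1)[OF G] U in \<open>auto simp: holo_on_cdiff f\<close>)
  qed
  show "(\<lambda>z. G (chart1 (x(j := z)))) holomorphic_on A" "(\<lambda>z. G (chart2 (x(j := z)))) holomorphic_on A"
    by (intro * chart_in_Uset chart_line)+
qed

lemma Ohat_bounded:
  assumes "G \<in> Ohat" "compact C" "C \<subseteq> Uset"
  obtains M where "\<And>x. x \<in> C \<Longrightarrow> norm (G x) \<le> M"
proof -
  have "bounded (G ` C)"
    by (intro compact_imp_bounded compact_continuous_image assms continuous_on_subset[OF Ohat_continuous])
  then show ?thesis using that unfolding bounded_iff by blast
qed

lemma pdisc_subset: "pdisc R \<subseteq> Uset"
  using chart_in_Uset by (auto simp: pdisc_def)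

lemma sep_entire_chart:
  assumes G: "G \<in> Ohat"
  shows "sep_entire (\<lambda>x. G (chart1 x))" "sep_entire (\<lambda>x. G (chart2 x))"
proof -
  have "\<exists>M. \<forall>x. (\<forall>j. norm (x j) \<le> R) \<longrightarrow> norm (G (chart1 x)) \<le> M \<and> norm (G (chart2 x)) \<le> M" for R
  proof -
    obtain M where "\<And>x. x \<in> pdisc R \<Longrightarrow> norm (G x) \<le> M"
      using Ohat_bounded[OF G compact_pdisc pdisc_subset[of R]] by blast
    then show ?thesis by (intro exI[of _ M]) (simp add: pdisc_def)
  qed
  then show "sep_entire (\<lambda>x. G (chart1 x))" "sep_entire (\<lambda>x. G (chart2 x))"
    unfolding sep_entire_def using Ohat_chart_holomorphic[OF G] by blast+
qed

text \<open>Scaling p to zeroth coordinate 1 leaves no choice for q: the form equals -1 on the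
  chart, so the product of both factors must be - bil p q. The last clause says that a point with
  both zeroth coordinates nonzero lands in the overlap with the second chart.\<close>

lemma chart1_scaling:
  fixes p q :: "'n::finite pt"
  assumes "(p, q) \<in> Uset" "fst p \<noteq> 0"
  obtains x z u where "z \<noteq> 0" "u \<noteq> 0" "p = sc z (fst (chart1 x))" "q = sc u (snd (chart1 x))"
    "fst q \<noteq> 0 \<Longrightarrow> 1 + (\<Sum>i\<in>UNIV. x (Inl i) * x (Inr i)) \<noteq> 0"
proof
  define b where "b = bil p q"
  have b: "b \<noteq> 0" using assms by (simp add: b_def in_Uset)
  define x where "x = case_sum (\<lambda>i. snd p $ i / fst p) (\<lambda>i. - fst p * snd q $ i / b)"
  have xs: "x (Inl i) = snd p $ i / fst p" "x (Inr i) = - fst p * snd q $ i / b" for i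
    by (simp_all add: x_def)
  have "(\<Sum>i\<in>UNIV. x (Inl i) * x (Inr i)) = - (\<Sum>i\<in>UNIV. snd p $ i * snd q $ i) / b"
    using assms by (simp add: xs sum_divide_distrib sum_negf)
  also have "(\<Sum>i\<in>UNIV. snd p $ i * snd q $ i) = b + fst p * fst q" by (simp add: b_def bil_def)
  finally have S: "(\<Sum>i\<in>UNIV. x (Inl i) * x (Inr i)) = - (b + fst p * fst q) / b" .
  have s: "1 + (\<Sum>i\<in>UNIV. x (Inl i) * x (Inr i)) = - (fst p * fst q) / b"
    unfolding S using b by (simp add: field_simps)
  show "p = sc (fst p) (fst (chart1 x))"
    using assms by (auto simp: sc_def chart1_def prod_eq_iff vec_eq_iff xs)
  have "snd (chart1 x) = (- (fst p * fst q) / b, \<chi> i. x (Inr i))" by (simp add: chart1_def s)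
  then show "q = sc (- b / fst p) (snd (chart1 x))"
    using assms b by (auto simp: sc_def prod_eq_iff vec_eq_iff xs)
  show "1 + (\<Sum>i\<in>UNIV. x (Inl i) * x (Inr i)) \<noteq> 0" if "fst q \<noteq> 0"
    using assms b that by (simp add: s)
  show "fst p \<noteq> 0" "- b / fst p \<noteq> 0" using assms b by auto
qed

text \<open>Real points form a set of uniqueness. The coordinates are released from being real one
  at a time, each by the identity theorem on a disc whose real points accumulate at 0.\<close>

lemma vanish_from_real:
  fixes \<Phi> :: "('j::finite \<Rightarrow> complex) \<Rightarrow> complex"
  assumes hol: "\<And>x j. (\<And>i. norm (x i) < \<delta>) \<Longrightarrow> (\<lambda>z. \<Phi> (x(j := z))) holomorphic_on ball 0 \<delta>"
    and real: "\<And>x. (\<And>i. norm (x i) < \<delta>) \<Longrightarrow> (\<And>i. x i \<in> \<real>) \<Longrightarrow> \<Phi> x = 0"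
    and x: "\<And>i. norm (x i) < \<delta>"
  shows "\<Phi> x = 0"
proof -
  have "\<forall>x. (\<forall>i. norm (x i) < \<delta>) \<longrightarrow> (\<forall>i. i \<notin> J \<longrightarrow> x i \<in> \<real>) \<longrightarrow> \<Phi> x = 0" if "finite J" for J
    using that
  proof (induction J)
    case empty
    then show ?case using real by auto
  next
    case (insert j J)
    show ?case
    proof (intro allI impI)
      fix x :: "'j \<Rightarrow> complex" assume x: "\<forall>i. norm (x i) < \<delta>" "\<forall>i. i \<notin> insert j J \<longrightarrow> x i \<in> \<real>"
      have \<delta>: "\<delta> > 0" using x(1) norm_ge_zero le_less_trans by blast
      have "\<Phi> (x(j := x j)) = 0"
      proof (rule analytic_continuation[where f = "\<lambda>z. \<Phi> (x(j := z))" and U = "ball 0 \<delta> \<inter> \<real>" and \<xi> = 0])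
        show "(0::complex) islimpt ball 0 \<delta> \<inter> \<real>"
          unfolding islimpt_approachable
        proof (intro allI impI)
          fix e :: real assume "e > 0"
          then show "\<exists>x'\<in>ball 0 \<delta> \<inter> \<real>. x' \<noteq> (0::complex) \<and> dist x' 0 < e"
            using \<delta> by (intro bexI[of _ "of_real (min e \<delta> / 2)"]) auto
        qed
        show "\<Phi> (x(j := z)) = 0" if "z \<in> ball 0 \<delta> \<inter> \<real>" for z
          using insert.IH x that by (auto simp: dist_norm)
      qed (use hol x \<delta> in auto)
      then show "\<Phi> x = 0" by simp
    qed
  qed
  from this[of UNIV] x show ?thesis by simp
qed

lemma norm_bil_small:
  fixes x y :: "'n::finite \<Rightarrow> complex"
  assumes "\<And>i. norm (x i) \<le> r" "\<And>i. norm (y i) \<le> r" "r \<ge> 0"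
  shows "norm (\<Sum>i\<in>UNIV. x i * y i) \<le> real CARD('n) * r\<^sup>2"
proof -
  have "norm (\<Sum>i\<in>UNIV. x i * y i) \<le> (\<Sum>i\<in>(UNIV::'n set). r * r)"
    by (intro sum_norm_le) (auto simp: norm_mult intro!: mult_mono assms)
  then show ?thesis by (simp add: power2_eq_square)
qed

text \<open>In the coordinates p = s + i t, q = s - i t the embedded disc is the set of real points (s,t).\<close>

lemma emb_zero_imp_chart1_zero:
  fixes G :: "'n::finite pt \<times> 'n pt \<Rightarrow> complex"
  assumes G: "G \<in> Ohat" and z: "\<And>w. emb G w = 0"
  shows "\<exists>r>0. \<forall>x. (\<forall>j. norm (x j) \<le> r) \<longrightarrow> G (chart1 x) = 0"
proof -
  define N where "N = real CARD('n)"
  have N: "N \<ge> 1" unfolding N_def by (simp add: Suc_leI)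
  \<comment> \<open>With N coordinates of size below this \<delta>, each of s.s and t.t is at most N
    \<delta>^2 <= 1/4 in norm, which keeps the form away from 0.\<close>
  define \<delta> where "\<delta> = 1 / (2 * N)"
  have \<delta>: "\<delta> > 0" "\<delta> \<le> 1" "N * \<delta>\<^sup>2 \<le> 1 / 4"
    using N by (auto simp: \<delta>_def power2_eq_square field_simps)
  define ch where "ch x = ((1::complex, \<chi> i. x (Inl i) + \<i> * x (Inr i)), (1::complex, \<chi> i. x (Inl i) - \<i> * x (Inr i)))"
    for x :: "'n + 'n \<Rightarrow> complex"
  have bil_ch: "bil (fst (ch x)) (snd (ch x)) = (\<Sum>i\<in>UNIV. x (Inl i) * x (Inl i)) + (\<Sum>i\<in>UNIV. x (Inr i) * x (Inr i)) - 1" for x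
    by (simp add: ch_def bil_def sum.distrib[symmetric] algebra_simps)
  have small: "norm ((\<Sum>i\<in>UNIV. x (Inl i) * x (Inl i)) + (\<Sum>i\<in>UNIV. x (Inr i) * x (Inr i))) \<le> 1 / 2"
    if "\<And>j. norm (x j) < \<delta>" for x :: "'n + 'n \<Rightarrow> complex"
  proof -
    have "norm (\<Sum>i\<in>UNIV. x (Inl i) * x (Inl i)) \<le> N * \<delta>\<^sup>2" "norm (\<Sum>i\<in>UNIV. x (Inr i) * x (Inr i)) \<le> N * \<delta>\<^sup>2"
      unfolding N_def by (rule norm_bil_small; use that \<delta> in \<open>auto intro: less_imp_le\<close>)+
    then show ?thesis using \<delta>(3) by (intro norm_triangle_le) linarith
  qed
  have inU: "ch x \<in> Uset" if "\<And>j. norm (x j) < \<delta>" for x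
    using small[of x, OF that] by (auto simp: in_Uset bil_ch)
  have chz: "G (ch x) = 0" if "\<And>j. norm (x j) < \<delta>" for x
  proof (rule vanish_from_real[where \<delta> = \<delta> and \<Phi> = "\<lambda>x. G (ch x)", OF _ _ that])
    fix x :: "'n + 'n \<Rightarrow> complex" and j assume x: "\<And>i. norm (x i) < \<delta>"
    have "\<exists>y v. \<forall>z. ch (x(j := z)) = y + csc z v"
    proof (cases j)
      case (Inl i)
      have "ch (x(j := z)) = ch (x(j := 0)) + csc z ((0, axis i 1), (0, axis i 1))" for z
        by (rule pt2_eqI) (auto simp: Inl ch_def axis_def)
      then show ?thesis by blast
    next
      case (Inr i)
      have "ch (x(j := z)) = ch (x(j := 0)) + csc z ((0, axis i \<i>), (0, axis i (-\<i>)))" for z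
        by (rule pt2_eqI) (auto simp: Inr ch_def axis_def)
      then show ?thesis by blast
    qed
    then obtain y v where yv: "\<And>z. ch (x(j := z)) = y + csc z v" by blast
    show "(\<lambda>z. G (ch (x(j := z)))) holomorphic_on ball 0 \<delta>"
      unfolding holomorphic_on_def yv
    proof (intro ballI cdiff_line_differentiable)
      fix z :: complex assume "z \<in> ball 0 \<delta>"
      then have "ch (x(j := z)) \<in> Uset" using x by (intro inU) auto
      then show "cdiff G (y + csc z v)" using OhatD(1)[OF G] by (auto simp: holo_on_cdiff yv)
    qed
  next
    fix x :: "'n + 'n \<Rightarrow> complex" assume x: "\<And>i. norm (x i) < \<delta>" and r: "\<And>i. x i \<in> \<real>"
    define w where "w = (\<chi> i. x (Inl i) + \<i> * x (Inr i))"
    have cr: "cnj (x i) = x i" for i using r[of i] by (simp add: Reals_cnj_iff)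
    have ch: "ch x = ((1, w), (1, cnjv w))"
      by (simp add: ch_def w_def cnjv_def cr)
    have "wdot w = (\<Sum>i\<in>UNIV. x (Inl i) * x (Inl i)) + (\<Sum>i\<in>UNIV. x (Inr i) * x (Inr i))"
      using bil_ch[of x] by (simp add: ch bil_emb)
    then have "norm (wdot w) \<le> 1 / 2" using small[of x, OF x] by simp
    then have "(norm w)\<^sup>2 \<le> 1 / 2" by (simp add: wdot_norm norm_power)
    then have "norm w < 1" by (smt (verit) one_le_power norm_ge_zero field_sum_of_halves)
    then show "G (ch x) = 0" using z[of w] by (simp add: emb_def ch)
  qed
  have zero: "G ((1, p), (1, q)) = 0" if "\<And>i. norm (p $ i) < \<delta>" "\<And>i. norm (q $ i) < \<delta>" for p q :: "complex ^ 'n"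
  proof -
    define x where "x = case_sum (\<lambda>i. (p $ i + q $ i) / 2) (\<lambda>i. (p $ i - q $ i) / (2 * \<i>))"
    have "norm (x j) < \<delta>" for j
    proof -
      have "norm (p $ i + q $ i) < 2 * \<delta>" "norm (p $ i - q $ i) < 2 * \<delta>" for i
        using that[of i] norm_triangle_ineq[of "p $ i" "q $ i"] norm_triangle_ineq4[of "p $ i" "q $ i"] by linarith+
      then show ?thesis by (cases j) (auto simp: x_def norm_divide norm_mult field_simps)
    qed
    moreover have "ch x = ((1, p), (1, q))"
      by (auto simp: ch_def x_def prod_eq_iff vec_eq_iff field_simps)
    ultimately show ?thesis using chz[of x] by simp
  qed
  show ?thesis
  \<comment> \<open>Bringing a point of the first chart to zeroth coordinates 1 divides q by s = 1 +
    p.q. Since norm s >= 1/2, the radius \<delta> / 4 keeps the quotient below \<delta>.\<close>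
  proof (intro exI[of _ "\<delta> / 4"] conjI allI impI)
    fix x :: "'n + 'n \<Rightarrow> complex" assume x: "\<forall>j. norm (x j) \<le> \<delta> / 4"
    define s where "s = 1 + (\<Sum>i\<in>UNIV. x (Inl i) * x (Inr i))"
    have "norm (\<Sum>i\<in>UNIV. x (Inl i) * x (Inr i)) \<le> N * (\<delta> / 4)\<^sup>2"
      unfolding N_def by (rule norm_bil_small) (use x \<delta> in auto)
    also have "\<dots> \<le> 1 / 4" using \<delta>(3) by (simp add: power_divide)
    finally have s: "norm s \<ge> 1 / 2"
      unfolding s_def using norm_triangle_ineq4[of "1 + (\<Sum>i\<in>UNIV. x (Inl i) * x (Inr i))" "\<Sum>i\<in>UNIV. x (Inl i) * x (Inr i)"] by simp
    then have s0: "s \<noteq> 0" by auto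
    define q where "q = (\<chi> i. x (Inr i) / s)"
    have c1: "chart1 x = (sc 1 (1, \<chi> i. x (Inl i)), sc s (1, q))"
      using s0 by (auto simp: chart1_def sc_def s_def[symmetric] q_def prod_eq_iff vec_eq_iff)
    have "((1, \<chi> i. x (Inl i)), (1, q)) \<in> Uset"
      using chart_in_Uset(1)[of x] s0 by (simp add: c1 in_Uset bil_sc)
    then have "G (chart1 x) = G ((1, \<chi> i. x (Inl i)), (1, q))"
      unfolding c1 by (rule OhatD(3)[OF G]) (use s0 in auto)
    also have "\<dots> = 0"
    proof (rule zero)
      show "norm ((\<chi> i. x (Inl i)) $ i) < \<delta>" for i using x[rule_format, of "Inl i"] \<delta> by simp
      have "norm (x (Inr i)) < \<delta> * norm s" for i
      proof -
        have "norm (x (Inr i)) < \<delta> * (1 / 2)" using x[rule_format, of "Inr i"] \<delta> by simp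
        also have "\<dots> \<le> \<delta> * norm s" using s \<delta> by (intro mult_left_mono) auto
        finally show ?thesis .
      qed
      then show "norm (q $ i) < \<delta>" for i
        using s0 by (simp add: q_def norm_divide field_simps)
    qed
    finally show "G (chart1 x) = 0" .
  qed (use \<delta> in auto)
qed

text \<open>Vanishing on a small polydisc of the first chart kills all Taylor coefficients by
  Cauchy's estimate with bound 0. The first chart reaches, up to scaling, every point with nonzero
  zeroth coordinate of p, and \<open>Ohat_eq_generic\<close> supplies the rest. This is what makes
  \<open>hat\<close> meaningful.\<close>

lemma emb_inj_zero:
  assumes G: "G \<in> Ohat" and z: "\<And>w. emb G w = 0"
  shows "G = (\<lambda>_. 0)"
proof (rule Ohat_eq_generic[OF G Ohat_zero])
  obtain c where c: "decay UNIV c" "\<And>x. G (chart1 x) = (\<Sum>\<^sub>\<infinity>P. c P * mpow x P)"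
    using sep_entire_expansion[OF sep_entire_chart(1)[OF G]] by blast
  obtain r where r: "r > 0" "\<And>x. (\<forall>j. norm (x j) \<le> r) \<Longrightarrow> G (chart1 x) = 0"
    using emb_zero_imp_chart1_zero[OF G z] by blast
  have "norm (c P) * r ^ nabs P \<le> 0" for P
    by (rule multi_power_series_coeff_bound[of UNIV])
       (use c r in \<open>auto simp: c(2)[symmetric]\<close>)
  then have "c P = 0" for P
    using r(1) by (metis mult_le_0_iff norm_le_zero_iff not_le zero_less_power)
  then have zero: "G (chart1 x) = 0" for x by (simp add: c(2))
  fix x :: "'a pt \<times> 'a pt" assume x: "x \<in> Uset" "fst (fst x) \<noteq> 0"
  then have x': "(fst x, snd x) \<in> Uset" by simp
  obtain y s u where y: "s \<noteq> 0" "u \<noteq> 0" "fst x = sc s (fst (chart1 y))" "snd x = sc u (snd (chart1 y))"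
    using chart1_scaling[OF x' x(2)] by metis
  have "G x = G (sc s (fst (chart1 y)), sc u (snd (chart1 y)))" by (simp add: y(3,4)[symmetric])
  also have "\<dots> = G (fst (chart1 y), snd (chart1 y))"
    by (rule OhatD(3)[OF G]) (use y chart_in_Uset(1) in auto)
  finally show "G x = 0" by (simp add: zero)
qed

lemma emb_inj:
  assumes "G \<in> Ohat" "G' \<in> Ohat" "emb G = emb G'"
  shows "G = G'"
proof -
  have "(\<lambda>x. G x - G' x) = (\<lambda>_. 0)"
  proof (rule emb_inj_zero[OF Ohat_diff[OF assms(1,2)]])
    show "emb (\<lambda>x. G x - G' x) w = 0" for w using fun_cong[OF assms(3), of w] by (auto simp: emb_def)
  qed
  then show ?thesis by (simp add: fun_eq_iff)
qed

lemma hat_emb: "G \<in> Ohat \<Longrightarrow> hat (emb G) = G"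
  unfolding hat_def by (rule the_equality) (use emb_inj in auto)

lemma hat_Ohat: "a \<in> ADn \<Longrightarrow> hat a \<in> Ohat" and emb_hat: "a \<in> ADn \<Longrightarrow> emb (hat a) = a"
  by (auto simp: ADn_def hat_emb)

section \<open>The Schauder expansion\<close>

type_synonym 'n pmi = "('n \<Rightarrow> nat) \<times> ('n \<Rightarrow> nat)"

definition deg :: "'n::finite pmi \<Rightarrow> nat" where
  "deg k = nabs (fst k) + nabs (snd k)"

text \<open>The exponent of z by which the monomial scales under (p, q) |-> (z p, q / z). Its sign
  decides on which chart f_{r,P,Q} is the bare monomial.\<close>

definition wt :: "'n::finite pmi \<Rightarrow> int" where
  "wt k = int (nabs (fst k)) - int (nabs (snd k))"

definition mon :: "('n::finite + 'n \<Rightarrow> complex) \<Rightarrow> 'n pmi \<Rightarrow> complex" where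
  "mon x k = mpow x (case_sum (fst k) (snd k))"

definition decay2 :: "('n::finite pmi \<Rightarrow> complex) \<Rightarrow> bool" where
  "decay2 c \<longleftrightarrow> (\<forall>R>0. (\<lambda>k. norm (c k) * R ^ deg k) summable_on UNIV)"

text \<open>\<open>lift1\<close> and \<open>lift2\<close> pad both multi-indices by a zeroth
  exponent up to the common degree max(|P|, |Q|). The pairs obtained are those of equal degree with
  a vanishing zeroth exponent on at least one side; they describe the basis f_{r,P,Q} inside the
  f_{P,Q}.\<close>

definition lift1 :: "'n::finite pmi \<Rightarrow> 'n mi" where
  "lift1 k = (max (nabs (fst k)) (nabs (snd k)) - nabs (fst k), fst k)"

definition lift2 :: "'n::finite pmi \<Rightarrow> 'n mi" where
  "lift2 k = (max (nabs (fst k)) (nabs (snd k)) - nabs (snd k), snd k)"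

definition frh :: "'n::finite pmi \<Rightarrow> 'n pt \<times> 'n pt \<Rightarrow> complex" where
  "frh k = fPh (lift1 k) (lift2 k)"

lemma mabs_lift: "mabs (lift1 k) = max (nabs (fst k)) (nabs (snd k))" "mabs (lift2 k) = max (nabs (fst k)) (nabs (snd k))"
  by (simp_all add: mabs_def lift1_def lift2_def nabs_def)

lemma mabs_lift_le: "mabs (lift1 k) \<le> deg k"
  by (simp add: mabs_lift deg_def)

lemma fr_eq_fP: "fr (fst k) (snd k) = fP (lift1 k) (lift2 k)"
  by (auto simp: fun_eq_iff fr_def fP_def mabs_lift) (simp_all add: lift1_def lift2_def)

lemma frh_Ohat: "frh k \<in> Ohat"
  unfolding frh_def by (rule fPh_in_Ohat) (simp add: mabs_lift)

lemma emb_frh: "emb (frh k) = fr (fst k) (snd k)"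
  by (simp add: frh_def emb_fPh fr_eq_fP)

lemma prod_sum_type: "(\<Prod>j\<in>UNIV. f j) = (\<Prod>i\<in>UNIV. f (Inl i)) * (\<Prod>i\<in>UNIV. f (Inr i))"
  for f :: "'a::finite + 'b::finite \<Rightarrow> complex"
  unfolding UNIV_Plus_UNIV[symmetric] by (subst prod.Plus) (auto simp: o_def)

lemma sum_sum_type: "(\<Sum>j\<in>UNIV. f j) = (\<Sum>i\<in>UNIV. f (Inl i)) + (\<Sum>i\<in>UNIV. f (Inr i))"
  for f :: "'a::finite + 'b::finite \<Rightarrow> nat"
  unfolding UNIV_Plus_UNIV[symmetric] by (subst sum.Plus) (auto simp: o_def)

lemma mon_eq: "mon x k = (\<Prod>i\<in>UNIV. x (Inl i) ^ fst k i) * (\<Prod>i\<in>UNIV. x (Inr i) ^ snd k i)"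
  by (simp add: mon_def mpow_def prod_sum_type)

lemma nabs_case_sum: "nabs (case_sum P Q) = nabs P + nabs Q"
  by (simp add: nabs_def sum_sum_type)

lemma deg_eq: "deg k = nabs (case_sum (fst k) (snd k))"
  by (simp add: deg_def nabs_case_sum)

lemma bij_case_sum: "bij (\<lambda>k::'n pmi. case_sum (fst k) (snd k))"
proof (rule bijI')
  fix P :: "'n + 'n \<Rightarrow> nat"
  show "\<exists>k. P = case_sum (fst k) (snd k)"
    by (intro exI[of _ "(\<lambda>i. P (Inl i), \<lambda>i. P (Inr i))"]) (auto simp: fun_eq_iff split: sum.split)
qed (metis case_sum_o_inj prod_eqI)

lemma summable_on_pmi: "f summable_on UNIV \<longleftrightarrow> (\<lambda>k::'n pmi. f (case_sum (fst k) (snd k))) summable_on UNIV"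
  using summable_on_reindex_bij_betw[OF bij_case_sum, of f] by simp

lemma infsum_pmi: "infsum f UNIV = (\<Sum>\<^sub>\<infinity>k::'n pmi. f (case_sum (fst k) (snd k)))"
  using infsum_reindex_bij_betw[OF bij_case_sum, of f] by simp

lemma decay2_coeff_bound:
  fixes c :: "'n::finite pmi \<Rightarrow> complex"
  assumes c: "decay2 c" and "R > 0"
    and M: "\<And>x. (\<And>j. norm (x j) \<le> R) \<Longrightarrow> norm (\<Sum>\<^sub>\<infinity>k. c k * mon x k) \<le> M"
  shows "norm (c k) * R ^ deg k \<le> M"
proof -
  define e where "e P = c (\<lambda>i. P (Inl i), \<lambda>i. P (Inr i))" for P
  have e: "e (case_sum (fst k) (snd k)) = c k" for k by (simp add: e_def)
  have "norm (e (case_sum (fst k) (snd k))) * R ^ nabs (case_sum (fst k) (snd k)) \<le> M"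
  proof (rule multi_power_series_coeff_bound[of UNIV])
    show "decay (mi_on UNIV) e"
      unfolding decay_def mi_on_UNIV summable_on_pmi e deg_eq[symmetric] using c by (simp add: decay2_def)
    fix x :: "'n + 'n \<Rightarrow> complex" assume "\<And>j. norm (x j) \<le> R"
    from M[OF this] show "norm (\<Sum>\<^sub>\<infinity>P\<in>mi_on UNIV. e P * mpow x P) \<le> M"
      by (simp add: infsum_pmi e mon_def)
  qed (use assms in auto)
  then show ?thesis by (simp add: e deg_eq)
qed

lemma sep_entire_expansion2:
  fixes g :: "('n::finite + 'n \<Rightarrow> complex) \<Rightarrow> complex"
  assumes "sep_entire g"
  obtains c where "decay2 c" "\<And>x. g x = (\<Sum>\<^sub>\<infinity>k. c k * mon x k)"
proof -
  obtain c where c: "decay UNIV c" "\<And>x. g x = (\<Sum>\<^sub>\<infinity>P. c P * mpow x P)"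
    using sep_entire_expansion[OF assms] by blast
  show ?thesis
  proof (rule that)
    show "decay2 (\<lambda>k. c (case_sum (fst k) (snd k)))"
      unfolding decay2_def deg_eq using c(1) by (simp add: decay_def summable_on_pmi)
    show "g x = (\<Sum>\<^sub>\<infinity>k. c (case_sum (fst k) (snd k)) * mon x k)" for x
      by (simp add: c(2) infsum_pmi mon_def)
  qed
qed

lemma norm_mon_le: "(\<And>j. norm (x j) \<le> R) \<Longrightarrow> norm (mon x k) \<le> R ^ deg k"
  unfolding mon_def deg_eq by (rule norm_mpow_le)

lemma decay2_abs_summable:
  assumes "decay2 c"
  shows "(\<lambda>k. norm (c k * mon x k)) summable_on UNIV"
proof -
  obtain R where R: "R > 0" "\<And>j. norm (x j) \<le> R" using finite_bound by blast
  show ?thesis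
    by (rule summable_on_comparison_test[where f = "\<lambda>k. norm (c k) * R ^ deg k"])
       (use assms R in \<open>auto simp: decay2_def norm_mult intro!: mult_left_mono norm_mon_le\<close>)
qed

lemma decay2_summable: "decay2 c \<Longrightarrow> (\<lambda>k. c k * mon x k) summable_on UNIV"
  by (rule abs_summable_summable[OF decay2_abs_summable])

section \<open>The scaling action and Laurent series in its parameter\<close>

definition tw :: "complex \<Rightarrow> ('n + 'n \<Rightarrow> complex) \<Rightarrow> 'n + 'n \<Rightarrow> complex" where
  "tw z x = case_sum (\<lambda>i. z * x (Inl i)) (\<lambda>i. x (Inr i) / z)"

lemma tw_simps [simp]: "tw z x (Inl i) = z * x (Inl i)" "tw z x (Inr i) = x (Inr i) / z"
  by (simp_all add: tw_def)

lemma mon_tw: "z \<noteq> 0 \<Longrightarrow> mon (tw z x) k = z powi wt k * mon x k"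
proof -
  assume z: "z \<noteq> 0"
  have "mon (tw z x) k = z ^ nabs (fst k) / z ^ nabs (snd k) * mon x k"
    by (simp add: mon_eq power_mult_distrib power_divide prod.distrib prod_dividef nabs_def power_sum)
  also have "z ^ nabs (fst k) / z ^ nabs (snd k) = z powi wt k"
    using z by (simp add: wt_def power_int_diff)
  finally show ?thesis .
qed

lemma sum_tw: "z \<noteq> 0 \<Longrightarrow> (\<Sum>i\<in>UNIV. tw z x (Inl i) * tw z x (Inr i)) = (\<Sum>i\<in>UNIV. x (Inl i) * x (Inr i))"
  by (intro sum.cong) auto

lemma infsum_diff:
  fixes f g :: "'a \<Rightarrow> complex"
  assumes "f summable_on A" "g summable_on A"
  shows "(\<Sum>\<^sub>\<infinity>x\<in>A. f x - g x) = infsum f A - infsum g A"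
  using infsum_add[OF assms(1) summable_on_uminus[THEN iffD2, OF assms(2)]] by (simp add: infsum_uminus)

lemma infsum_split_UNIV:
  fixes f :: "'a \<Rightarrow> complex"
  assumes "f summable_on UNIV"
  shows "infsum f UNIV = infsum f {x. P x} + infsum f {x. \<not> P x}"
proof -
  have "UNIV = {x. P x} \<union> {x. \<not> P x}" by auto
  then show ?thesis
    using infsum_Un_disjoint[of f "{x. P x}" "{x. \<not> P x}"] summable_on_subset_banach[OF assms subset_UNIV] by auto
qed

lemma holomorphic_infsum_powers:
  fixes u :: "'i \<Rightarrow> complex" and n :: "'i \<Rightarrow> nat"
  assumes sm: "\<And>r. r > 0 \<Longrightarrow> (\<lambda>i. norm (u i) * r ^ n i) summable_on A"
  shows "(\<lambda>z. \<Sum>\<^sub>\<infinity>i\<in>A. u i * z ^ n i) holomorphic_on UNIV"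
proof -
  have *: "(\<lambda>z. \<Sum>\<^sub>\<infinity>i\<in>A. u i * z ^ n i) holomorphic_on ball 0 r" if r: "r > 0" for r
  proof (rule holomorphic_uniform_limit[of 0 r "\<lambda>X z. \<Sum>i\<in>X. u i * z ^ n i" "finite_subsets_at_top A"])
    show "uniform_limit (cball 0 r) (\<lambda>X z. \<Sum>i\<in>X. u i * z ^ n i) (\<lambda>z. \<Sum>\<^sub>\<infinity>i\<in>A. u i * z ^ n i) (finite_subsets_at_top A)"
      by (rule Weierstrass_m_test_general[OF _ sm[OF r]])
         (auto simp: norm_mult norm_power intro!: mult_left_mono power_mono)
    show "\<forall>\<^sub>F X in finite_subsets_at_top A. continuous_on (cball 0 r) (\<lambda>z. \<Sum>i\<in>X. u i * z ^ n i) \<and>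
            (\<lambda>z. \<Sum>i\<in>X. u i * z ^ n i) holomorphic_on ball 0 r"
      by (intro always_eventually allI conjI continuous_intros holomorphic_intros)
  qed auto
  show ?thesis
    unfolding holomorphic_on_open[OF open_UNIV]
  proof
    fix z :: complex
    have "z \<in> ball 0 (norm z + 1)" by simp
    then show "\<exists>f'. ((\<lambda>z. \<Sum>\<^sub>\<infinity>i\<in>A. u i * z ^ n i) has_field_derivative f') (at z)"
      using *[of "norm z + 1", unfolded holomorphic_on_open[OF open_ball]] by (auto simp: add_nonneg_pos)
  qed
qed

text \<open>The positive part is an entire function of z that is bounded near infinity, because there it
  is minus the other part, an entire function of 1/z.\<close>

lemma laurent_positive_part_zero:
  fixes u :: "'i \<Rightarrow> complex" and d :: "'i \<Rightarrow> int"
  assumes sm: "\<And>r. r > 0 \<Longrightarrow> (\<lambda>i. norm (u i) * r powi d i) summable_on UNIV"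
    and zero: "\<And>z. z \<noteq> 0 \<Longrightarrow> (\<Sum>\<^sub>\<infinity>i. u i * z powi d i) = 0"
  shows "(\<Sum>\<^sub>\<infinity>i\<in>{i. d i > 0}. u i) = 0"
proof -
  define A B where "A = {i. d i > 0}" and "B = {i. d i \<le> 0}"
  define E where "E z = (\<Sum>\<^sub>\<infinity>i\<in>A. u i * z ^ nat (d i))" for z
  define F where "F z = (\<Sum>\<^sub>\<infinity>i\<in>B. u i * z ^ nat (- d i))" for z
  have smA: "(\<lambda>i. norm (u i) * r ^ nat (d i)) summable_on A" if "r > 0" for r
    using summable_on_subset_banach[OF sm[OF that], of A]
    by (rule summable_on_cong[THEN iffD1, rotated]) (auto simp: A_def power_int_def)
  have smB: "(\<lambda>i. norm (u i) * r ^ nat (- d i)) summable_on B" if "r > 0" for r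
  proof -
    have "(\<lambda>i. norm (u i) * inverse r powi d i) summable_on B"
      using sm[of "inverse r"] that by (intro summable_on_subset_banach[of _ UNIV B]) auto
    then show ?thesis
      by (rule summable_on_cong[THEN iffD1, rotated]) (auto simp: B_def power_int_def)
  qed
  have E: "E holomorphic_on UNIV" and F: "F holomorphic_on UNIV"
    unfolding E_def F_def using smA smB by (auto intro: holomorphic_infsum_powers)
  have EF: "E z = - F (inverse z)" if z: "z \<noteq> 0" for z
  proof -
    have "(\<lambda>i. norm (u i * z powi d i)) summable_on UNIV"
      using sm[of "norm z"] z by (simp add: norm_mult norm_power_int)
    then have s: "(\<lambda>i. u i * z powi d i) summable_on UNIV"
      by (rule abs_summable_summable)
    have "(\<Sum>\<^sub>\<infinity>i. u i * z powi d i) = (\<Sum>\<^sub>\<infinity>i\<in>A. u i * z powi d i) + (\<Sum>\<^sub>\<infinity>i\<in>B. u i * z powi d i)"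
      using infsum_split_UNIV[OF s, of "\<lambda>i. d i > 0"] by (simp add: A_def B_def not_less)
    also have "(\<Sum>\<^sub>\<infinity>i\<in>A. u i * z powi d i) = E z"
      unfolding E_def by (intro infsum_cong) (auto simp: A_def power_int_def)
    also have "(\<Sum>\<^sub>\<infinity>i\<in>B. u i * z powi d i) = F (inverse z)"
      unfolding F_def by (intro infsum_cong) (auto simp: B_def power_int_def)
    finally show ?thesis using zero[OF z] by (simp add: eq_neg_iff_add_eq_0)
  qed
  have bd: "bounded (H ` cball 0 1)" if "H holomorphic_on UNIV" for H :: "complex \<Rightarrow> complex"
    by (intro compact_imp_bounded compact_continuous_image)
       (auto intro!: holomorphic_on_imp_continuous_on holomorphic_on_subset[OF that])
  have K': "\<exists>K. \<forall>z. norm z \<le> 1 \<longrightarrow> norm (H z) \<le> K" if "H holomorphic_on UNIV" for H :: "complex \<Rightarrow> complex"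
    using bd[OF that] unfolding bounded_iff by (metis imageI mem_cball_0)
  obtain K1 where K1: "\<And>z. norm z \<le> 1 \<Longrightarrow> norm (E z) \<le> K1" using K'[OF E] by blast
  obtain K2 where K2: "\<And>z. norm z \<le> 1 \<Longrightarrow> norm (F z) \<le> K2" using K'[OF F] by blast
  have "bounded (range E)"
    unfolding bounded_iff
  proof (intro exI[of _ "max K1 K2"] ballI)
    fix y assume "y \<in> range E"
    then obtain z where y: "y = E z" by auto
    show "norm y \<le> max K1 K2"
    proof (cases "norm z \<le> 1")
      case False
      then have "z \<noteq> 0" "norm (inverse z) \<le> 1" by (auto simp: norm_inverse inverse_le_1_iff)
      then show ?thesis using K2[of "inverse z"] by (simp add: y EF)
    qed (use K1 y in \<open>auto simp: le_max_iff_disj\<close>)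
  qed
  then have "E 1 = E 0"
    using Liouville_theorem[OF E] by (auto simp: constant_on_def)
  \<comment> \<open>All exponents occurring in \<open>E\<close> are positive, so there is no
    constant term; a constant \<open>E\<close> is then 0, and its value at 1 is the sum in
    question.\<close>
  also have "E 0 = 0" unfolding E_def by (rule infsum_0) (auto simp: A_def)
  finally show ?thesis by (simp add: E_def A_def)
qed

text \<open>The zeroth coordinate of q on this chart is 1 + p.q, and it enters with the padding
  exponent of \<open>lift2\<close>, which is the weight if that is positive and 0 otherwise.\<close>

lemma frh_chart1:
  "frh k (chart1 x) = mon x k * (if wt k \<le> 0 then 1 else (1 + (\<Sum>i\<in>UNIV. x (Inl i) * x (Inr i))) powi wt k)"
proof -
  have "frh k (chart1 x) = mon x k * (1 + (\<Sum>i\<in>UNIV. x (Inl i) * x (Inr i))) ^ fst (lift2 k)"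
    by (simp add: frh_def fPh_def chart_in_Uset bil_chart ptpow_def wpow_def lift1_def lift2_def mon_eq)
       (simp add: chart1_def)
  moreover have "fst (lift2 k) = (if wt k \<le> 0 then 0 else nat (wt k))"
    by (auto simp: lift2_def wt_def)
  ultimately show ?thesis by (auto simp: power_int_def)
qed

lemma frh_sc:
  "x \<in> Uset \<Longrightarrow> z \<noteq> 0 \<Longrightarrow> u \<noteq> 0 \<Longrightarrow> frh k (sc z (fst x), sc u (snd x)) = frh k x"
  using OhatD(3)[OF frh_Ohat, of "fst x" "snd x"] by simp

lemma norm_wpow_le:
  fixes w :: "complex ^ 'n::finite"
  assumes "\<And>i. norm (w $ i) \<le> R"
  shows "norm (wpow w P) \<le> R ^ nabs P"
  using norm_mpow_le[of "\<lambda>i. w $ i" R P] assms by (simp add: wpow_def mpow_def)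

lemma fPh_bound:
  fixes C :: "('n::finite pt \<times> 'n pt) set"
  assumes C: "C \<in> cpts"
  obtains r where "r \<ge> 1" "\<And>P Q x. x \<in> C \<Longrightarrow> mabs P = mabs Q \<Longrightarrow> norm (fPh P Q x) \<le> r ^ mabs P"
proof -
  have cpt: "compact C" "C \<subseteq> Uset" using C by (auto simp: cpts_def)
  have "continuous_on C (\<lambda>x. bil (fst x) (snd x))"
    by (intro holo_on_imp_continuous_on) (simp add: holo_on_cdiff cdiff_bil)
  then have "compact ((\<lambda>x. inverse (bil (fst x) (snd x))) ` C)"
    using cpt by (intro compact_continuous_image continuous_on_inverse) (auto simp: in_Uset)
  from compact_imp_bounded[OF this] obtain B where B: "\<And>x. x \<in> C \<Longrightarrow> norm (inverse (bil (fst x) (snd x))) \<le> B"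
    unfolding bounded_iff by blast
  obtain A where A: "\<And>x. x \<in> C \<Longrightarrow> norm x \<le> A"
    using compact_imp_bounded[OF cpt(1)] unfolding bounded_iff by auto
  define \<rho> where "\<rho> = max 1 (max A B)"
  have \<rho>: "\<rho> \<ge> 1" "A \<le> \<rho>" "B \<le> \<rho>" by (auto simp: \<rho>_def)
  have pp: "norm (ptpow p P) \<le> \<rho> ^ mabs P" if "norm p \<le> \<rho>" for p :: "'n pt" and P
  proof -
    have f: "norm (fst p) \<le> \<rho>" using norm_fst_le[of "fst p" "snd p"] that by simp
    have "norm (snd p $ i) \<le> \<rho>" for i
      using norm_snd_le[of "snd p" "fst p"] Finite_Cartesian_Product.norm_nth_le[of "snd p" i] that by simp
    then have "norm (wpow (snd p) (snd P)) \<le> \<rho> ^ nabs (snd P)" by (rule norm_wpow_le)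
    moreover have "norm (fst p ^ fst P) \<le> \<rho> ^ fst P" using f by (simp add: norm_power power_mono)
    ultimately have "norm (ptpow p P) \<le> \<rho> ^ fst P * \<rho> ^ nabs (snd P)"
      unfolding ptpow_def norm_mult using \<rho> by (intro mult_mono) auto
    then show ?thesis by (simp add: mabs_def nabs_def power_add)
  qed
  show ?thesis
  \<comment> \<open>One factor \<rho> per degree comes from each of the monomial in p, the monomial
    in q and the inverse of the form.\<close>
  proof (rule that[of "\<rho> ^ 3"])
    show "\<rho> ^ 3 \<ge> 1" using \<rho> by (simp add: one_le_power)
    fix P Q :: "'n mi" and x assume x: "x \<in> C" and PQ: "mabs P = mabs Q"
    have n: "norm (fst x) \<le> \<rho>" "norm (snd x) \<le> \<rho>"
      using norm_fst_le[of "fst x" "snd x"] norm_snd_le[of "snd x" "fst x"] A[OF x] \<rho> by auto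
    have "norm (inverse ((- bil (fst x) (snd x)) ^ mabs P)) \<le> \<rho> ^ mabs P"
      unfolding norm_inverse norm_power norm_minus_cancel power_inverse[symmetric]
      using B[OF x] \<rho> by (intro power_mono) (auto simp: norm_inverse)
    then have "norm (ptpow (fst x) P) * norm (ptpow (snd x) Q) * norm (inverse ((- bil (fst x) (snd x)) ^ mabs P))
        \<le> \<rho> ^ mabs P * \<rho> ^ mabs Q * \<rho> ^ mabs P"
      using \<rho> by (intro mult_mono pp n) auto
    also have "\<dots> = (\<rho> ^ 3) ^ mabs P" by (simp add: PQ power3_eq_cube power_mult_distrib)
    finally show "norm (fPh P Q x) \<le> (\<rho> ^ 3) ^ mabs P"
      using x cpt by (auto simp: fPh_def norm_mult[symmetric] divide_inverse)
  qed
qed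

lemma frh_bound:
  fixes C :: "('n::finite pt \<times> 'n pt) set"
  assumes C: "C \<in> cpts"
  obtains r where "r \<ge> 1" "\<And>k x. x \<in> C \<Longrightarrow> norm (frh k x) \<le> r ^ deg k"
proof -
  obtain r where r: "r \<ge> 1" "\<And>P Q x. x \<in> C \<Longrightarrow> mabs P = mabs Q \<Longrightarrow> norm (fPh P Q x) \<le> r ^ mabs P"
    using fPh_bound[OF C] by blast
  show ?thesis
  proof (rule that[OF r(1)])
    fix k x assume "x \<in> C"
    then have "norm (frh k x) \<le> r ^ mabs (lift1 k)" unfolding frh_def by (intro r(2)) (simp_all add: mabs_lift)
    also have "\<dots> \<le> r ^ deg k" by (intro power_increasing mabs_lift_le r(1))
    finally show "norm (frh k x) \<le> r ^ deg k" .
  qed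
qed

lemma single_cpts: "x \<in> Uset \<Longrightarrow> {x} \<in> cpts"
  by (simp add: cpts_def)

lemma frh_abs_summable:
  assumes "decay2 c"
  shows "(\<lambda>k. norm (c k * frh k x)) summable_on UNIV"
proof (cases "x \<in> Uset")
  case True
  obtain r where r: "r \<ge> 1" "\<And>k. norm (frh k x) \<le> r ^ deg k"
    using frh_bound[OF single_cpts[OF True]] by (metis singletonI)
  show ?thesis
    by (rule summable_on_comparison_test[where f = "\<lambda>k. norm (c k) * r ^ deg k"])
       (use assms r in \<open>auto simp: decay2_def norm_mult intro!: mult_left_mono\<close>)
qed (simp add: frh_def fPh_def)

lemma frh_summable: "decay2 c \<Longrightarrow> (\<lambda>k. c k * frh k x) summable_on UNIV"
  by (rule abs_summable_summable[OF frh_abs_summable])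

lemma frh_infsum_Ohat:
  assumes "decay2 c"
  shows "(\<lambda>x. \<Sum>\<^sub>\<infinity>k. c k * frh k x) \<in> Ohat"
proof (rule Ohat_infsum)
  show "(\<lambda>x. c k * frh k x) \<in> Ohat" for k by (intro Ohat_cmult frh_Ohat)
  fix C :: "('a pt \<times> 'a pt) set" assume "C \<in> cpts"
  then obtain r where r: "r \<ge> 1" "\<And>k y. y \<in> C \<Longrightarrow> norm (frh k y) \<le> r ^ deg k"
    using frh_bound by blast
  show "\<exists>M. M summable_on UNIV \<and> (\<forall>i. \<forall>x\<in>C. norm (c i * frh i x) \<le> M i)"
    by (rule exI[of _ "\<lambda>k. norm (c k) * r ^ deg k"])
       (use assms r in \<open>auto simp: decay2_def norm_mult intro!: mult_left_mono\<close>)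
qed

section \<open>Existence and uniqueness of the coefficients\<close>

definition represents :: "('n::finite pmi \<Rightarrow> complex) \<Rightarrow> ('n pt \<times> 'n pt \<Rightarrow> complex) \<Rightarrow> bool" where
  "represents c G \<longleftrightarrow> decay2 c \<and> (\<forall>x. G x = (\<Sum>\<^sub>\<infinity>k. c k * frh k x))"

text \<open>The transition between the charts where s = 1 + p.q is nonzero: the rescaling by s and 1
  / s that changes charts is itself an instance of the scaling action, so it only replaces the
  parameter z by s z.\<close>

lemma chart2_tw:
  assumes "z \<noteq> 0" "1 + (\<Sum>i\<in>UNIV. x (Inl i) * x (Inr i)) = s" "s \<noteq> 0"
  shows "chart2 (tw (s * z) x) = (sc s (fst (chart1 (tw z x))), sc (1 / s) (snd (chart1 (tw z x))))"
proof -
  have "chart1 (tw z x) = ((1, \<chi> i. z * x (Inl i)), (s, \<chi> i. x (Inr i) / z))"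
    unfolding chart1_def sum_tw[OF assms(1)] assms(2) by simp
  moreover have "chart2 (tw (s * z) x) = ((s, \<chi> i. s * z * x (Inl i)), (1, \<chi> i. x (Inr i) / (s * z)))"
    using assms(1,3) unfolding chart2_def by (subst sum_tw) (simp_all add: assms(2))
  ultimately show ?thesis using assms(3) by (simp add: sc_def prod_eq_iff vec_eq_iff)
qed

text \<open>Nonpositive weights take their coefficients from the first chart and positive weights
  from the second. The issue is that the positive-weight part of the first expansion equals that of
  the second carried over by the transition map. The coefficients \<open>c1 k\<close> and
  \<open>c2 k\<close> themselves need not agree, since for positive weight \<open>frh k\<close> is
  not a monomial on the first chart; only the partial sums are compared.\<close>

theorem Ohat_expansion:
  fixes G :: "'n::finite pt \<times> 'n pt \<Rightarrow> complex"
  assumes G: "G \<in> Ohat"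
  obtains c where "represents c G"
    "\<And>R M k. R > 0 \<Longrightarrow> (\<And>x. x \<in> pdisc R \<Longrightarrow> norm (G x) \<le> M) \<Longrightarrow> norm (c k) * R ^ deg k \<le> M"
proof -
  obtain c1 where c1: "decay2 c1" "\<And>x. G (chart1 x) = (\<Sum>\<^sub>\<infinity>k. c1 k * mon x k)"
    using sep_entire_expansion2[OF sep_entire_chart(1)[OF G]] by blast
  obtain c2 where c2: "decay2 c2" "\<And>x. G (chart2 x) = (\<Sum>\<^sub>\<infinity>k. c2 k * mon x k)"
    using sep_entire_expansion2[OF sep_entire_chart(2)[OF G]] by blast
  define c where "c k = (if wt k \<le> 0 then c1 k else c2 k)" for k
  have "decay2 c"
    unfolding decay2_def
  proof (intro allI impI)
    fix R :: real assume "R > 0"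
    then have "(\<lambda>k. norm (c1 k) * R ^ deg k + norm (c2 k) * R ^ deg k) summable_on UNIV"
      using c1(1) c2(1) by (intro summable_on_add) (auto simp: decay2_def)
    then show "(\<lambda>k. norm (c k) * R ^ deg k) summable_on UNIV"
      by (rule summable_on_comparison_test) (use \<open>R > 0\<close> in \<open>auto simp: c_def\<close>)
  qed
  have on_chart: "G (chart1 x) = (\<Sum>\<^sub>\<infinity>k. c k * frh k (chart1 x))"
    if "1 + (\<Sum>i\<in>UNIV. x (Inl i) * x (Inr i)) \<noteq> 0" for x
  proof -
    define s where "s = 1 + (\<Sum>i\<in>UNIV. x (Inl i) * x (Inr i))"
    have s: "s \<noteq> 0" using that by (simp add: s_def)
    \<comment> \<open>Multiplied by z^wt k, this is the difference of the k-th terms of the two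
      expansions at representatives of one and the same point of the orbit; summed over all k it
      vanishes for every z.\<close>
    define u where "u k = c1 k * mon x k - c2 k * (s powi wt k * mon x k)" for k
    have uz: "u k * z powi wt k = c1 k * mon (tw z x) k - c2 k * mon (tw (s * z) x) k" if "z \<noteq> 0" for z k
      using that s by (simp add: u_def mon_tw power_int_mult_distrib algebra_simps)
    have "(\<Sum>\<^sub>\<infinity>k\<in>{k. wt k > 0}. u k) = 0"
    proof (rule laurent_positive_part_zero)
      fix r :: real assume r: "r > 0"
      define z where "z = complex_of_real r"
      have z: "z \<noteq> 0" "norm z = r" using r by (auto simp: z_def)
      have "(\<lambda>k. norm (c1 k * mon (tw z x) k) + norm (c2 k * mon (tw (s * z) x) k)) summable_on UNIV"
        by (intro summable_on_add decay2_abs_summable c1 c2)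
      then have "(\<lambda>k. norm (u k * z powi wt k)) summable_on UNIV"
        by (rule summable_on_comparison_test) (auto simp: uz z intro: norm_triangle_ineq4)
      then show "(\<lambda>k. norm (u k) * r powi wt k) summable_on UNIV" using z by (simp add: norm_mult norm_power_int)
    next
      fix z :: complex assume z: "z \<noteq> 0"
      have "(\<Sum>\<^sub>\<infinity>k. u k * z powi wt k) = (\<Sum>\<^sub>\<infinity>k. c1 k * mon (tw z x) k) - (\<Sum>\<^sub>\<infinity>k. c2 k * mon (tw (s * z) x) k)"
        by (simp add: uz z infsum_diff decay2_summable c1 c2)
      also have "\<dots> = G (chart1 (tw z x)) - G (chart2 (tw (s * z) x))" by (simp add: c1 c2)
      also have "G (chart2 (tw (s * z) x)) = G (fst (chart1 (tw z x)), snd (chart1 (tw z x)))"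
        unfolding chart2_tw[OF z s_def[symmetric] s]
        by (rule OhatD(3)[OF G]) (use s chart_in_Uset in auto)
      finally show "(\<Sum>\<^sub>\<infinity>k. u k * z powi wt k) = 0" by simp
    qed
    moreover have sub: "(\<lambda>k. c1 k * mon x k) summable_on S" "(\<lambda>k. c2 k * (s powi wt k * mon x k)) summable_on S" for S
    proof -
      show "(\<lambda>k. c1 k * mon x k) summable_on S"
        by (rule summable_on_subset_banach[OF decay2_summable[OF c1(1)] subset_UNIV])
      have "(\<lambda>k. c2 k * mon (tw s x) k) summable_on S"
        by (rule summable_on_subset_banach[OF decay2_summable[OF c2(1)] subset_UNIV])
      then show "(\<lambda>k. c2 k * (s powi wt k * mon x k)) summable_on S" using s by (simp add: mon_tw)
    qed
    ultimately have pos: "(\<Sum>\<^sub>\<infinity>k\<in>{k. wt k > 0}. c1 k * mon x k) = (\<Sum>\<^sub>\<infinity>k\<in>{k. wt k > 0}. c2 k * (s powi wt k * mon x k))"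
      unfolding u_def by (subst (asm) infsum_diff) auto
    have split: "(\<Sum>\<^sub>\<infinity>k. f k) = (\<Sum>\<^sub>\<infinity>k\<in>{k. wt k \<le> 0}. f k) + (\<Sum>\<^sub>\<infinity>k\<in>{k. wt k > 0}. f k)"
      if "f summable_on UNIV" for f :: "'n pmi \<Rightarrow> complex"
      using infsum_split_UNIV[OF that, of "\<lambda>k. wt k \<le> 0"] by (simp add: not_le)
    have "G (chart1 x) = (\<Sum>\<^sub>\<infinity>k\<in>{k. wt k \<le> 0}. c1 k * mon x k) + (\<Sum>\<^sub>\<infinity>k\<in>{k. wt k > 0}. c2 k * (s powi wt k * mon x k))"
      unfolding c1(2) pos[symmetric] by (rule split[OF sub(1)])
    also have "\<dots> = (\<Sum>\<^sub>\<infinity>k\<in>{k. wt k \<le> 0}. c k * frh k (chart1 x)) + (\<Sum>\<^sub>\<infinity>k\<in>{k. wt k > 0}. c k * frh k (chart1 x))"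
      by (intro arg_cong2[of _ _ _ _ "(+)"] infsum_cong) (auto simp: c_def frh_chart1 s_def)
    also have "\<dots> = (\<Sum>\<^sub>\<infinity>k. c k * frh k (chart1 x))"
      by (rule split[symmetric]) (rule frh_summable[OF \<open>decay2 c\<close>])
    finally show ?thesis .
  qed
  have "G = (\<lambda>x. \<Sum>\<^sub>\<infinity>k. c k * frh k x)"
  proof (rule Ohat_eq_generic[OF G frh_infsum_Ohat[OF \<open>decay2 c\<close>]])
    fix x :: "'n pt \<times> 'n pt" assume x: "x \<in> Uset" "fst (fst x) \<noteq> 0" "fst (snd x) \<noteq> 0"
    then have x': "(fst x, snd x) \<in> Uset" by simp
    obtain y t u where y: "t \<noteq> 0" "u \<noteq> 0" "fst x = sc t (fst (chart1 y))" "snd x = sc u (snd (chart1 y))"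
        "1 + (\<Sum>i\<in>UNIV. y (Inl i) * y (Inr i)) \<noteq> 0"
      by (rule chart1_scaling[OF x' x(2)]) (use x(3) in blast)
    have xe: "x = (sc t (fst (chart1 y)), sc u (snd (chart1 y)))" by (simp add: y(3,4)[symmetric])
    have "G (sc t (fst (chart1 y)), sc u (snd (chart1 y))) = G (fst (chart1 y), snd (chart1 y))"
      by (rule OhatD(3)[OF G]) (use y chart_in_Uset in auto)
    then have "G x = G (chart1 y)" by (simp add: xe)
    then show "G x = (\<Sum>\<^sub>\<infinity>k. c k * frh k x)"
      unfolding on_chart[OF y(5)] unfolding xe by (simp add: frh_sc[OF chart_in_Uset(1) y(1,2)])
  qed
  then have "represents c G" using \<open>decay2 c\<close> by (auto simp: represents_def)
  moreover have "norm (c k) * R ^ deg k \<le> M" if "R > 0" and M: "\<And>x. x \<in> pdisc R \<Longrightarrow> norm (G x) \<le> M" for R M k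
  proof -
    have "norm (c1 k) * R ^ deg k \<le> M"
      by (rule decay2_coeff_bound[OF c1(1) \<open>R > 0\<close>]) (auto simp: c1(2)[symmetric] pdisc_def intro!: M)
    moreover have "norm (c2 k) * R ^ deg k \<le> M"
      by (rule decay2_coeff_bound[OF c2(1) \<open>R > 0\<close>]) (auto simp: c2(2)[symmetric] pdisc_def intro!: M)
    ultimately show ?thesis by (simp add: c_def)
  qed
  ultimately show ?thesis using that by blast
qed

lemma bil_commute: "bil p q = bil q p"
  by (simp add: bil_def mult.commute)

lemma frh_swap: "frh (prod.swap k) (prod.swap x) = frh k x"
proof -
  have "lift1 (prod.swap k) = lift2 k" "lift2 (prod.swap k) = lift1 k"
    by (simp_all add: lift1_def lift2_def max.commute)
  then show ?thesis
    by (simp add: frh_def fPh_def in_Uset mabs_lift bil_commute[of "snd x"] max.commute)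
qed

lemma frh_chart2:
  assumes "wt k \<ge> 0"
  shows "frh k (chart2 x) = mon x k"
proof -
  have "frh k (chart2 x) = mon x k * (1 + (\<Sum>i\<in>UNIV. x (Inl i) * x (Inr i))) ^ fst (lift1 k)"
    by (simp add: frh_def fPh_def chart_in_Uset bil_chart ptpow_def wpow_def lift1_def lift2_def mon_eq)
       (simp add: chart2_def)
  moreover have "fst (lift1 k) = 0"
    using assms by (auto simp: lift1_def wt_def)
  ultimately show ?thesis by simp
qed

text \<open>Along the scaling action the series is a Laurent series in z that vanishes identically,
  so its positive part drops out. What remains on the first chart is a plain power series, zero near
  the origin, and Cauchy's estimate with bound 0 kills its coefficients.\<close>

lemma frh_series_zero_nonpos:
  fixes c :: "'n::finite pmi \<Rightarrow> complex"
  assumes c: "decay2 c" and z: "\<And>x. x \<in> Uset \<Longrightarrow> (\<Sum>\<^sub>\<infinity>k. c k * frh k x) = 0" and k: "wt k \<le> 0"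
  shows "c k = 0"
proof -
  have nonpos: "(\<Sum>\<^sub>\<infinity>k\<in>{k. \<not> wt k > 0}. c k * mon x k) = 0"
    if "1 + (\<Sum>i\<in>UNIV. x (Inl i) * x (Inr i)) \<noteq> 0" for x
  proof -
    define s where "s = 1 + (\<Sum>i\<in>UNIV. x (Inl i) * x (Inr i))"
    have s: "s \<noteq> 0" using that by (simp add: s_def)
    define u where "u k = c k * frh k (chart1 x)" for k
    have uz: "u k * z powi wt k = c k * frh k (chart1 (tw z x))" if "z \<noteq> 0" for z k
      unfolding u_def frh_chart1 sum_tw[OF that] by (simp add: mon_tw[OF that])
    have "(\<Sum>\<^sub>\<infinity>k\<in>{k. wt k > 0}. u k) = 0"
    proof (rule laurent_positive_part_zero)
      fix r :: real assume r: "r > 0"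
      define z where "z = complex_of_real r"
      have z: "z \<noteq> 0" "norm z = r" using r by (auto simp: z_def)
      have "(\<lambda>k. norm (u k * z powi wt k)) summable_on UNIV"
        unfolding uz[OF z(1)] by (rule frh_abs_summable[OF c])
      then show "(\<lambda>k. norm (u k) * r powi wt k) summable_on UNIV" using z by (simp add: norm_mult norm_power_int)
    next
      fix z :: complex assume z: "z \<noteq> 0"
      show "(\<Sum>\<^sub>\<infinity>k. u k * z powi wt k) = 0"
        unfolding uz[OF z] by (rule assms(2)[OF chart_in_Uset(1)])
    qed
    moreover have "infsum u UNIV = 0" unfolding u_def by (rule z[OF chart_in_Uset(1)])
    moreover have "u summable_on UNIV" unfolding u_def by (rule frh_summable[OF c])
    ultimately have "(\<Sum>\<^sub>\<infinity>k\<in>{k. \<not> wt k > 0}. u k) = 0"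
      using infsum_split_UNIV[of u "\<lambda>k. wt k > 0"] by simp
    also have "(\<Sum>\<^sub>\<infinity>k\<in>{k. \<not> wt k > 0}. u k) = (\<Sum>\<^sub>\<infinity>k\<in>{k. \<not> wt k > 0}. c k * mon x k)"
      by (intro infsum_cong) (auto simp: u_def frh_chart1)
    finally show ?thesis .
  qed
  define b where "b k = (if wt k > 0 then 0 else c k)" for k
  have b: "decay2 b"
    unfolding decay2_def
  proof (intro allI impI)
    fix R :: real assume "R > 0"
    then show "(\<lambda>k. norm (b k) * R ^ deg k) summable_on UNIV"
      using c unfolding decay2_def
      by (auto simp: b_def intro: summable_on_comparison_test[where f = "\<lambda>k. norm (c k) * R ^ deg k"])
  qed
  define N where "N = real CARD('n)"
  have N: "N \<ge> 1" unfolding N_def by (simp add: Suc_leI)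
  \<comment> \<open>On this polydisc |p.q| <= N r^2 < 1, so 1 + p.q cannot vanish.\<close>
  define r where "r = 1 / (2 * N)"
  have r: "r > 0" "N * r\<^sup>2 < 1"
    using N by (auto simp: r_def power2_eq_square field_simps)
  have "norm (b k) * r ^ deg k \<le> 0"
  proof (rule decay2_coeff_bound[OF b r(1)])
    fix x :: "'n + 'n \<Rightarrow> complex" assume x: "\<And>j. norm (x j) \<le> r"
    have "norm (\<Sum>i\<in>UNIV. x (Inl i) * x (Inr i)) < 1"
      using norm_bil_small[of "\<lambda>i. x (Inl i)" r "\<lambda>i. x (Inr i)"] x r by (simp add: N_def)
    then have "1 + (\<Sum>i\<in>UNIV. x (Inl i) * x (Inr i)) \<noteq> 0"
      by (metis add_eq_0_iff less_irrefl norm_minus_cancel norm_one)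
    from nonpos[OF this] have "(\<Sum>\<^sub>\<infinity>k. b k * mon x k) = 0"
      by (subst infsum_cong_neutral[where T = "{k. \<not> wt k > 0}" and g = "\<lambda>k. c k * mon x k"]) (auto simp: b_def)
    then show "norm (\<Sum>\<^sub>\<infinity>k. b k * mon x k) \<le> 0" by simp
  qed
  then show ?thesis
    using k r(1) by (auto simp: b_def mult_le_0_iff not_less)
       (metis less_irrefl zero_less_power not_le)
qed

text \<open>Exchanging p and q reverses the sign of the weight, which reduces positive weights to
  \<open>frh_series_zero_nonpos\<close>.\<close>

lemma frh_series_zero:
  fixes c :: "'n::finite pmi \<Rightarrow> complex"
  assumes c: "decay2 c" and z: "\<And>x. x \<in> Uset \<Longrightarrow> (\<Sum>\<^sub>\<infinity>k. c k * frh k x) = 0"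
  shows "c k = 0"
proof (cases "wt k \<le> 0")
  case True
  show ?thesis by (rule frh_series_zero_nonpos[OF c z True])
next
  case False
  have bsw: "bij (prod.swap :: 'n pmi \<Rightarrow> 'n pmi)" by (rule bij_swap)
  have deg: "deg (prod.swap k) = deg k" for k :: "'n pmi" by (simp add: deg_def)
  have "(\<lambda>k. c (prod.swap k)) (prod.swap k) = 0"
  proof (rule frh_series_zero_nonpos[where c = "\<lambda>k. c (prod.swap k)" and k = "prod.swap k"])
    show "wt (prod.swap k) \<le> 0" using False by (simp add: wt_def)
    show "decay2 (\<lambda>k. c (prod.swap k))"
      unfolding decay2_def
    proof (intro allI impI)
      fix R :: real assume "R > 0"
      with c have "(\<lambda>k. norm (c k) * R ^ deg k) summable_on UNIV" by (simp add: decay2_def)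
      then show "(\<lambda>k. norm (c (prod.swap k)) * R ^ deg k) summable_on UNIV"
        using summable_on_reindex_bij_betw[OF bsw, of "\<lambda>k. norm (c k) * R ^ deg k"] by (simp add: deg)
    qed
    fix x :: "'n pt \<times> 'n pt" assume "x \<in> Uset"
    then have x: "prod.swap x \<in> Uset" by (simp add: in_Uset bil_commute)
    have "(\<Sum>\<^sub>\<infinity>k. c (prod.swap k) * frh k x) = (\<Sum>\<^sub>\<infinity>k. c (prod.swap k) * frh (prod.swap k) (prod.swap x))"
      by (simp add: frh_swap)
    also have "\<dots> = (\<Sum>\<^sub>\<infinity>k. c k * frh k (prod.swap x))"
      by (rule infsum_reindex_bij_betw[OF bsw])
    also have "\<dots> = 0" by (rule z[OF x])
    finally show "(\<Sum>\<^sub>\<infinity>k. c (prod.swap k) * frh k x) = 0" .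
  qed
  then show ?thesis by simp
qed

lemma decay2_lincomb:
  assumes "decay2 c" "decay2 c'"
  shows "decay2 (\<lambda>k. z * c k + c' k)"
  unfolding decay2_def
proof (intro allI impI)
  fix R :: real assume R: "R > 0"
  have "(\<lambda>k. norm z * (norm (c k) * R ^ deg k) + norm (c' k) * R ^ deg k) summable_on UNIV"
    using assms R by (intro summable_on_add summable_on_cmult_right) (auto simp: decay2_def)
  then show "(\<lambda>k. norm (z * c k + c' k) * R ^ deg k) summable_on UNIV"
  proof (rule summable_on_comparison_test)
    fix k
    have "norm (z * c k + c' k) * R ^ deg k \<le> (norm z * norm (c k) + norm (c' k)) * R ^ deg k"
      using R by (intro mult_right_mono) (auto simp: norm_mult[symmetric] norm_triangle_ineq)
    then show "norm (z * c k + c' k) * R ^ deg k \<le> norm z * (norm (c k) * R ^ deg k) + norm (c' k) * R ^ deg k"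
      by (simp add: algebra_simps)
  qed (use R in auto)
qed

lemma represents_lincomb:
  assumes "represents c G" "represents c' G'"
  shows "represents (\<lambda>k. z * c k + c' k) (\<lambda>x. z * G x + G' x)"
  using assms unfolding represents_def
  by (auto simp: decay2_lincomb distrib_right mult.assoc infsum_add infsum_cmult_right' frh_summable summable_on_cmult_right)

lemma represents_unique:
  assumes "represents c G" "represents c' G"
  shows "c = c'"
proof
  fix k
  have r: "represents (\<lambda>k. -1 * c k + c' k) (\<lambda>x. -1 * G x + G x)" by (rule represents_lincomb[OF assms])
  have r1: "decay2 (\<lambda>k. -1 * c k + c' k)" and r2: "\<And>x. -1 * G x + G x = (\<Sum>\<^sub>\<infinity>k. (-1 * c k + c' k) * frh k x)"
    using r unfolding represents_def by blast+
  have "-1 * c k + c' k = 0"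
    by (rule frh_series_zero[OF r1]) (simp only: r2[symmetric], simp)
  then show "c k = c' k" by simp
qed

definition coef :: "'n::finite fn \<Rightarrow> 'n pmi \<Rightarrow> complex" where
  "coef a = (THE c. represents c (hat a))"

lemma coef_eqI: "represents c (hat a) \<Longrightarrow> coef a = c"
  unfolding coef_def by (rule the_equality) (auto intro: represents_unique)

lemma coef_represents: "a \<in> ADn \<Longrightarrow> represents (coef a) (hat a)"
  using Ohat_expansion[OF hat_Ohat] coef_eqI by metis

lemma coef_decay: "a \<in> ADn \<Longrightarrow> decay2 (coef a)"
  using coef_represents by (auto simp: represents_def)

section \<open>The Frechet space of functions on the disc\<close>

lemma sn_upper:
  assumes "a \<in> ADn" "C \<in> cpts" "x \<in> C"
  shows "norm (hat a x) \<le> sn C a"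
proof -
  obtain M where "\<And>x. x \<in> C \<Longrightarrow> norm (hat a x) \<le> M"
    using Ohat_bounded[OF hat_Ohat[OF assms(1)]] assms(2) by (auto simp: cpts_def)
  then have "bdd_above ((\<lambda>x. norm (hat a x)) ` C)" by (rule bdd_aboveI2)
  then show ?thesis unfolding sn_def using assms(3) by (rule cSUP_upper[rotated])
qed

lemma sn_least: "C \<in> cpts \<Longrightarrow> (\<And>x. x \<in> C \<Longrightarrow> norm (hat a x) \<le> M) \<Longrightarrow> sn C a \<le> M"
  unfolding sn_def by (rule cSUP_least) (auto simp: cpts_def)

lemma sn_nonneg:
  assumes "a \<in> ADn" "C \<in> cpts"
  shows "sn C a \<ge> 0"
proof -
  obtain x where "x \<in> C" using assms(2) by (auto simp: cpts_def)
  then show ?thesis using sn_upper[OF assms] norm_ge_zero order_trans by blast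
qed

lemma ADn_lincomb: "a \<in> ADn \<Longrightarrow> b \<in> ADn \<Longrightarrow> (\<lambda>w. z * a w + b w) \<in> ADn"
  and hat_lincomb: "a \<in> ADn \<Longrightarrow> b \<in> ADn \<Longrightarrow> hat (\<lambda>w. z * a w + b w) = (\<lambda>x. z * hat a x + hat b x)"
proof -
  assume a: "a \<in> ADn" "b \<in> ADn"
  have O: "(\<lambda>x. z * hat a x + hat b x) \<in> Ohat"
    by (intro Ohat_add Ohat_cmult hat_Ohat a)
  have "emb (\<lambda>x. z * hat a x + hat b x) = (\<lambda>w. z * emb (hat a) w + emb (hat b) w)"
    by (auto simp: emb_def)
  then have e: "emb (\<lambda>x. z * hat a x + hat b x) = (\<lambda>w. z * a w + b w)" by (simp add: emb_hat a)
  show "(\<lambda>w. z * a w + b w) \<in> ADn" unfolding ADn_def using O e[symmetric] by blast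
  show "hat (\<lambda>w. z * a w + b w) = (\<lambda>x. z * hat a x + hat b x)"
    using hat_emb[OF O] e by simp
qed

lemma emb_zero: "emb (\<lambda>_. 0) = (\<lambda>_. 0)"
  by (auto simp: emb_def)

lemma ADn_zero: "(\<lambda>_. 0) \<in> ADn"
  unfolding ADn_def using emb_zero[symmetric] Ohat_zero by blast

lemma hat_zero: "hat (\<lambda>_. 0) = (\<lambda>_. 0)"
  using hat_emb[OF Ohat_zero] by (simp add: emb_zero)

lemma ADn_cmult: "a \<in> ADn \<Longrightarrow> (\<lambda>w. z * a w) \<in> ADn"
  and hat_cmult: "a \<in> ADn \<Longrightarrow> hat (\<lambda>w. z * a w) = (\<lambda>x. z * hat a x)"
  using ADn_lincomb[OF _ ADn_zero] hat_lincomb[OF _ ADn_zero] by (auto simp: hat_zero)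

lemma ADn_add: "a \<in> ADn \<Longrightarrow> b \<in> ADn \<Longrightarrow> (\<lambda>w. a w + b w) \<in> ADn"
  and hat_add: "a \<in> ADn \<Longrightarrow> b \<in> ADn \<Longrightarrow> hat (\<lambda>w. a w + b w) = (\<lambda>x. hat a x + hat b x)"
  using ADn_lincomb[of a b 1] hat_lincomb[of a b 1] by auto

lemma ADn_diff: "a \<in> ADn \<Longrightarrow> b \<in> ADn \<Longrightarrow> a - b \<in> ADn"
  and hat_diff: "a \<in> ADn \<Longrightarrow> b \<in> ADn \<Longrightarrow> hat (a - b) = (\<lambda>x. hat a x - hat b x)"
  using ADn_lincomb[of b a "-1"] hat_lincomb[of b a "-1"] by (auto simp: fun_diff_def)

lemma ADn_sum_hat:
  "(\<And>i. i \<in> I \<Longrightarrow> f i \<in> ADn) \<Longrightarrow> (\<lambda>w. \<Sum>i\<in>I. f i w) \<in> ADn \<and> hat (\<lambda>w. \<Sum>i\<in>I. f i w) = (\<lambda>x. \<Sum>i\<in>I. hat (f i) x)"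
proof (induction I rule: infinite_finite_induct)
  case (insert i I)
  then show ?case using ADn_add[of "f i"] hat_add[of "f i"] by auto
qed (auto simp: ADn_zero hat_zero)

lemma ADn_sum: "(\<And>i. i \<in> I \<Longrightarrow> f i \<in> ADn) \<Longrightarrow> (\<lambda>w. \<Sum>i\<in>I. f i w) \<in> ADn"
  and hat_sum: "(\<And>i. i \<in> I \<Longrightarrow> f i \<in> ADn) \<Longrightarrow> hat (\<lambda>w. \<Sum>i\<in>I. f i w) = (\<lambda>x. \<Sum>i\<in>I. hat (f i) x)"
  using ADn_sum_hat by blast+

lemma fr_ADn: "fr P Q \<in> ADn" and hat_fr: "hat (fr P Q) = frh (P, Q)"
proof -
  have e: "emb (frh (P, Q)) = fr P Q" by (simp add: emb_frh)
  show "fr P Q \<in> ADn" unfolding ADn_def using e[symmetric] frh_Ohat by blast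
  show "hat (fr P Q) = frh (P, Q)" using hat_emb[OF frh_Ohat] by (simp add: e[symmetric])
qed

lemma fP_ADn: "mabs P = mabs Q \<Longrightarrow> fP P Q \<in> ADn"
  unfolding ADn_def using emb_fPh[symmetric] fPh_in_Ohat by blast

lemma hat_fP: "mabs P = mabs Q \<Longrightarrow> hat (fP P Q) = fPh P Q"
  by (simp add: emb_fPh[symmetric] hat_emb fPh_in_Ohat)

lemma hat_outside: "a \<in> ADn \<Longrightarrow> x \<notin> Uset \<Longrightarrow> hat a x = 0"
  using OhatD(2)[OF hat_Ohat] by blast

lemma ADn_eqI: "a \<in> ADn \<Longrightarrow> b \<in> ADn \<Longrightarrow> (\<And>x. x \<in> Uset \<Longrightarrow> hat a x = hat b x) \<Longrightarrow> a = b"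
  by (metis emb_hat ext hat_outside)

lemma ADn_eq_zeroI:
  assumes "a \<in> ADn" "\<And>C. C \<in> cpts \<Longrightarrow> sn C a \<le> 0"
  shows "a = (\<lambda>_. 0)"
proof (rule ADn_eqI[OF assms(1) ADn_zero])
  fix x :: "'a pt \<times> 'a pt" assume x: "x \<in> Uset"
  have "norm (hat a x) \<le> 0"
    using sn_upper[OF assms(1) single_cpts[OF x] singletonI] assms(2)[OF single_cpts[OF x]] by linarith
  then show "hat a x = hat (\<lambda>_. 0) x" by (simp add: hat_zero)
qed

lemma sn_cmult:
  assumes "a \<in> ADn" "C \<in> cpts"
  shows "sn C (\<lambda>w. z * a w) \<le> norm z * sn C a"
  by (rule sn_least[OF assms(2)]) (auto simp: hat_cmult assms norm_mult intro!: mult_left_mono sn_upper)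

lemma sn_add:
  assumes "a \<in> ADn" "b \<in> ADn" "C \<in> cpts"
  shows "sn C (\<lambda>w. a w + b w) \<le> sn C a + sn C b"
  by (rule sn_least[OF assms(3)])
     (auto simp: hat_add assms intro!: norm_triangle_le add_mono sn_upper)

lemma coef_bound:
  assumes "a \<in> ADn" "R > 0"
  shows "norm (coef a k) * R ^ deg k \<le> sn (pdisc R) a"
proof -
  obtain c where c: "represents c (hat a)"
    "\<And>R M k. R > 0 \<Longrightarrow> (\<And>x. x \<in> pdisc R \<Longrightarrow> norm (hat a x) \<le> M) \<Longrightarrow> norm (c k) * R ^ deg k \<le> M"
    using Ohat_expansion[OF hat_Ohat[OF assms(1)]] by blast
  have "norm (c k) * R ^ deg k \<le> sn (pdisc R) a"
    by (rule c(2)) (use assms in \<open>auto intro!: sn_upper pdisc_cpts\<close>)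
  then show ?thesis using coef_eqI[OF c(1)] by simp
qed

lemma coef_lincomb:
  assumes "a \<in> ADn" "b \<in> ADn"
  shows "coef (\<lambda>w. z * a w + b w) k = z * coef a k + coef b k"
proof -
  have "coef (\<lambda>w. z * a w + b w) = (\<lambda>k. z * coef a k + coef b k)"
    by (rule coef_eqI) (simp add: hat_lincomb assms represents_lincomb coef_represents)
  then show ?thesis by simp
qed

lemma coef_finite:
  assumes "finite K"
  shows "coef (\<lambda>w. \<Sum>k\<in>K. c k * fr (fst k) (snd k) w) = (\<lambda>k. if k \<in> K then c k else 0)"
proof (rule coef_eqI)
  have h: "hat (\<lambda>w. \<Sum>k\<in>K. c k * fr (fst k) (snd k) w) = (\<lambda>x. \<Sum>k\<in>K. c k * frh k x)"
    by (simp add: hat_sum ADn_cmult fr_ADn hat_cmult hat_fr)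
  have fin: "f summable_on UNIV" if "\<And>k. k \<notin> K \<Longrightarrow> f k = 0" for f :: "'a pmi \<Rightarrow> real"
    using assms that summable_on_cong_neutral[of UNIV K f f] by auto
  show "represents (\<lambda>k. if k \<in> K then c k else 0) (hat (\<lambda>w. \<Sum>k\<in>K. c k * fr (fst k) (snd k) w))"
    unfolding represents_def h
  proof (intro conjI allI)
    show "decay2 (\<lambda>k. if k \<in> K then c k else 0)"
      unfolding decay2_def by (auto intro!: fin)
    fix x
    have "(\<Sum>\<^sub>\<infinity>k. (if k \<in> K then c k else 0) * frh k x) = (\<Sum>\<^sub>\<infinity>k\<in>K. c k * frh k x)"
      by (rule infsum_cong_neutral) auto
    then show "(\<Sum>k\<in>K. c k * frh k x) = (\<Sum>\<^sub>\<infinity>k. (if k \<in> K then c k else 0) * frh k x)"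
      using assms by simp
  qed
qed

text \<open>Completeness in the form in which it is used. The hat of the sum is built by
  \<open>Ohat_infsum\<close> and identified through its restriction to the disc; the error after the
  finite set F is bounded by the tail of the scalar series of seminorms.\<close>

lemma ADn_series:
  fixes f :: "'i::countable \<Rightarrow> 'n::finite fn"
  assumes f: "\<And>i. f i \<in> ADn" and sm: "\<And>C. C \<in> cpts \<Longrightarrow> (\<lambda>i. sn C (f i)) summable_on UNIV"
  shows "(\<lambda>w. \<Sum>\<^sub>\<infinity>i. f i w) \<in> ADn"
    and "hat (\<lambda>w. \<Sum>\<^sub>\<infinity>i. f i w) = (\<lambda>x. \<Sum>\<^sub>\<infinity>i. hat (f i) x)"
    and "\<And>C. C \<in> cpts \<Longrightarrow> sn C (\<lambda>w. \<Sum>\<^sub>\<infinity>i. f i w) \<le> (\<Sum>\<^sub>\<infinity>i. sn C (f i))"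
    and "fconv (\<lambda>w. \<Sum>\<^sub>\<infinity>i. f i w) (\<lambda>F w. \<Sum>i\<in>F. f i w)"
proof -
  define G where "G x = (\<Sum>\<^sub>\<infinity>i. hat (f i) x)" for x
  have O: "G \<in> Ohat"
    unfolding G_def
  proof (rule Ohat_infsum)
    fix C :: "('n pt \<times> 'n pt) set" assume C: "C \<in> cpts"
    show "\<exists>M. M summable_on UNIV \<and> (\<forall>i. \<forall>x\<in>C. norm (hat (f i) x) \<le> M i)"
      by (intro exI[of _ "\<lambda>i. sn C (f i)"]) (auto simp: sm C f intro!: sn_upper)
  qed (rule hat_Ohat[OF f])
  have e: "emb G = (\<lambda>w. \<Sum>\<^sub>\<infinity>i. f i w)"
  proof
    fix w
    have fw: "f i w = emb (hat (f i)) w" for i by (simp add: emb_hat f)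
    show "emb G w = (\<Sum>\<^sub>\<infinity>i. f i w)"
      unfolding fw by (auto simp: emb_def G_def)
  qed
  show A: "(\<lambda>w. \<Sum>\<^sub>\<infinity>i. f i w) \<in> ADn" unfolding ADn_def using O e[symmetric] by blast
  show H: "hat (\<lambda>w. \<Sum>\<^sub>\<infinity>i. f i w) = (\<lambda>x. \<Sum>\<^sub>\<infinity>i. hat (f i) x)"
    unfolding hat_emb[OF O, unfolded e] by (rule ext) (rule G_def)
  have abs: "(\<lambda>i. norm (hat (f i) x)) summable_on S" if "C \<in> cpts" "x \<in> C" for C x S
    using summable_on_subset_banach[OF sm[OF that(1)] subset_UNIV]
    by (rule summable_on_comparison_test) (use that f in \<open>auto intro!: sn_upper\<close>)
  have le: "norm (\<Sum>\<^sub>\<infinity>i\<in>S. hat (f i) x) \<le> (\<Sum>\<^sub>\<infinity>i\<in>S. sn C (f i))" if C: "C \<in> cpts" "x \<in> C" for C x S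
  proof -
    have "norm (\<Sum>\<^sub>\<infinity>i\<in>S. hat (f i) x) \<le> (\<Sum>\<^sub>\<infinity>i\<in>S. norm (hat (f i) x))"
      by (rule norm_infsum_bound[OF abs[OF C]])
    also have "\<dots> \<le> (\<Sum>\<^sub>\<infinity>i\<in>S. sn C (f i))"
      by (rule infsum_mono[OF abs[OF C] summable_on_subset_banach[OF sm[OF C(1)] subset_UNIV]])
         (use C f in \<open>auto intro!: sn_upper\<close>)
    finally show ?thesis .
  qed
  show "sn C (\<lambda>w. \<Sum>\<^sub>\<infinity>i. f i w) \<le> (\<Sum>\<^sub>\<infinity>i. sn C (f i))" if "C \<in> cpts" for C
    by (rule sn_least[OF that]) (simp add: H le[OF that])
  show "fconv (\<lambda>w. \<Sum>\<^sub>\<infinity>i. f i w) (\<lambda>F w. \<Sum>i\<in>F. f i w)"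
    unfolding fconv_def
  proof
    fix C :: "('n pt \<times> 'n pt) set" assume C: "C \<in> cpts"
    let ?s = "\<lambda>F. (\<lambda>w. \<Sum>\<^sub>\<infinity>i. f i w) - (\<lambda>w. \<Sum>i\<in>F. f i w)"
    have AF: "?s F \<in> ADn" for F by (intro ADn_diff A ADn_sum f)
    have "sn C (?s F) \<le> (\<Sum>\<^sub>\<infinity>i. sn C (f i)) - (\<Sum>i\<in>F. sn C (f i))" if F: "finite F" for F
    proof (rule sn_least[OF C])
      fix x assume x: "x \<in> C"
      have "hat (?s F) x = (\<Sum>\<^sub>\<infinity>i. hat (f i) x) - (\<Sum>\<^sub>\<infinity>i\<in>F. hat (f i) x)"
        using F by (simp add: hat_diff A ADn_sum f hat_sum H)
      also have "\<dots> = (\<Sum>\<^sub>\<infinity>i\<in>UNIV - F. hat (f i) x)"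
        by (rule infsum_Diff[symmetric]) (auto intro!: abs_summable_summable[OF abs[OF C x]])
      finally have "norm (hat (?s F) x) \<le> (\<Sum>\<^sub>\<infinity>i\<in>UNIV - F. sn C (f i))"
        using le[OF C x] by simp
      also have "\<dots> = (\<Sum>\<^sub>\<infinity>i. sn C (f i)) - (\<Sum>\<^sub>\<infinity>i\<in>F. sn C (f i))"
        by (rule infsum_Diff) (use F sm[OF C] in auto)
      finally show "norm (hat (?s F) x) \<le> (\<Sum>\<^sub>\<infinity>i. sn C (f i)) - (\<Sum>i\<in>F. sn C (f i))" using F by simp
    qed
    moreover have "((\<lambda>F. (\<Sum>\<^sub>\<infinity>i. sn C (f i)) - (\<Sum>i\<in>F. sn C (f i))) \<longlongrightarrow> 0) (finite_subsets_at_top UNIV)"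
      using tendsto_diff[OF tendsto_const[of "\<Sum>\<^sub>\<infinity>i. sn C (f i)"] infsum_tendsto[OF sm[OF C]]] by simp
    ultimately show "((\<lambda>F. sn C (?s F)) \<longlongrightarrow> 0) (finite_subsets_at_top UNIV)"
      by (intro tendsto_sandwich[of "\<lambda>_. 0" "\<lambda>F. sn C (?s F)" _ "\<lambda>F. (\<Sum>\<^sub>\<infinity>i. sn C (f i)) - (\<Sum>i\<in>F. sn C (f i))"])
         (auto intro!: eventually_finite_subsets_at_top_weakI sn_nonneg AF C)
  qed
qed

text \<open>On the chart on which \<open>frh k\<close> is a bare monomial, the point with all
  coordinates R gives exactly R^deg. Hence the absolute convergence demanded by
  \<open>schauder\<close> forces decay faster than any exponential.\<close>

lemma fr_lower_bound:
  assumes "R > 0"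
  shows "R ^ deg k \<le> sn (pdisc R) (fr (fst k) (snd k))"
proof -
  define x where "x = (if wt k \<le> 0 then chart1 (\<lambda>_. of_real R) else chart2 (\<lambda>_. of_real R) :: 'a pt \<times> 'a pt)"
  have "frh k x = mon (\<lambda>_. of_real R) k" by (auto simp: x_def frh_chart1 frh_chart2)
  also have "\<dots> = of_real (R ^ deg k)"
    by (simp add: mon_eq deg_def nabs_def power_add power_sum)
  finally have "norm (hat (fr (fst k) (snd k)) x) = R ^ deg k"
    using assms by (simp add: hat_fr norm_power)
  moreover have "x \<in> pdisc R" using assms by (auto simp: x_def pdisc_def)
  ultimately show ?thesis
    using sn_upper[OF fr_ADn pdisc_cpts[of R], of x "fst k" "snd k"] assms by simp
qed

text \<open>Seminorms of one-point sets turn convergence in the space into pointwise convergence of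
  the hats, so c represents \<open>hat a\<close> and uniqueness applies. The final theorem
  quantifies over arbitrary Schauder families; this lemma replaces them by
  \<open>coef\<close>.\<close>

lemma schauder_coef:
  assumes a: "a \<in> ADn" and s: "schauder a c"
  shows "c = coef a"
proof -
  have s1: "\<And>C. C \<in> cpts \<Longrightarrow> (\<lambda>k. norm (c k) * sn C (fr (fst k) (snd k))) summable_on UNIV"
    and s2: "fconv a (\<lambda>F w. \<Sum>k\<in>F. c k * fr (fst k) (snd k) w)"
    using s by (auto simp: schauder_def case_prod_unfold)
  have "represents c (hat a)"
    unfolding represents_def
  proof (intro conjI allI)
    show "decay2 c"
      unfolding decay2_def
    proof (intro allI impI)
      fix R :: real assume "R > 0"
      show "(\<lambda>k. norm (c k) * R ^ deg k) summable_on UNIV"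
        by (rule summable_on_comparison_test[OF s1[OF pdisc_cpts[of R]]])
           (use \<open>R > 0\<close> in \<open>auto intro!: mult_left_mono fr_lower_bound\<close>)
    qed
    fix x :: "'a pt \<times> 'a pt"
    show "hat a x = (\<Sum>\<^sub>\<infinity>k. c k * frh k x)"
    proof (cases "x \<in> Uset")
      case True
      have F: "(\<lambda>w. \<Sum>k\<in>F. c k * fr (fst k) (snd k) w) \<in> ADn" for F
        by (intro ADn_sum ADn_cmult fr_ADn)
      have eq: "sn {x} (a - (\<lambda>w. \<Sum>k\<in>F. c k * fr (fst k) (snd k) w)) = norm (hat a x - (\<Sum>k\<in>F. c k * frh k x))" for F
        unfolding sn_def by (simp add: hat_diff a F hat_sum ADn_cmult fr_ADn hat_cmult hat_fr)
      have "((\<lambda>F. sn {x} (a - (\<lambda>w. \<Sum>k\<in>F. c k * fr (fst k) (snd k) w))) \<longlongrightarrow> 0) (finite_subsets_at_top UNIV)"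
        using s2 single_cpts[OF True] unfolding fconv_def by blast
      then have "((\<lambda>F. norm (hat a x - (\<Sum>k\<in>F. c k * frh k x))) \<longlongrightarrow> 0) (finite_subsets_at_top UNIV)"
        unfolding eq .
      then have "((\<lambda>F. hat a x - (hat a x - (\<Sum>k\<in>F. c k * frh k x))) \<longlongrightarrow> hat a x - 0) (finite_subsets_at_top UNIV)"
        by (intro tendsto_diff tendsto_const) (simp only: tendsto_norm_zero_iff)
      then have "((\<lambda>k. c k * frh k x) has_sum hat a x) UNIV" by (simp add: has_sum_def)
      then show ?thesis by (simp add: infsumI)
    qed (simp add: hat_outside a frh_def fPh_def)
  qed
  then show ?thesis by (rule coef_eqI[symmetric])
qed

text \<open>Cauchy's estimate at radius \<open>2 * R\<close> costs only the factor (1/2)^deg at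
  radius R. Its sum K is the same for all functions a, which is what continuity of the product
  requires.\<close>

lemma coef_sum_bound:
  assumes R: "R > 0"
  obtains K where "K \<ge> 0"
    "\<And>a. a \<in> ADn \<Longrightarrow> (\<Sum>\<^sub>\<infinity>k. norm (coef a k) * R ^ deg k) \<le> K * sn (pdisc (2 * R)) (a :: 'n::finite fn)"
proof -
  have g: "(\<lambda>k::'n pmi. (1/2::real) ^ deg k) summable_on UNIV"
    using geometric_summable_mi[of "1/2", where 'j = "'n + 'n"] unfolding summable_on_pmi deg_eq[symmetric] by simp
  define K where "K = (\<Sum>\<^sub>\<infinity>k::'n pmi. (1/2::real) ^ deg k)"
  show ?thesis
  proof (rule that)
    show "K \<ge> 0" unfolding K_def by (rule infsum_nonneg) auto
    fix a :: "'n fn" assume a: "a \<in> ADn"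
    have "(\<Sum>\<^sub>\<infinity>k. norm (coef a k) * R ^ deg k) \<le> (\<Sum>\<^sub>\<infinity>k::'n pmi. sn (pdisc (2 * R)) a * (1/2) ^ deg k)"
    proof (rule infsum_mono)
      show "(\<lambda>k. norm (coef a k) * R ^ deg k) summable_on UNIV" using coef_decay[OF a] R by (simp add: decay2_def)
      show "(\<lambda>k::'n pmi. sn (pdisc (2 * R)) a * (1/2) ^ deg k) summable_on UNIV" by (intro summable_on_cmult_right g)
      fix k
      have "norm (coef a k) * (2 * R) ^ deg k \<le> sn (pdisc (2 * R)) a" using coef_bound[OF a, of "2 * R"] R by simp
      then show "norm (coef a k) * R ^ deg k \<le> sn (pdisc (2 * R)) a * (1/2) ^ deg k"
        by (simp add: power_mult_distrib power_divide field_simps)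
    qed
    also have "\<dots> = K * sn (pdisc (2 * R)) a" unfolding K_def by (simp add: infsum_cmult_right')
    finally show "(\<Sum>\<^sub>\<infinity>k. norm (coef a k) * R ^ deg k) \<le> K * sn (pdisc (2 * R)) a" .
  qed
qed

section \<open>The star product on polynomials\<close>

definition ff :: "complex \<Rightarrow> nat \<Rightarrow> complex" where
  "ff a k = (\<Prod>i = 0..<k. a - of_nat i)"

lemma ff_gbinomial: "ff a k = fact k * (a gchoose k)"
  by (simp add: ff_def gbinomial_mult_fact)

lemma ff_0 [simp]: "ff a 0 = 1"
  by (simp add: ff_def)

lemma ff_Suc: "ff a (Suc k) = ff a k * (a - of_nat k)"
  by (simp add: ff_def)

lemma ff_add: "ff a (m + k) = ff a m * ff (a - of_nat m) k"
  by (induction k) (simp_all add: ff_Suc algebra_simps)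

lemma ff_of_nat: "ff (of_nat S) k = fact k * of_nat (S choose k)"
  by (simp add: ff_gbinomial binomial_gbinomial)

text \<open>Vandermonde's convolution, rescaled from binomial coefficients to falling factorials; it
  holds for complex b because one binomial may have a complex top.\<close>

lemma ff_add_of_nat:
  "ff (b + of_nat S) P = (\<Sum>T\<le>P. fact T * of_nat (P choose T) * of_nat (S choose T) * ff b (P - T))"
proof -
  have "ff (b + of_nat S) P = (\<Sum>T\<le>P. fact P * ((of_nat S gchoose T) * (b gchoose (P - T))))"
    unfolding ff_gbinomial sum_distrib_left[symmetric] gbinomial_Vandermonde[symmetric, of "of_nat S" b P] add.commute[of b]
    by (simp add: atLeast0AtMost)
  also have "\<dots> = (\<Sum>T\<le>P. fact T * of_nat (P choose T) * of_nat (S choose T) * ff b (P - T))"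
  proof (rule sum.cong)
    fix T assume "T \<in> {..P}"
    then have "(fact P :: complex) = fact T * fact (P - T) * of_nat (P choose T)"
      using binomial_fact_lemma[of T P] by (metis atMost_iff of_nat_fact of_nat_mult)
    then show "fact P * ((of_nat S gchoose T) * (b gchoose (P - T)))
        = fact T * of_nat (P choose T) * of_nat (S choose T) * ff b (P - T)"
      by (simp add: ff_gbinomial binomial_gbinomial)
  qed simp
  finally show ?thesis .
qed

text \<open>The Leibniz rule for d^P y^S in one variable, composed with d^R and read off on the
  power y^a. Since only coefficients occur, a may be any complex number. Terms with T > S vanish
  through the binomial.\<close>

lemma ff_wick:
  "ff (a - of_nat R + of_nat S) P * ff a R =
     (\<Sum>T\<le>P. fact T * of_nat (P choose T) * of_nat (S choose T) * ff a (P + R - T))"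
  unfolding ff_add_of_nat sum_distrib_right
proof (rule sum.cong)
  fix T assume "T \<in> {..P}"
  then have "P + R - T = R + (P - T)" by simp
  then show "fact T * of_nat (P choose T) * of_nat (S choose T) * ff (a - of_nat R) (P - T) * ff a R =
      fact T * of_nat (P choose T) * of_nat (S choose T) * ff a (P + R - T)"
    by (simp add: ff_add mult_ac)
qed simp

definition mi_below :: "'n::finite mi \<Rightarrow> 'n mi \<Rightarrow> 'n mi set" where
  "mi_below P S = {T. mi_le T P \<and> mi_le T S}"

lemma mi_le_set: "{T. mi_le T P} = {..fst P} \<times> PiE UNIV (\<lambda>i. {..snd P i})"
  by (auto simp: mi_le_def)

lemma finite_mi_le: "finite {T. mi_le T (P :: 'n::finite mi)}"
  unfolding mi_le_set by (intro finite_cartesian_product finite_PiE) auto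

lemma finite_mi_below: "finite (mi_below P S)"
  by (rule finite_subset[OF _ finite_mi_le[of P]]) (auto simp: mi_below_def)

lemma mi_choose_eq_0: "\<not> mi_le T P \<Longrightarrow> mi_choose P T = 0"
  by (auto simp: mi_choose_def mi_le_def binomial_eq_0_iff not_le)

lemma mabs_mi_sub:
  assumes "mi_le T P"
  shows "mabs (mi_sub (mi_add P R) T) + mabs T = mabs P + mabs R"
proof -
  have "(\<Sum>i\<in>UNIV. snd P i + snd R i - snd T i) + (\<Sum>i\<in>UNIV. snd T i) = (\<Sum>i\<in>UNIV. snd P i + snd R i)"
    unfolding sum.distrib[symmetric] using assms by (intro sum.cong) (auto simp: mi_le_def trans_le_add1)
  then show ?thesis using assms by (simp add: mabs_def mi_sub_def mi_add_def mi_le_def sum.distrib)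
qed

text \<open>The Wick product is represented by letting z^P zbar^Q act as the differential operator
  y^Q (2 h eta d/dy)^P, eta = diag(-1,1,...,1), on functions that are homogeneous of degree -1/(2h);
  cf is the coefficient it picks up at the monomial whose exponents are -1/(2h) - |b| in direction 0
  and b otherwise. Integer b keeps the exponent shifts free of truncated subtraction.\<close>

definition cf :: "complex \<Rightarrow> 'n::finite mi \<Rightarrow> ('n \<Rightarrow> int) \<Rightarrow> complex" where
  "cf h P b = (-1) ^ fst P * (2 * h) ^ mabs P * ff (- 1 / (2 * h) - of_int (\<Sum>i\<in>UNIV. b i)) (fst P)
     * (\<Prod>i\<in>UNIV. ff (of_int (b i)) (snd P i))"

definition shift :: "('n \<Rightarrow> int) \<Rightarrow> 'n mi \<Rightarrow> 'n mi \<Rightarrow> 'n \<Rightarrow> int" where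
  "shift b P Q = (\<lambda>i. b i - int (snd P i) + int (snd Q i))"

definition wc :: "complex \<Rightarrow> 'n::finite mi \<Rightarrow> 'n mi \<Rightarrow> 'n mi \<Rightarrow> complex" where
  "wc h P S T = (-1) ^ fst T * (2 * h) ^ mabs T * of_nat (mi_fact T)
         * of_nat (mi_choose P T) * of_nat (mi_choose S T)"

text \<open>For |R| = |S| total homogeneity is preserved, so the exponent in direction 0, determined
  by b, obeys the same rule as the others: lowered by the zeroth entry of R and raised by that of
  S.\<close>

lemma sum_shift:
  assumes "mabs R = mabs S"
  shows "(\<Sum>i\<in>UNIV. shift b R S i) = (\<Sum>i\<in>UNIV. b i) + int (fst R) - int (fst S)"
proof -
  have "int (fst R) + (\<Sum>i\<in>UNIV. int (snd R i)) = int (fst S) + (\<Sum>i\<in>UNIV. int (snd S i))"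
    using assms unfolding mabs_def by (metis of_nat_add of_nat_sum)
  then show ?thesis by (simp add: shift_def sum.distrib sum_subtractf)
qed

text \<open>Direction by direction this is \<open>ff_wick\<close>; multiplying out the 1 + n sums
  gives one sum over multi-indices T. The sign and the power of 2h in the Wick coefficient are what
  is left over when those of exponent P + R are compared with those of P + R - T.\<close>

lemma cf_mult:
  fixes P R S :: "'n::finite mi"
  assumes RS: "mabs R = mabs S"
  shows "cf h P (shift b R S) * cf h R b = (\<Sum>T\<in>mi_below P S. wc h P S T * cf h (mi_sub (mi_add P R) T) b)"
proof -
  define a where "a = - 1 / (2 * h) - of_int (\<Sum>i\<in>UNIV. b i)"
  define X where "X t = fact t * of_nat (fst P choose t) * of_nat (fst S choose t) * ff a (fst P + fst R - t)" for t
  define Y where "Y i t = fact t * of_nat (snd P i choose t) * of_nat (snd S i choose t) * ff (of_int (b i)) (snd P i + snd R i - t)" for i t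
  have a: "- 1 / (2 * h) - of_int (\<Sum>i\<in>UNIV. shift b R S i) = a - of_nat (fst R) + of_nat (fst S)"
    unfolding sum_shift[OF RS] a_def by simp
  have b: "of_int (shift b R S i) = of_int (b i) - of_nat (snd R i) + of_nat (snd S i)" for i
    by (simp add: shift_def)
  have "cf h P (shift b R S) * cf h R b = (-1) ^ (fst P + fst R) * (2 * h) ^ (mabs P + mabs R)
     * ((ff (a - of_nat (fst R) + of_nat (fst S)) (fst P) * ff a (fst R)) *
       (\<Prod>i\<in>UNIV. ff (of_int (b i) - of_nat (snd R i) + of_nat (snd S i)) (snd P i) * ff (of_int (b i)) (snd R i)))"
    unfolding cf_def a b a_def[symmetric] prod.distrib power_add by (simp add: mult_ac)
  also have "\<dots> = (-1) ^ (fst P + fst R) * (2 * h) ^ (mabs P + mabs R) * ((\<Sum>t\<le>fst P. X t) * (\<Prod>i\<in>UNIV. \<Sum>t\<le>snd P i. Y i t))"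
    unfolding ff_wick X_def Y_def ..
  also have "(\<Prod>i\<in>UNIV. \<Sum>t\<le>snd P i. Y i t) = (\<Sum>T\<in>PiE UNIV (\<lambda>i. {..snd P i}). \<Prod>i\<in>UNIV. Y i (T i))"
    by (rule prod_sum_PiE) auto
  also have "(\<Sum>t\<le>fst P. X t) * \<dots> = (\<Sum>T\<in>{T. mi_le T P}. X (fst T) * (\<Prod>i\<in>UNIV. Y i (snd T i)))"
    unfolding mi_le_set sum_product sum.cartesian_product by (simp add: case_prod_unfold)
  also have "(-1) ^ (fst P + fst R) * (2 * h) ^ (mabs P + mabs R) * \<dots> =
      (\<Sum>T\<in>{T. mi_le T P}. wc h P S T * cf h (mi_sub (mi_add P R) T) b)"
    unfolding sum_distrib_left
  proof (rule sum.cong)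
    fix T assume "T \<in> {T. mi_le T P}"
    then have T: "mi_le T P" by simp
    then have "(-1) ^ (fst P + fst R) = (-1) ^ fst T * ((-1) ^ (fst P + fst R - fst T) :: complex)"
      by (simp add: mi_le_def power_add[symmetric])
    moreover have "(2 * h) ^ (mabs P + mabs R) = (2 * h) ^ mabs T * (2 * h) ^ mabs (mi_sub (mi_add P R) T)"
      by (simp add: mabs_mi_sub[OF T, of R, symmetric] power_add)
    ultimately show "(-1) ^ (fst P + fst R) * (2 * h) ^ (mabs P + mabs R) * (X (fst T) * (\<Prod>i\<in>UNIV. Y i (snd T i))) =
        wc h P S T * cf h (mi_sub (mi_add P R) T) b"
      unfolding wc_def cf_def a_def[symmetric] X_def Y_def
      by (simp add: mi_fact_def mi_choose_def mi_sub_def mi_add_def prod.distrib mult_ac)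
  qed simp
  also have "\<dots> = (\<Sum>T\<in>mi_below P S. wc h P S T * cf h (mi_sub (mi_add P R) T) b)"
    by (rule sum.mono_neutral_right[OF finite_mi_le])
       (auto simp: mi_below_def wc_def mi_choose_eq_0)
  finally show ?thesis .
qed

lemma shift_shift:
  assumes "T \<in> mi_below P S"
  shows "shift (shift b R S) P Q = shift b (mi_sub (mi_add P R) T) (mi_sub (mi_add Q S) T)"
proof
  fix i
  have "snd T i \<le> snd P i" "snd T i \<le> snd S i" using assms by (auto simp: mi_below_def mi_le_def)
  then show "shift (shift b R S) P Q i = shift b (mi_sub (mi_add P R) T) (mi_sub (mi_add Q S) T) i"
    by (simp add: shift_def mi_sub_def mi_add_def)
qed

section \<open>Finitely supported combinations and the Wick product as an iterated sum\<close>

definition lin :: "('k \<Rightarrow> complex) \<Rightarrow> ('k \<Rightarrow> complex) \<Rightarrow> complex" where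
  "lin c l = (\<Sum>k\<in>{k. c k \<noteq> 0}. c k * l k)"

lemma lin_superset:
  assumes "finite K" "{k. c k \<noteq> 0} \<subseteq> K"
  shows "lin c l = (\<Sum>k\<in>K. c k * l k)"
  unfolding lin_def by (rule sum.mono_neutral_left) (use assms in auto)

lemma lin_lincomb:
  assumes "finite {k. c k \<noteq> 0}" "finite {k. c' k \<noteq> 0}"
  shows "lin (\<lambda>k. z * c k + c' k) l = z * lin c l + lin c' l"
proof -
  define K where "K = {k. c k \<noteq> 0} \<union> {k. c' k \<noteq> 0}"
  have "finite K" "{k. c k \<noteq> 0} \<subseteq> K" "{k. c' k \<noteq> 0} \<subseteq> K" "{k. z * c k + c' k \<noteq> 0} \<subseteq> K"
    using assms by (auto simp: K_def)
  then show ?thesis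
    by (simp add: lin_superset[of K] sum_distrib_left sum.distrib distrib_right mult.assoc)
qed

lemma lin_cong: "(\<And>k. c k \<noteq> 0 \<Longrightarrow> l k = l' k) \<Longrightarrow> lin c l = lin c l'"
  unfolding lin_def by (rule sum.cong) auto

lemma lin_add_right: "lin c (\<lambda>k. z * l k + l' k) = z * lin c l + lin c l'"
  unfolding lin_def by (simp add: sum.distrib sum_distrib_left algebra_simps)

lemma lin_cmult_right: "lin c (\<lambda>k. z * l k) = z * lin c l"
  unfolding lin_def by (simp add: sum_distrib_left algebra_simps)

lemma lin_swap: "lin c (\<lambda>x. lin e (\<lambda>y. f x y)) = lin e (\<lambda>y. lin c (\<lambda>x. f x y))"
  unfolding lin_def sum_distrib_left by (subst sum.swap) (simp add: mult_ac)

lemma lin_single: "lin (\<lambda>k. if k = k0 then z else 0) l = z * l k0"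
proof -
  have "lin (\<lambda>k. if k = k0 then z else 0) l = (\<Sum>k\<in>{k0}. (if k = k0 then z else 0) * l k)"
    by (rule lin_superset) auto
  then show ?thesis by simp
qed

definition wk :: "'n mi \<times> 'n mi \<Rightarrow> 'n mi \<times> 'n mi \<Rightarrow> 'n mi \<Rightarrow> 'n mi \<times> 'n mi" where
  "wk x y T = (mi_sub (mi_add (fst x) (fst y)) T, mi_sub (mi_add (snd x) (snd y)) T)"

definition wick_index :: "('n::finite mi \<times> 'n mi \<Rightarrow> complex) \<Rightarrow> ('n mi \<times> 'n mi \<Rightarrow> complex)
    \<Rightarrow> (('n mi \<times> 'n mi) \<times> ('n mi \<times> 'n mi) \<times> 'n mi) set" where
  "wick_index c e = Sigma {x. c x \<noteq> 0} (\<lambda>x. Sigma {y. e y \<noteq> 0} (\<lambda>y. mi_below (fst x) (snd y)))"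

lemma finite_wick_index: "finite {k. c k \<noteq> 0} \<Longrightarrow> finite {k. e k \<noteq> 0} \<Longrightarrow> finite (wick_index c e)"
  unfolding wick_index_def by (intro finite_SigmaI finite_mi_below) auto

lemma wick_eq:
  "wick h c e k = (\<Sum>i\<in>{i \<in> wick_index c e. wk (fst i) (fst (snd i)) (snd (snd i)) = k}.
     c (fst i) * e (fst (snd i)) * wc h (fst (fst i)) (snd (fst (snd i))) (snd (snd i)))"
  unfolding wick_def
proof (rule sum.cong)
  show "{(x, y, T). c x \<noteq> 0 \<and> e y \<noteq> 0 \<and> mi_le T (fst x) \<and> mi_le T (snd y) \<and>
          k = (mi_sub (mi_add (fst x) (fst y)) T, mi_sub (mi_add (snd x) (snd y)) T)} =
      {i \<in> wick_index c e. wk (fst i) (fst (snd i)) (snd (snd i)) = k}"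
    by (auto simp: wick_index_def wk_def mi_below_def)
qed (auto simp: wc_def)

lemma wick_support:
  "{k. wick h c e k \<noteq> 0} \<subseteq> (\<lambda>i. wk (fst i) (fst (snd i)) (snd (snd i))) ` wick_index c e"
proof
  fix k assume k: "k \<in> {k. wick h c e k \<noteq> 0}"
  show "k \<in> (\<lambda>i. wk (fst i) (fst (snd i)) (snd (snd i))) ` wick_index c e"
  proof (rule ccontr)
    assume "\<not> ?thesis"
    then have "{i \<in> wick_index c e. wk (fst i) (fst (snd i)) (snd (snd i)) = k} = {}" by blast
    then have "wick h c e k = 0" unfolding wick_eq by (simp only: sum.empty)
    then show False using k by simp
  qed
qed

text \<open>\<open>wick\<close> collects the triples (x, y, T) by their resulting exponent. Pairing
  with a functional l undoes the grouping, and no information about collisions of exponents is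
  required.\<close>

lemma lin_wick:
  fixes c e :: "'n::finite mi \<times> 'n mi \<Rightarrow> complex"
  assumes c: "finite {k. c k \<noteq> 0}" and e: "finite {k. e k \<noteq> 0}"
  shows "lin (wick h c e) l =
    lin c (\<lambda>x. lin e (\<lambda>y. \<Sum>T\<in>mi_below (fst x) (snd y). wc h (fst x) (snd y) T * l (wk x y T)))"
proof -
  define g where "g i = wk (fst i) (fst (snd i)) (snd (snd i))"
    for i :: "('n mi \<times> 'n mi) \<times> ('n mi \<times> 'n mi) \<times> 'n mi"
  define w where "w i = c (fst i) * e (fst (snd i)) * wc h (fst (fst i)) (snd (fst (snd i))) (snd (snd i))"
    for i :: "('n mi \<times> 'n mi) \<times> ('n mi \<times> 'n mi) \<times> 'n mi"
  note fin = finite_wick_index[OF c e]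
  have "lin (wick h c e) l = (\<Sum>k\<in>g ` wick_index c e. wick h c e k * l k)"
    by (rule lin_superset) (use fin wick_support[of h c e] in \<open>auto simp: g_def\<close>)
  also have "\<dots> = (\<Sum>k\<in>g ` wick_index c e. \<Sum>i\<in>{i \<in> wick_index c e. g i = k}. w i * l (g i))"
    unfolding wick_eq sum_distrib_right by (intro sum.cong refl) (auto simp: g_def w_def)
  also have "\<dots> = (\<Sum>i\<in>wick_index c e. w i * l (g i))"
    by (rule sum.image_gen[OF fin, symmetric])
  also have "\<dots> = (\<Sum>x\<in>{x. c x \<noteq> 0}. \<Sum>y\<in>{y. e y \<noteq> 0}. \<Sum>T\<in>mi_below (fst x) (snd y). w (x, y, T) * l (g (x, y, T)))"
    unfolding wick_index_def
    by (simp add: sum.Sigma c e finite_mi_below finite_SigmaI case_prod_unfold)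
  also have "\<dots> = lin c (\<lambda>x. lin e (\<lambda>y. \<Sum>T\<in>mi_below (fst x) (snd y). wc h (fst x) (snd y) T * l (wk x y T)))"
    unfolding lin_def sum_distrib_left by (simp add: w_def g_def mult_ac)
  finally show ?thesis .
qed

lemma UpolD: "c \<in> Upol \<Longrightarrow> finite {k. c k \<noteq> 0}" "c \<in> Upol \<Longrightarrow> c k \<noteq> 0 \<Longrightarrow> mabs (fst k) = mabs (snd k)"
  unfolding Upol_def by (simp, cases k, auto)

lemma UpolI: "finite {k. c k \<noteq> 0} \<Longrightarrow> (\<And>k. c k \<noteq> 0 \<Longrightarrow> mabs (fst k) = mabs (snd k)) \<Longrightarrow> c \<in> Upol"
  unfolding Upol_def by force

lemma wick_Upol:
  assumes c: "c \<in> Upol" and e: "e \<in> Upol"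
  shows "wick h c e \<in> Upol"
proof (rule UpolI)
  show "finite {k. wick h c e k \<noteq> 0}"
    by (rule finite_subset[OF wick_support]) (intro finite_imageI finite_wick_index UpolD assms)
  fix k assume "wick h c e k \<noteq> 0"
  then obtain x y T where k: "k = wk x y T" and x: "c x \<noteq> 0" "e y \<noteq> 0" "T \<in> mi_below (fst x) (snd y)"
    using wick_support[of h c e] by (auto simp: wick_index_def)
  have "mabs (fst k) + mabs T = mabs (fst x) + mabs (fst y)"
    unfolding k wk_def fst_conv using x by (intro mabs_mi_sub) (auto simp: mi_below_def)
  moreover have "mi_add (snd x) (snd y) = mi_add (snd y) (snd x)" by (simp add: mi_add_def add.commute)
  then have "mabs (snd k) + mabs T = mabs (snd y) + mabs (snd x)"
    unfolding k wk_def snd_conv using x by (simp add: mabs_mi_sub mi_below_def)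
  ultimately show "mabs (fst k) = mabs (snd k)"
    using UpolD(2)[OF c x(1)] UpolD(2)[OF e x(2)] by simp
qed

lemma Upol_lincomb:
  assumes "c \<in> Upol" "c' \<in> Upol"
  shows "(\<lambda>k. z * c k + c' k) \<in> Upol"
proof (rule UpolI)
  show "finite {k. z * c k + c' k \<noteq> 0}"
    by (rule finite_subset[of _ "{k. c k \<noteq> 0} \<union> {k. c' k \<noteq> 0}"]) (use UpolD(1) assms in auto)
  fix k assume "z * c k + c' k \<noteq> 0"
  then show "mabs (fst k) = mabs (snd k)"
    using UpolD(2)[OF assms(1), of k] UpolD(2)[OF assms(2), of k] by (cases "c k = 0") auto
qed

text \<open>The transpose of the differential operator of c: f is a function of the output
  exponents, b an input exponent. Arbitrary f are allowed, which makes it easy to single out one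
  exponent, and composition is reversed.\<close>

definition Op :: "complex \<Rightarrow> ('n::finite mi \<times> 'n mi \<Rightarrow> complex) \<Rightarrow> (('n \<Rightarrow> int) \<Rightarrow> complex) \<Rightarrow> ('n \<Rightarrow> int) \<Rightarrow> complex" where
  "Op h c f b = lin c (\<lambda>k. cf h (fst k) b * f (shift b (fst k) (snd k)))"

text \<open>By \<open>shift_shift\<close> all T contributing to a pair x, y lead to the same output
  exponent, so the value of f factors out; the remaining sum over T is
  \<open>cf_mult\<close>.\<close>

lemma Op_wick:
  assumes c: "c \<in> Upol" and e: "e \<in> Upol"
  shows "Op h (wick h c e) f = Op h e (Op h c f)"
proof
  fix b
  have "Op h (wick h c e) f b = lin c (\<lambda>x. lin e (\<lambda>y. \<Sum>T\<in>mi_below (fst x) (snd y). wc h (fst x) (snd y) T *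
      (cf h (fst (wk x y T)) b * f (shift b (fst (wk x y T)) (snd (wk x y T))))))"
    unfolding Op_def by (rule lin_wick[OF UpolD(1)[OF c] UpolD(1)[OF e]])
  also have "\<dots> = lin c (\<lambda>x. lin e (\<lambda>y. cf h (fst y) b *
      (cf h (fst x) (shift b (fst y) (snd y)) * f (shift (shift b (fst y) (snd y)) (fst x) (snd x)))))"
  proof (intro lin_cong)
    fix x y assume "c x \<noteq> 0" "e y \<noteq> 0"
    then have y: "mabs (fst y) = mabs (snd y)" using UpolD(2)[OF e] by blast
    have "(\<Sum>T\<in>mi_below (fst x) (snd y). wc h (fst x) (snd y) T *
          (cf h (fst (wk x y T)) b * f (shift b (fst (wk x y T)) (snd (wk x y T))))) =
        (\<Sum>T\<in>mi_below (fst x) (snd y). wc h (fst x) (snd y) T * cf h (mi_sub (mi_add (fst x) (fst y)) T) b)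
         * f (shift (shift b (fst y) (snd y)) (fst x) (snd x))"
      unfolding sum_distrib_right
      by (intro sum.cong refl) (simp add: wk_def shift_shift)
    then show "(\<Sum>T\<in>mi_below (fst x) (snd y). wc h (fst x) (snd y) T *
          (cf h (fst (wk x y T)) b * f (shift b (fst (wk x y T)) (snd (wk x y T))))) =
        cf h (fst y) b * (cf h (fst x) (shift b (fst y) (snd y)) * f (shift (shift b (fst y) (snd y)) (fst x) (snd x)))"
      unfolding cf_mult[OF y, symmetric] by (simp add: mult_ac)
  qed
  also have "\<dots> = Op h e (Op h c f) b"
    unfolding Op_def by (subst lin_swap) (simp add: lin_cmult_right)
  finally show "Op h (wick h c e) f b = Op h e (Op h c f) b" .
qed

lemma Op_lincomb:
  "c \<in> Upol \<Longrightarrow> c' \<in> Upol \<Longrightarrow> Op h (\<lambda>k. z * c k + c' k) f b = z * Op h c f b + Op h c' f b"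
  unfolding Op_def by (rule lin_lincomb) (auto dest: UpolD)

lemma Op_linear_right: "Op h c (\<lambda>b. z * f b + f' b) b = z * Op h c f b + Op h c f' b"
  unfolding Op_def lin_add_right[symmetric] by (simp add: algebra_simps)

section \<open>Normalised coefficients and reduction to the basis\<close>

definition nrm :: "complex \<Rightarrow> nat \<Rightarrow> complex" where
  "nrm h m = (2 * h) ^ m * pochhammer (1 / (2 * h)) m"

lemma psi_lin: "psi h c w = lin c (\<lambda>k. nrm h (mabs (fst k)) * fP (fst k) (snd k) w)"
  by (simp add: psi_def lin_def nrm_def mult.assoc)

text \<open>At m = 0 the expression is 1 / (2h); for m >= 1 it could vanish only at the value h = -1
  / (2m), which H excludes.\<close>

lemma Hset_nonzero:
  assumes "h \<in> Hset"
  shows "h \<noteq> 0" "1 / (2 * h) + of_nat m \<noteq> 0"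
proof -
  show h: "h \<noteq> 0" using assms by (simp add: Hset_def)
  show "1 / (2 * h) + of_nat m \<noteq> 0"
  proof
    assume eq: "1 / (2 * h) + of_nat m = 0"
    have m: "m \<noteq> 0" using eq h by (cases "m = 0") auto
    have "1 + of_nat m * (2 * h) = 0" using eq h by (simp add: field_simps)
    then have "h * (2 * of_nat m) = - 1" by (simp add: algebra_simps eq_neg_iff_add_eq_0)
    then have "h = - 1 / (2 * of_nat m)" by (subst nonzero_eq_divide_eq) (use m in auto)
    moreover have "m \<ge> 1" using m by simp
    ultimately show False using assms unfolding Hset_def by blast
  qed
qed

lemma nrm_nonzero: "h \<in> Hset \<Longrightarrow> nrm h m \<noteq> 0"
  using Hset_nonzero[of h] by (auto simp: nrm_def pochhammer_prod)

lemma nrm_Suc: "h \<in> Hset \<Longrightarrow> nrm h (Suc m) = nrm h m * (2 * h * (1 / (2 * h) + of_nat m))"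
  by (simp add: nrm_def pochhammer_Suc mult_ac)

text \<open>Dividing by the factor that \<open>psi\<close> multiplies in gives \<open>psi\<close>
  and \<open>Op\<close> the common form
  \<open>lin c (\<lambda>k. nrm h (mabs (fst k)) * l k)\<close>, with l taken from f_{P,Q} or from
  this coefficient.\<close>

definition cfn :: "complex \<Rightarrow> 'n::finite mi \<Rightarrow> ('n \<Rightarrow> int) \<Rightarrow> complex" where
  "cfn h P b = cf h P b / nrm h (mabs P)"

lemma Op_cfn: "h \<in> Hset \<Longrightarrow> Op h c f b =
   lin c (\<lambda>k. nrm h (mabs (fst k)) * (cfn h (fst k) b * f (shift b (fst k) (snd k))))"
  unfolding Op_def cfn_def by (intro lin_cong) (simp add: nrm_nonzero)

definition inc0 :: "'n mi \<Rightarrow> 'n mi" where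
  "inc0 P = (Suc (fst P), snd P)"

definition inc :: "'n \<Rightarrow> 'n mi \<Rightarrow> 'n mi" where
  "inc i P = (fst P, (snd P)(i := Suc (snd P i)))"

text \<open>On the quadric p0 q0 = 1 + p.q one has f_{P+e0,Q+e0} = f_{P,Q} + (sum over i of f_{P+ei,Q+ei});
  used repeatedly, this relation reduces every f_{P,Q} to the basis elements f_{r,P,Q}.\<close>

definition reductive :: "('n::finite mi \<times> 'n mi \<Rightarrow> complex) \<Rightarrow> bool" where
  "reductive l \<longleftrightarrow> (\<forall>P Q. mabs P = mabs Q \<longrightarrow> l (inc0 P, inc0 Q) = l (P, Q) + (\<Sum>i\<in>UNIV. l (inc i P, inc i Q)))"

text \<open>The combination n is chosen before the functional l. It is this uniformity that lets a
  reduction be read both for \<open>psi\<close> and for \<open>Op\<close>.\<close>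

definition red :: "(('n::finite mi \<times> 'n mi \<Rightarrow> complex) \<Rightarrow> complex) \<Rightarrow> bool" where
  "red F \<longleftrightarrow> (\<exists>n. finite {j. n j \<noteq> 0} \<and> (\<forall>l. reductive l \<longrightarrow> F l = lin n (\<lambda>j. l (lift1 j, lift2 j))))"

lemma sum_fun_upd_Suc: "(\<Sum>k\<in>UNIV. (f(i := Suc (f i))) k) = Suc (\<Sum>k\<in>UNIV. f k)" for f :: "'n::finite \<Rightarrow> nat"
  by (simp add: sum.remove[of UNIV i])

lemma prod_fun_upd: "(\<Prod>k\<in>UNIV. g k ((f(i := y)) k)) = g i y * (\<Prod>k\<in>UNIV - {i}. g k (f k))" for g :: "'n::finite \<Rightarrow> 'b \<Rightarrow> complex"
  by (simp add: prod.remove[of UNIV i])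

lemma mabs_inc [simp]: "mabs (inc0 P) = Suc (mabs P)" "mabs (inc i P) = Suc (mabs P)"
  by (simp_all add: mabs_def inc0_def inc_def sum_fun_upd_Suc del: fun_upd_apply)

lemma red_lincomb:
  assumes "red F" "red G"
  shows "red (\<lambda>l. z * F l + G l)"
proof -
  obtain n where n: "finite {j. n j \<noteq> 0}" "\<And>l. reductive l \<Longrightarrow> F l = lin n (\<lambda>j. l (lift1 j, lift2 j))"
    using assms(1) by (auto simp: red_def)
  obtain m where m: "finite {j. m j \<noteq> 0}" "\<And>l. reductive l \<Longrightarrow> G l = lin m (\<lambda>j. l (lift1 j, lift2 j))"
    using assms(2) by (auto simp: red_def)
  have "finite {j. z * n j + m j \<noteq> 0}"
    by (rule finite_subset[of _ "{j. n j \<noteq> 0} \<union> {j. m j \<noteq> 0}"]) (use n m in auto)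
  then show ?thesis
    unfolding red_def by (intro exI[of _ "\<lambda>j. z * n j + m j"]) (simp add: n m lin_lincomb)
qed

lemma red_cong: "red F \<Longrightarrow> (\<And>l. reductive l \<Longrightarrow> F l = G l) \<Longrightarrow> red G"
  unfolding red_def by (elim exE conjE, rule exI) auto

lemma red_zero: "red (\<lambda>_. 0)"
  unfolding red_def by (intro exI[of _ "\<lambda>_. 0"]) (simp add: lin_def)

lemma red_sum: "finite I \<Longrightarrow> (\<And>i. i \<in> I \<Longrightarrow> red (F i)) \<Longrightarrow> red (\<lambda>l. \<Sum>i\<in>I. z i * F i l)"
  by (induction I rule: finite_induct) (auto intro: red_zero red_lincomb)

text \<open>Induction on the zeroth exponent of P: the relation lowers it by one in every resulting
  term. It stops as soon as one of the two zeroth exponents is 0, and such a pair has the form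
  (\<open>lift1 j\<close>, \<open>lift2 j\<close>).\<close>

lemma red_single:
  assumes "mabs P = mabs Q"
  shows "red (\<lambda>l. l (P, Q))"
  using assms
proof (induction "fst P" arbitrary: P Q)
  have base: "red (\<lambda>l. l (P, Q))" if "mabs P = mabs Q" "fst P = 0 \<or> fst Q = 0" for P Q :: "'n::finite mi"
  proof -
    have "(lift1 (snd P, snd Q), lift2 (snd P, snd Q)) = (P, Q)"
      using that by (auto simp: lift1_def lift2_def mabs_def nabs_def prod_eq_iff)
    moreover have "finite {j. (if j = (snd P, snd Q) then 1 else 0 :: complex) \<noteq> 0}" by simp
    ultimately show ?thesis
      unfolding red_def by (intro exI[of _ "\<lambda>j. if j = (snd P, snd Q) then 1 else 0"]) (simp add: lin_single)
  qed
  { case 0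
    then show ?case by (intro base) auto }
  { case (Suc p)
    show ?case
    proof (cases "fst Q")
      case 0
      then show ?thesis using Suc by (intro base) auto
    next
      case (Suc q)
      define P0 Q0 where "P0 = (p, snd P)" and "Q0 = (q, snd Q)"
      have PQ: "P = inc0 P0" "Q = inc0 Q0"
        using Suc \<open>Suc p = fst P\<close> by (simp_all add: P0_def Q0_def inc0_def prod_eq_iff)
      have m: "mabs P0 = mabs Q0" using Suc.prems by (simp add: PQ)
      have r1: "red (\<lambda>l. l (P0, Q0))" by (rule Suc.hyps(1)[OF _ m]) (simp add: P0_def)
      have r2: "red (\<lambda>l. l (inc i P0, inc i Q0))" for i
      proof (rule Suc.hyps(1))
        show "p = fst (inc i P0)" by (simp add: inc_def P0_def)
        show "mabs (inc i P0) = mabs (inc i Q0)" by (simp add: m)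
      qed
      have r: "red (\<lambda>l. 1 * l (P0, Q0) + (\<Sum>i\<in>UNIV. 1 * l (inc i P0, inc i Q0)))"
        by (intro red_lincomb[OF r1] red_sum[OF finite r2])
      then show ?thesis
        unfolding PQ by (rule red_cong) (use m in \<open>simp add: reductive_def del: split_paired_All\<close>)
    qed }
qed

lemma wpow_Suc: "wpow w (P(i := Suc (P i))) = w $ i * wpow w P"
proof -
  have "wpow w (P(i := Suc (P i))) = w $ i ^ Suc (P i) * (\<Prod>k\<in>UNIV - {i}. w $ k ^ P k)"
    unfolding wpow_def by (rule prod_fun_upd[of "\<lambda>k m. w $ k ^ m"])
  also have "\<dots> = w $ i * wpow w P"
    unfolding wpow_def by (simp add: prod.remove[of UNIV i "\<lambda>k. w $ k ^ P k"])
  finally show ?thesis .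
qed

lemma snd_inc: "snd (inc i P) = (snd P)(i := Suc (snd P i))"
  by (simp add: inc_def)

lemma cnjv_nth: "cnjv w $ i = cnj (w $ i)"
  by (simp add: cnjv_def)

text \<open>With D = 1 - w.wbar this is A / D^(m+1) = A / D^m + (1 - D) A / D^(m+1), as w.wbar = 1 -
  D.\<close>

lemma reductive_fP: "reductive (\<lambda>k. fP (fst k) (snd k) w)"
  unfolding reductive_def
proof (intro allI impI)
  fix P Q :: "'a mi" assume PQ: "mabs P = mabs Q"
  show "fP (fst (inc0 P, inc0 Q)) (snd (inc0 P, inc0 Q)) w =
      fP (fst (P, Q)) (snd (P, Q)) w + (\<Sum>i\<in>UNIV. fP (fst (inc i P, inc i Q)) (snd (inc i P, inc i Q)) w)"
  proof (cases "w \<in> ball 0 1")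
    case True
    define A where "A = wpow w (snd P) * wpow (cnjv w) (snd Q)"
    define D where "D = 1 - wdot w"
    have D: "D \<noteq> 0" using wdot_ball[OF True] by (simp add: D_def)
    have "(\<Sum>i\<in>UNIV. fP (inc i P) (inc i Q) w) = (\<Sum>i\<in>UNIV. (w $ i * cnj (w $ i)) * (A / D ^ Suc (mabs P)))"
      using True by (intro sum.cong refl) (simp add: fP_def snd_inc wpow_Suc A_def D_def cnjv_nth mult_ac)
    also have "\<dots> = wdot w * (A / D ^ Suc (mabs P))"
      by (simp only: wdot_def sum_distrib_right)
    finally have e1: "(\<Sum>i\<in>UNIV. fP (inc i P) (inc i Q) w) = wdot w * (A / D ^ Suc (mabs P))" .
    have e2: "fP (inc0 P) (inc0 Q) w = A / D ^ Suc (mabs P)" "fP P Q w = A / D ^ mabs P"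
      using True by (simp_all add: fP_def A_def D_def) (simp_all add: inc0_def)
    have e3: "wdot w = 1 - D" by (simp add: D_def)
    show ?thesis unfolding fst_conv snd_conv e1 e2 e3 using D by (simp add: field_simps)
  qed (simp add: fP_def)
qed

lemma cf_inc0: "cf h (inc0 P) b = cf h P b * (2 * h * (1 / (2 * h) + of_int (\<Sum>i\<in>UNIV. b i) + of_nat (fst P)))"
proof -
  define a where "a = - 1 / (2 * h) - of_int (\<Sum>i\<in>UNIV. b i)"
  have A: "1 / (2 * h) + of_int (\<Sum>i\<in>UNIV. b i) + of_nat (fst P) = - (a - of_nat (fst P))" by (simp add: a_def)
  have i0: "fst (inc0 P) = Suc (fst P)" "snd (inc0 P) = snd P" by (simp_all add: inc0_def)
  show ?thesis
    unfolding cf_def mabs_inc i0 A a_def[symmetric] ff_Suc power_Suc by algebra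
qed

lemma cf_inc: "cf h (inc i P) b = cf h P b * (2 * h * (of_int (b i) - of_nat (snd P i)))"
proof -
  have "(\<Prod>k\<in>UNIV. ff (of_int (b k)) (snd (inc i P) k)) =
      ff (of_int (b i)) (Suc (snd P i)) * (\<Prod>k\<in>UNIV - {i}. ff (of_int (b k)) (snd P k))"
    unfolding inc_def snd_conv by (rule prod_fun_upd[of "\<lambda>k m. ff (of_int (b k)) m"])
  also have "\<dots> = (\<Prod>k\<in>UNIV. ff (of_int (b k)) (snd P k)) * (of_int (b i) - of_nat (snd P i))"
    by (simp add: prod.remove[of UNIV i "\<lambda>k. ff (of_int (b k)) (snd P k)"] ff_Suc)
  finally show ?thesis
    unfolding cf_def mabs_inc by (simp add: inc_def mult_ac)
qed

lemma shift_inc: "shift b (inc0 P) (inc0 Q) = shift b P Q" "shift b (inc i P) (inc i Q) = shift b P Q"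
  by (auto simp: shift_def inc0_def inc_def fun_eq_iff)

text \<open>Euler's relation for functions homogeneous of degree -x, where x = 1 / (2h). Relative to
  the coefficient of P, raising direction 0 contributes (x + |b| + P_0) / (x + |P|) and raising
  direction i contributes (b_i - P_i) / (x + |P|), with |b| the sum of the b_i; the first is 1 plus
  the sum of the others. The output exponent does not change, so f is only a common factor.\<close>

lemma reductive_cfn:
  assumes h: "h \<in> Hset"
  shows "reductive (\<lambda>k. cfn h (fst k) b * f (shift b (fst k) (snd k)))"
  unfolding reductive_def fst_conv snd_conv shift_inc
proof (intro allI impI)
  fix P Q :: "'a mi" assume PQ: "mabs P = mabs Q"
  define x where "x = 1 / (2 * h)"
  define B where "B = (\<Sum>i\<in>UNIV. of_int (b i) :: complex)"
  have h0: "h \<noteq> 0" and xm: "x + of_nat (mabs P) \<noteq> 0" using Hset_nonzero[OF h] by (auto simp: x_def)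
  have c0: "cfn h (inc0 P) b = cfn h P b * ((x + B + of_nat (fst P)) / (x + of_nat (mabs P)))"
    using h0 xm nrm_nonzero[OF h, of "mabs P"]
    by (simp add: cfn_def cf_inc0 nrm_Suc[OF h] x_def[symmetric] B_def[symmetric])
  have ci: "cfn h (inc i P) b = cfn h P b * ((of_int (b i) - of_nat (snd P i)) / (x + of_nat (mabs P)))" for i
    using h0 xm nrm_nonzero[OF h, of "mabs P"]
    by (simp add: cfn_def cf_inc nrm_Suc[OF h] x_def[symmetric])
  have "(\<Sum>i\<in>UNIV. of_int (b i) - of_nat (snd P i)) = B - (of_nat (mabs P) - of_nat (fst P))"
    by (simp add: B_def mabs_def sum_subtractf)
  then have "(\<Sum>i\<in>UNIV. cfn h (inc i P) b) = cfn h P b * ((B - (of_nat (mabs P) - of_nat (fst P))) / (x + of_nat (mabs P)))"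
    unfolding ci sum_distrib_left[symmetric] sum_divide_distrib[symmetric] by simp
  moreover have "(x + B + of_nat (fst P)) / (x + of_nat (mabs P)) =
      1 + (B - (of_nat (mabs P) - of_nat (fst P))) / (x + of_nat (mabs P))"
    using xm by (simp add: field_simps)
  ultimately have "cfn h (inc0 P) b = cfn h P b + (\<Sum>i\<in>UNIV. cfn h (inc i P) b)"
    by (simp add: c0 distrib_left)
  then show "cfn h (inc0 P) b * f (shift b P Q) =
      cfn h P b * f (shift b P Q) + (\<Sum>i\<in>UNIV. cfn h (inc i P) b * f (shift b P Q))"
    by (simp add: distrib_right sum_distrib_right)
qed

lemma Upol_reduce:
  assumes c: "c \<in> Upol"
  obtains n where "finite {j. n j \<noteq> 0}"
    "\<And>l. reductive l \<Longrightarrow> lin c (\<lambda>k. nrm h (mabs (fst k)) * l k) = lin n (\<lambda>j. l (lift1 j, lift2 j))"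
proof -
  have "red (\<lambda>l. \<Sum>k\<in>{k. c k \<noteq> 0}. (c k * nrm h (mabs (fst k))) * l k)"
  proof (rule red_sum[OF UpolD(1)[OF c]])
    fix k assume "k \<in> {k. c k \<noteq> 0}"
    then show "red (\<lambda>l. l k)" using red_single[of "fst k" "snd k"] UpolD(2)[OF c] by simp
  qed
  then show ?thesis using that unfolding red_def lin_def by (auto simp: mult.assoc)
qed

lemma lin_fr_eq:
  "(\<lambda>w. lin n (\<lambda>j. fP (lift1 j) (lift2 j) w)) = (\<lambda>w. \<Sum>j\<in>{j. n j \<noteq> 0}. n j * fr (fst j) (snd j) w)"
  by (simp add: lin_def fr_eq_fP)

lemma ff_of_nat_nonzero: "ff (of_nat S) k \<noteq> 0 \<longleftrightarrow> k \<le> S"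
  by (simp add: ff_of_nat binomial_eq_0_iff not_less)

text \<open>In each of the directions 1 to n the factor is a factorial; in direction 0 the factors
  are -(1 / (2h) + m) with m a natural number, and these do not vanish for h in H.\<close>

lemma cfn_diag_nonzero:
  assumes h: "h \<in> Hset"
  shows "cfn h P (\<lambda>i. int (snd P i)) \<noteq> 0"
proof -
  have "ff (- 1 / (2 * h) - of_int (\<Sum>i\<in>UNIV. int (snd P i))) (fst P) \<noteq> 0"
  proof -
    have "- 1 / (2 * h) - of_int (\<Sum>i\<in>UNIV. int (snd P i)) - of_nat m \<noteq> 0" for m
    proof
      assume "- 1 / (2 * h) - of_int (\<Sum>i\<in>UNIV. int (snd P i)) - of_nat m = 0"
      moreover have "1 / (2 * h) + of_nat ((\<Sum>i\<in>UNIV. snd P i) + m) =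
          - (- 1 / (2 * h) - of_int (\<Sum>i\<in>UNIV. int (snd P i)) - of_nat m)" by simp
      ultimately have "1 / (2 * h) + of_nat ((\<Sum>i\<in>UNIV. snd P i) + m) = 0" by simp
      then show False using Hset_nonzero(2)[OF h] by blast
    qed
    then show ?thesis by (simp add: ff_def)
  qed
  moreover have "(\<Prod>i\<in>UNIV. ff (of_int (int (snd P i))) (snd P i)) \<noteq> 0"
    using ff_of_nat_nonzero by (simp add: prod_zero_iff)
  ultimately show ?thesis
    using Hset_nonzero(1)[OF h] nrm_nonzero[OF h] by (simp add: cfn_def cf_def)
qed

text \<open>A triangularity argument: take k in the support of d with |P| minimal, test on the input
  exponent P and on the indicator f of the output exponent Q, where k = (P, Q). A derivative of
  order P_j kills the input unless P_j <= P, minimality then forces P_j = P, and f forces Q_j = Q;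
  only the nonzero diagonal term remains.\<close>

lemma cfn_independent:
  fixes d :: "'n::finite pmi \<Rightarrow> complex"
  assumes h: "h \<in> Hset" and fin: "finite {j. d j \<noteq> 0}"
    and z: "\<And>f b. lin d (\<lambda>j. cfn h (lift1 j) b * f (shift b (lift1 j) (lift2 j))) = 0"
  shows "d j = 0"
proof (rule ccontr)
  assume "d j \<noteq> 0"
  then have "\<exists>j. d j \<noteq> 0" by blast
  then obtain k where k: "d k \<noteq> 0" and min: "\<And>j. d j \<noteq> 0 \<Longrightarrow> nabs (fst k) \<le> nabs (fst j)"
    using ex_has_least_nat[of "\<lambda>j. d j \<noteq> 0" _ "\<lambda>j. nabs (fst j)"] by blast
  define b where "b = (\<lambda>i. int (fst k i))"
  define f where "f g = (if g = (\<lambda>i. int (snd k i)) then 1 else 0 :: complex)" for g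
  have other: "cfn h (lift1 j) b * f (shift b (lift1 j) (lift2 j)) = 0" if "d j \<noteq> 0" "j \<noteq> k" for j
  proof (rule ccontr)
    assume nz: "\<not> ?thesis"
    then have "(\<Prod>i\<in>UNIV. ff (of_int (b i)) (fst j i)) \<noteq> 0"
      by (auto simp: cfn_def cf_def lift1_def)
    then have le: "fst j i \<le> fst k i" for i
      using ff_of_nat_nonzero by (auto simp: b_def prod_zero_iff)
    have "fst j = fst k"
    proof (rule ccontr)
      assume "fst j \<noteq> fst k"
      then obtain i where "fst j i < fst k i" using le by (metis ext le_neq_implies_less)
      then have "nabs (fst j) < nabs (fst k)" unfolding nabs_def using le by (intro sum_strict_mono_ex1) auto
      then show False using min[OF that(1)] by simp
    qed
    moreover have "shift b (lift1 j) (lift2 j) = (\<lambda>i. int (snd k i))"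
      using nz by (auto simp: f_def split: if_splits)
    then have "snd j = snd k"
      using \<open>fst j = fst k\<close> by (simp add: shift_def b_def lift1_def lift2_def fun_eq_iff)
    ultimately show False using that(2) by (simp add: prod_eq_iff)
  qed
  have "lin d (\<lambda>j. cfn h (lift1 j) b * f (shift b (lift1 j) (lift2 j))) =
      (\<Sum>j\<in>{k}. d j * (cfn h (lift1 j) b * f (shift b (lift1 j) (lift2 j))))"
    unfolding lin_def by (rule sum.mono_neutral_right[OF fin]) (use k other in auto)
  also have "\<dots> = d k * cfn h (lift1 k) (\<lambda>i. int (snd (lift1 k) i))"
    by (simp add: f_def b_def shift_def lift1_def lift2_def)
  finally show False using z[of b f] cfn_diag_nonzero[OF h, of "lift1 k"] k by simp
qed

text \<open>Both sides are computed from the same reduced families n and n'. These are determined by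
  the functions through uniqueness of Schauder coefficients (\<open>coef_finite\<close>) and by the
  operators through \<open>cfn_independent\<close>.\<close>

lemma psi_eq_iff_Op:
  assumes h: "h \<in> Hset" and c: "c \<in> Upol" "c' \<in> Upol"
  shows "psi h c = psi h c' \<longleftrightarrow> Op h c = Op h c'"
proof -
  obtain n where n: "finite {j. n j \<noteq> 0}"
    "\<And>l. reductive l \<Longrightarrow> lin c (\<lambda>k. nrm h (mabs (fst k)) * l k) = lin n (\<lambda>j. l (lift1 j, lift2 j))"
    using Upol_reduce[OF c(1)] by blast
  obtain n' where n': "finite {j. n' j \<noteq> 0}"
    "\<And>l. reductive l \<Longrightarrow> lin c' (\<lambda>k. nrm h (mabs (fst k)) * l k) = lin n' (\<lambda>j. l (lift1 j, lift2 j))"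
    using Upol_reduce[OF c(2)] by blast
  have psi: "psi h c = (\<lambda>w. lin n (\<lambda>j. fP (lift1 j) (lift2 j) w))" "psi h c' = (\<lambda>w. lin n' (\<lambda>j. fP (lift1 j) (lift2 j) w))"
    using n(2)[OF reductive_fP] n'(2)[OF reductive_fP] by (auto simp: fun_eq_iff psi_lin)
  have Op: "Op h c f b = lin n (\<lambda>j. cfn h (lift1 j) b * f (shift b (lift1 j) (lift2 j)))"
    "Op h c' f b = lin n' (\<lambda>j. cfn h (lift1 j) b * f (shift b (lift1 j) (lift2 j)))" for f b
    using n(2)[OF reductive_cfn[OF h]] n'(2)[OF reductive_cfn[OF h]] by (auto simp: Op_cfn[OF h])
  show ?thesis
  proof
    assume "psi h c = psi h c'"
    then have "coef (\<lambda>w. \<Sum>j\<in>{j. n j \<noteq> 0}. n j * fr (fst j) (snd j) w) = coef (\<lambda>w. \<Sum>j\<in>{j. n' j \<noteq> 0}. n' j * fr (fst j) (snd j) w)"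
      unfolding psi lin_fr_eq by simp
    then have "(\<lambda>k. if k \<in> {j. n j \<noteq> 0} then n k else 0) = (\<lambda>k. if k \<in> {j. n' j \<noteq> 0} then n' k else 0)"
      unfolding coef_finite[OF n(1)] coef_finite[OF n'(1)] .
    then have "n = n'" by (auto simp: fun_eq_iff) (metis (full_types))+
    then show "Op h c = Op h c'" by (intro ext) (simp add: Op)
  next
    assume eq: "Op h c = Op h c'"
    define d where "d j = (-1) * n j + n' j" for j
    have "d j = 0" for j
    proof (rule cfn_independent[OF h])
      show "finite {j. d j \<noteq> 0}"
        by (rule finite_subset[of _ "{j. n j \<noteq> 0} \<union> {j. n' j \<noteq> 0}"]) (use n n' in \<open>auto simp: d_def\<close>)
      show "lin d (\<lambda>j. cfn h (lift1 j) b * f (shift b (lift1 j) (lift2 j))) = 0" for f b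
        unfolding d_def lin_lincomb[OF n(1) n'(1)] Op[symmetric] eq by simp
    qed
    then have "n = n'" by (auto simp: d_def fun_eq_iff)
    then show "psi h c = psi h c'" by (simp add: psi)
  qed
qed

text \<open>Eliminates the choice of preimages: the chosen ones have the same operators as the given
  ones, hence by \<open>Op_wick\<close> so do the Wick products, and equal operators mean equal
  images under \<open>psi\<close>.\<close>

lemma starP_psi:
  assumes h: "h \<in> Hset" and c: "c \<in> Upol" and e: "e \<in> Upol"
  shows "starP h (psi h c) (psi h e) = psi h (wick h c e)"
proof -
  define c' where "c' = (SOME c'. c' \<in> Upol \<and> psi h c' = psi h c)"
  define e' where "e' = (SOME e'. e' \<in> Upol \<and> psi h e' = psi h e)"
  have c': "c' \<in> Upol" "psi h c' = psi h c"
    using someI[of "\<lambda>c'. c' \<in> Upol \<and> psi h c' = psi h c" c] c by (auto simp: c'_def)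
  have e': "e' \<in> Upol" "psi h e' = psi h e"
    using someI[of "\<lambda>e'. e' \<in> Upol \<and> psi h e' = psi h e" e] e by (auto simp: e'_def)
  have "Op h c' = Op h c" "Op h e' = Op h e"
    using psi_eq_iff_Op[OF h] c c' e e' by blast+
  then have "Op h (wick h c' e') = Op h (wick h c e)"
    by (intro ext) (simp add: Op_wick c c' e e')
  then have "psi h (wick h c' e') = psi h (wick h c e)"
    using psi_eq_iff_Op[OF h] wick_Upol c c' e e' by blast
  then show ?thesis by (simp add: starP_def c'_def e'_def)
qed

lemma PD_psi:
  assumes h: "h \<in> Hset" and a: "a \<in> PD"
  obtains c where "c \<in> Upol" "psi h c = a"
proof -
  obtain F d where F: "finite F" "\<And>k. k \<in> F \<Longrightarrow> mabs (fst k) = mabs (snd k)"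
      and a: "a = (\<lambda>w. \<Sum>k\<in>F. d k * fP (fst k) (snd k) w)"
    using a by (auto simp: PD_def case_prod_unfold)
  define c where "c k = (if k \<in> F then d k / nrm h (mabs (fst k)) else 0)" for k
  show ?thesis
  proof (rule that)
    show "c \<in> Upol" by (rule UpolI) (use F in \<open>auto simp: c_def intro: finite_subset[of _ F] split: if_splits\<close>)
    show "psi h c = a"
    proof
      fix w
      have "psi h c w = (\<Sum>k\<in>F. c k * (nrm h (mabs (fst k)) * fP (fst k) (snd k) w))"
        unfolding psi_lin by (rule lin_superset) (use F in \<open>auto simp: c_def\<close>)
      also have "\<dots> = a w" unfolding a by (intro sum.cong refl) (simp add: c_def nrm_nonzero[OF h])
      finally show "psi h c w = a w" .
    qed
  qed
qed

lemma psi_PD: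
  assumes c: "c \<in> Upol"
  shows "psi h c \<in> PD"
  unfolding PD_def
proof (intro CollectI exI conjI)
  show "finite {k. c k \<noteq> 0}" by (rule UpolD(1)[OF c])
  show "\<forall>(P, Q)\<in>{k. c k \<noteq> 0}. mabs P = mabs Q" using UpolD(2)[OF c] by force
  show "psi h c = (\<lambda>w. \<Sum>(P, Q)\<in>{k. c k \<noteq> 0}. (\<lambda>k. c k * nrm h (mabs (fst k))) (P, Q) * fP P Q w)"
    by (simp add: fun_eq_iff psi_lin lin_def case_prod_unfold mult.assoc)
qed

lemma psi_lincomb: "c \<in> Upol \<Longrightarrow> c' \<in> Upol \<Longrightarrow> psi h (\<lambda>k. z * c k + c' k) = (\<lambda>w. z * psi h c w + psi h c' w)"
  by (rule ext) (simp add: psi_lin lin_lincomb UpolD(1))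

lemma starP_PD:
  assumes h: "h \<in> Hset" and a: "a \<in> PD" "b \<in> PD"
  shows "starP h a b \<in> PD"
proof -
  obtain c where c: "c \<in> Upol" "psi h c = a" using PD_psi[OF h a(1)] by blast
  obtain e where e: "e \<in> Upol" "psi h e = b" using PD_psi[OF h a(2)] by blast
  show ?thesis
    unfolding c(2)[symmetric] e(2)[symmetric] starP_psi[OF h c(1) e(1)] by (intro psi_PD wick_Upol c e)
qed

lemma PD_lincomb: "a \<in> PD \<Longrightarrow> b \<in> PD \<Longrightarrow> (\<lambda>w. z * a w + b w) \<in> PD"
proof -
  assume ab: "a \<in> PD" "b \<in> PD"
  \<comment> \<open>Closure of P(D_n) under linear combinations is inherited from the coefficient
    side through \<open>psi\<close> at a fixed parameter, here h = 1, which has to be recognised as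
    an element of H.\<close>
  have "(1::complex) \<noteq> - 1 / (2 * of_nat m)" if "m \<ge> 1" for m :: nat
  proof
    assume "(1::complex) = - 1 / (2 * of_nat m)"
    then have "of_nat (2 * m + 1) = (0::complex)" using that by (simp add: field_simps)
    then show False by (simp only: of_nat_eq_0_iff)
  qed
  then have 1: "1 \<in> Hset" by (auto simp: Hset_def)
  obtain c e where "c \<in> Upol" "e \<in> Upol" "psi 1 c = a" "psi 1 e = b"
    using PD_psi[OF 1 ab(1)] PD_psi[OF 1 ab(2)] by metis
  then show ?thesis using psi_lincomb[of c e 1 z] psi_PD[OF Upol_lincomb[of c e z], of 1] by simp
qed

lemma Op_lincomb_fun:
  "c \<in> Upol \<Longrightarrow> c' \<in> Upol \<Longrightarrow> Op h (\<lambda>k. z * c k + c' k) f = (\<lambda>b. z * Op h c f b + Op h c' f b)"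
  by (rule ext) (rule Op_lincomb)

text \<open>The comparison is made between operators, where linearity is immediate, instead of
  between Wick products, whose defining sums range over the supports of the factors.\<close>

lemma starP_lincomb_left:
  assumes h: "h \<in> Hset" and a: "a \<in> PD" "a' \<in> PD" "b \<in> PD"
  shows "starP h (\<lambda>w. z * a w + a' w) b = (\<lambda>w. z * starP h a b w + starP h a' b w)"
proof -
  obtain c where c: "c \<in> Upol" "psi h c = a" using PD_psi[OF h a(1)] by blast
  obtain c' where c': "c' \<in> Upol" "psi h c' = a'" using PD_psi[OF h a(2)] by blast
  obtain e where e: "e \<in> Upol" "psi h e = b" using PD_psi[OF h a(3)] by blast
  have OpE: "Op h (wick h (\<lambda>k. z * c k + c' k) e) = Op h (\<lambda>k. z * wick h c e k + wick h c' e k)"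
    by (intro ext) (simp add: Op_wick Upol_lincomb wick_Upol c c' e Op_lincomb_fun Op_linear_right)
  have "psi h (wick h (\<lambda>k. z * c k + c' k) e) = psi h (\<lambda>k. z * wick h c e k + wick h c' e k)"
    by (rule psi_eq_iff_Op[OF h, THEN iffD2, OF _ _ OpE]) (intro wick_Upol Upol_lincomb c c' e)+
  note eq = this
  have "starP h (\<lambda>w. z * a w + a' w) b = starP h (psi h (\<lambda>k. z * c k + c' k)) (psi h e)"
    by (simp only: psi_lincomb[OF c(1) c'(1)] c(2) c'(2) e(2))
  also have "\<dots> = (\<lambda>w. z * psi h (wick h c e) w + psi h (wick h c' e) w)"
    unfolding starP_psi[OF h Upol_lincomb[OF c(1) c'(1)] e(1)] eq by (intro psi_lincomb wick_Upol c c' e)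
  also have "\<dots> = (\<lambda>w. z * starP h a b w + starP h a' b w)"
    unfolding starP_psi[OF h c(1) e(1), symmetric] starP_psi[OF h c'(1) e(1), symmetric] c(2) c'(2) e(2) ..
  finally show ?thesis .
qed

lemma starP_lincomb_right:
  assumes h: "h \<in> Hset" and a: "a \<in> PD" "a' \<in> PD" "b \<in> PD"
  shows "starP h b (\<lambda>w. z * a w + a' w) = (\<lambda>w. z * starP h b a w + starP h b a' w)"
proof -
  obtain c where c: "c \<in> Upol" "psi h c = a" using PD_psi[OF h a(1)] by blast
  obtain c' where c': "c' \<in> Upol" "psi h c' = a'" using PD_psi[OF h a(2)] by blast
  obtain e where e: "e \<in> Upol" "psi h e = b" using PD_psi[OF h a(3)] by blast
  have OpE: "Op h (wick h e (\<lambda>k. z * c k + c' k)) = Op h (\<lambda>k. z * wick h e c k + wick h e c' k)"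
    by (intro ext) (simp add: Op_wick Upol_lincomb wick_Upol c c' e Op_lincomb)
  have "psi h (wick h e (\<lambda>k. z * c k + c' k)) = psi h (\<lambda>k. z * wick h e c k + wick h e c' k)"
    by (rule psi_eq_iff_Op[OF h, THEN iffD2, OF _ _ OpE]) (intro wick_Upol Upol_lincomb c c' e)+
  note eq = this
  have "starP h b (\<lambda>w. z * a w + a' w) = starP h (psi h e) (psi h (\<lambda>k. z * c k + c' k))"
    by (simp only: psi_lincomb[OF c(1) c'(1)] c(2) c'(2) e(2))
  also have "\<dots> = (\<lambda>w. z * psi h (wick h e c) w + psi h (wick h e c') w)"
    unfolding starP_psi[OF h e(1) Upol_lincomb[OF c(1) c'(1)]] eq by (intro psi_lincomb wick_Upol c c' e)
  also have "\<dots> = (\<lambda>w. z * starP h b a w + starP h b a' w)"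
    unfolding starP_psi[OF h e(1) c(1), symmetric] starP_psi[OF h e(1) c'(1), symmetric] c(2) c'(2) e(2) ..
  finally show ?thesis .
qed

text \<open>Under \<open>Op\<close> both bracketings become the same composition of three
  operators.\<close>

lemma starP_assoc:
  assumes h: "h \<in> Hset" and a: "a \<in> PD" "b \<in> PD" "c \<in> PD"
  shows "starP h (starP h a b) c = starP h a (starP h b c)"
proof -
  obtain x where x: "x \<in> Upol" "psi h x = a" using PD_psi[OF h a(1)] by blast
  obtain y where y: "y \<in> Upol" "psi h y = b" using PD_psi[OF h a(2)] by blast
  obtain z where z: "z \<in> Upol" "psi h z = c" using PD_psi[OF h a(3)] by blast
  have OpE: "Op h (wick h (wick h x y) z) = Op h (wick h x (wick h y z))"
    by (intro ext) (simp add: Op_wick wick_Upol x y z)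
  have "psi h (wick h (wick h x y) z) = psi h (wick h x (wick h y z))"
    by (rule psi_eq_iff_Op[OF h, THEN iffD2, OF _ _ OpE]) (intro wick_Upol x y z)+
  then show ?thesis
    unfolding x(2)[symmetric] y(2)[symmetric] z(2)[symmetric] by (simp only: starP_psi[OF h] wick_Upol x(1) y(1) z(1))
qed

section \<open>The explicit product formula\<close>

definition scf :: "complex \<Rightarrow> 'n::finite mi \<Rightarrow> 'n mi \<Rightarrow> 'n mi \<Rightarrow> complex" where
  "scf h P S T = (-1) ^ fst T * of_nat (mi_fact T) * of_nat (mi_choose P T) * of_nat (mi_choose S T)
     * (pochhammer (1 / (2 * h)) (mabs P + mabs S - mabs T)
        / (pochhammer (1 / (2 * h)) (mabs P) * pochhammer (1 / (2 * h)) (mabs S)))"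

lemma fP_PD: "mabs P = mabs Q \<Longrightarrow> fP P Q \<in> PD"
  unfolding PD_def by (intro CollectI exI[of _ "{(P, Q)}"] exI[of _ "\<lambda>_. 1"]) auto

lemma fr_PD: "fr P Q \<in> PD"
  unfolding fr_eq_fP[of "(P, Q)", simplified] by (rule fP_PD) (simp add: mabs_lift)

text \<open>Each factor is the image of one rescaled basis element, so the Wick sum collapses to a
  single sum over T. The powers of 2h cancel because |T| + |P + R - T| = |P| + |S|.\<close>

lemma starP_fP:
  assumes h: "h \<in> Hset" and PQ: "mabs P = mabs Q" and RS: "mabs R = mabs S"
  shows "starP h (fP P Q) (fP R S) =
    (\<lambda>w. \<Sum>T\<in>mi_below P S. scf h P S T * fP (mi_sub (mi_add P R) T) (mi_sub (mi_add Q S) T) w)"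
proof -
  define u where "u P Q k = (if k = (P, Q) then 1 / nrm h (mabs P) else 0)" for P Q :: "'a mi" and k
  have u: "u P Q \<in> Upol" "psi h (u P Q) = fP P Q" if "mabs P = mabs Q" for P Q
  proof -
    show "u P Q \<in> Upol" by (rule UpolI) (use that in \<open>auto simp: u_def split: if_splits\<close>)
    show "psi h (u P Q) = fP P Q"
      unfolding psi_lin u_def lin_single by (simp add: nrm_nonzero[OF h])
  qed
  have "starP h (fP P Q) (fP R S) w =
      (\<Sum>T\<in>mi_below P S. scf h P S T * fP (mi_sub (mi_add P R) T) (mi_sub (mi_add Q S) T) w)" for w
  proof -
    have "starP h (fP P Q) (fP R S) w = psi h (wick h (u P Q) (u R S)) w"
      using starP_psi[OF h u(1)[OF PQ] u(1)[OF RS]] by (simp add: u(2) PQ RS)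
    also have "psi h (wick h (u P Q) (u R S)) w = 1 / nrm h (mabs P) * (1 / nrm h (mabs R) *
       (\<Sum>T\<in>mi_below P S. wc h P S T * (nrm h (mabs (mi_sub (mi_add P R) T)) * fP (mi_sub (mi_add P R) T) (mi_sub (mi_add Q S) T) w)))"
      unfolding psi_lin lin_wick[OF UpolD(1)[OF u(1)[OF PQ]] UpolD(1)[OF u(1)[OF RS]]]
      unfolding u_def lin_single by (simp add: wk_def)
    also have "\<dots> = (\<Sum>T\<in>mi_below P S. scf h P S T * fP (mi_sub (mi_add P R) T) (mi_sub (mi_add Q S) T) w)"
      unfolding sum_distrib_left
    proof (rule sum.cong)
      fix T assume "T \<in> mi_below P S"
      then have le: "mi_le T P" by (simp add: mi_below_def)
      have m: "mabs (mi_sub (mi_add P R) T) = mabs P + mabs S - mabs T" "mabs T \<le> mabs P + mabs S"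
        using mabs_mi_sub[OF le, of R] RS by auto
      have h0: "h \<noteq> 0" using Hset_nonzero[OF h] by simp
      have pw: "(2 * h) ^ mabs T * (2 * h) ^ (mabs P + mabs S - mabs T) = (2 * h) ^ mabs P * (2 * h) ^ mabs S"
        unfolding power_add[symmetric] using m(2) by simp
      have "1 / nrm h (mabs P) * (1 / nrm h (mabs R) * (wc h P S T * nrm h (mabs P + mabs S - mabs T))) =
         ((2 * h) ^ mabs T * (2 * h) ^ (mabs P + mabs S - mabs T)) / ((2 * h) ^ mabs P * (2 * h) ^ mabs S) * scf h P S T"
        unfolding RS wc_def scf_def nrm_def by (simp add: field_simps)
      also have "\<dots> = scf h P S T" unfolding pw using h0 by simp
      finally have E: "1 / nrm h (mabs P) * (1 / nrm h (mabs R) * (wc h P S T * nrm h (mabs P + mabs S - mabs T))) = scf h P S T" .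
      show "1 / nrm h (mabs P) * (1 / nrm h (mabs R) * (wc h P S T * (nrm h (mabs (mi_sub (mi_add P R) T)) *
            fP (mi_sub (mi_add P R) T) (mi_sub (mi_add Q S) T) w))) =
          scf h P S T * fP (mi_sub (mi_add P R) T) (mi_sub (mi_add Q S) T) w"
        unfolding m E[symmetric] by (simp add: mult_ac)
    qed simp
    finally show ?thesis .
  qed
  then show ?thesis by blast
qed

lemma PD_span:
  assumes "a \<in> PD"
  obtains K n where "finite K" "a = (\<lambda>w. \<Sum>j\<in>K. n j * fr (fst j) (snd j) w)"
proof -
  obtain F d where F: "finite F" "\<And>k. k \<in> F \<Longrightarrow> mabs (fst k) = mabs (snd k)"
      and a: "a = (\<lambda>w. \<Sum>k\<in>F. d k * fP (fst k) (snd k) w)"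
    using assms by (auto simp: PD_def case_prod_unfold)
  have "red (\<lambda>l. \<Sum>k\<in>F. d k * l k)"
  proof (rule red_sum[OF F(1)])
    fix k assume "k \<in> F"
    then show "red (\<lambda>l. l k)" using red_single[of "fst k" "snd k"] F(2) by simp
  qed
  then obtain n where n: "finite {j. n j \<noteq> 0}"
      "\<And>l. reductive l \<Longrightarrow> (\<Sum>k\<in>F. d k * l k) = lin n (\<lambda>j. l (lift1 j, lift2 j))"
    unfolding red_def by blast
  have "a = (\<lambda>w. \<Sum>j\<in>{j. n j \<noteq> 0}. n j * fr (fst j) (snd j) w)"
    using n(2)[OF reductive_fP] by (simp add: a lin_fr_eq[symmetric])
  then show ?thesis using that n(1) by blast
qed

lemma PD_ADn: "a \<in> PD \<Longrightarrow> a \<in> ADn"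
  by (erule PD_span) (auto intro!: ADn_sum ADn_cmult fr_ADn)

section \<open>Estimates for the star product\<close>

lemma prod_fact_le: "finite I \<Longrightarrow> (\<Prod>i\<in>I. fact (f i) :: nat) \<le> fact (\<Sum>i\<in>I. f i)"
proof (induction I rule: finite_induct)
  case (insert i I)
  have "(fact (f i) :: nat) * (\<Prod>i\<in>I. fact (f i)) \<le> fact (f i) * fact (\<Sum>i\<in>I. f i)"
    using insert by simp
  also have "\<dots> \<le> fact (f i + (\<Sum>i\<in>I. f i))"
    by (rule dvd_imp_le[OF fact_fact_dvd_fact]) simp
  finally show ?case using insert by simp
qed simp

lemma mi_fact_le: "mi_fact T \<le> fact (mabs T)"
proof -
  have "mi_fact T \<le> fact (fst T) * fact (\<Sum>i\<in>UNIV. snd T i)"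
    unfolding mi_fact_def by (intro mult_left_mono prod_fact_le) auto
  also have "\<dots> \<le> fact (mabs T)" unfolding mabs_def by (rule dvd_imp_le[OF fact_fact_dvd_fact]) simp
  finally show ?thesis .
qed

lemma mi_choose_le: "mi_choose P T \<le> 2 ^ mabs P"
proof -
  have "mi_choose P T \<le> 2 ^ fst P * (\<Prod>i\<in>UNIV. 2 ^ snd P i)"
    unfolding mi_choose_def by (intro mult_mono prod_mono binomial_le_pow2) (auto simp: binomial_le_pow2)
  then show ?thesis by (simp add: mabs_def power_add power_sum)
qed

lemma card_mi_below: "card (mi_below P S) \<le> 2 ^ mabs P"
proof -
  have "card (mi_below P S) \<le> card {T. mi_le T P}"
    by (intro card_mono finite_mi_le) (auto simp: mi_below_def)
  also have "\<dots> = Suc (fst P) * (\<Prod>i\<in>UNIV. Suc (snd P i))"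
    unfolding mi_le_set card_cartesian_product by (simp add: card_PiE)
  also have "\<dots> \<le> 2 ^ fst P * (\<Prod>i\<in>UNIV. 2 ^ snd P i)"
    by (intro mult_mono prod_mono) (auto simp: Suc_leI)
  finally show ?thesis by (simp add: mabs_def power_add power_sum)
qed

text \<open>Every factor 1 / (2h) + k is comparable in norm to k + 1, uniformly for h in L. The
  upper bound and the lower bound for large k come from boundedness of 1 / (2h) on L; for the
  finitely many small k, compactness gives a positive minimal distance from 0.\<close>

lemma pochhammer_bounds:
  assumes L: "compact L" "L \<subseteq> Hset"
  obtains d B :: real where "d > 0" "B \<ge> 1"
    "\<And>h m. h \<in> L \<Longrightarrow> d ^ m * fact m \<le> norm (pochhammer (1 / (2 * h)) m)"
    "\<And>h m. h \<in> L \<Longrightarrow> norm (pochhammer (1 / (2 * h)) m) \<le> B ^ m * fact m"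
proof -
  have nz: "h \<noteq> 0" "1 / (2 * h) + of_nat k \<noteq> 0" if "h \<in> L" for h k
    using Hset_nonzero[of h] L(2) that by blast+
  have cont: "continuous_on L (\<lambda>h. 1 / (2 * h))"
    by (intro continuous_intros) (use nz in auto)
  then obtain X where X: "\<And>h. h \<in> L \<Longrightarrow> norm (1 / (2 * h)) \<le> X"
    using compact_imp_bounded[OF compact_continuous_image[OF cont L(1)]] unfolding bounded_iff by blast
  define B where "B = max 1 X"
  have up: "norm (1 / (2 * h) + of_nat k) \<le> B * real (Suc k)" if "h \<in> L" for h k
  proof -
    have "norm (1 / (2 * h) + of_nat k) \<le> X + real k"
      using X[OF that] by (intro norm_triangle_le) simp
    also have "\<dots> \<le> B * 1 + B * real k"
      by (intro add_mono) (auto simp: B_def mult_le_cancel_right1)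
    finally show ?thesis by (simp add: algebra_simps)
  qed
  have "\<exists>\<delta>>0. \<forall>h\<in>L. \<delta> \<le> norm (1 / (2 * h) + of_nat k)" for k
  proof -
    have "continuous_on L (\<lambda>h. inverse (1 / (2 * h) + of_nat k))"
      by (intro continuous_intros cont) (use nz in auto)
    from compact_imp_bounded[OF compact_continuous_image[OF this L(1)]]
    obtain M where M: "\<And>h. h \<in> L \<Longrightarrow> norm (inverse (1 / (2 * h) + of_nat k)) \<le> M"
      unfolding bounded_iff by blast
    show ?thesis
    proof (intro exI[of _ "1 / max 1 M"] conjI ballI)
      fix h assume h: "h \<in> L"
      define n where "n = norm (1 / (2 * h) + of_nat k)"
      have n: "n > 0" using nz(2)[OF h] by (simp add: n_def)
      have "inverse n \<le> max 1 M" using M[OF h] unfolding norm_inverse n_def[symmetric] by simp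
      then show "1 / max 1 M \<le> norm (1 / (2 * h) + of_nat k)"
        using n unfolding n_def[symmetric] by (simp add: field_simps)
    qed auto
  qed
  then obtain \<delta> where \<delta>: "\<And>k. \<delta> k > 0" "\<And>k h. h \<in> L \<Longrightarrow> \<delta> k \<le> norm (1 / (2 * h) + of_nat k)" by metis
  \<comment> \<open>The inequality k >= 2 X + 1 is equivalent to k - X >= (k + 1) / 2; from there on
    the constant 1/2 works.\<close>
  define N where "N = nat \<lceil>2 * X + 1\<rceil>"
  define d where "d = Min (insert (1/2) ((\<lambda>k. \<delta> k / real (Suc k)) ` {..<N}))"
  have d: "d > 0" unfolding d_def using \<delta>(1) by (subst Min_gr_iff) (auto simp: add_pos_nonneg)
  have low: "d * real (Suc k) \<le> norm (1 / (2 * h) + of_nat k)" if h: "h \<in> L" for h k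
  proof (cases "k < N")
    case True
    then have "d \<le> \<delta> k / real (Suc k)" unfolding d_def by (intro Min_le) auto
    then have "d * real (Suc k) \<le> \<delta> k" by (simp add: pos_le_divide_eq)
    then show ?thesis using \<delta>(2)[OF h, of k] by linarith
  next
    case False
    then have k: "real k \<ge> 2 * X + 1" unfolding N_def by linarith
    have "d \<le> 1 / 2" unfolding d_def by (intro Min_le) auto
    then have "d * real (Suc k) \<le> 1 / 2 * real (Suc k)" by (intro mult_right_mono) auto
    also have "\<dots> \<le> real k - X" using k by simp
    also have "\<dots> \<le> norm (of_nat k :: complex) - norm (1 / (2 * h))" using X[OF h] by simp
    also have "\<dots> \<le> norm (of_nat k + 1 / (2 * h))" using norm_triangle_ineq4[of "of_nat k + 1 / (2 * h)" "1 / (2 * h)"] by simp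
    finally show ?thesis by (simp add: add.commute)
  qed
  show ?thesis
  proof (rule that[OF d, of B])
    show "B \<ge> 1" by (simp add: B_def)
    fix h m assume h: "h \<in> L"
    show "d ^ m * fact m \<le> norm (pochhammer (1 / (2 * h)) m)"
    proof (induction m)
      case (Suc m)
      have "d ^ m * fact m * (d * real (Suc m)) \<le> norm (pochhammer (1 / (2 * h)) m) * norm (1 / (2 * h) + of_nat m)"
        using d by (intro mult_mono Suc low h) auto
      then show ?case by (simp add: pochhammer_Suc norm_mult mult_ac)
    qed simp
    show "norm (pochhammer (1 / (2 * h)) m) \<le> B ^ m * fact m"
    proof (induction m)
      case (Suc m)
      have "norm (pochhammer (1 / (2 * h)) m) * norm (1 / (2 * h) + of_nat m) \<le> B ^ m * fact m * (B * real (Suc m))"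
        by (intro mult_mono Suc up h) (auto simp: B_def)
      then show ?case by (simp add: pochhammer_Suc norm_mult mult_ac)
    qed simp
  qed
qed

text \<open>The factorials balance: t! from the contraction and (M + N - t)! from the numerator are
  together at most (M + N)!, and dividing by M! N! leaves a binomial coefficient. Hence the growth
  is only exponential.\<close>

lemma scf_bound:
  assumes L: "compact L" "L \<subseteq> Hset"
  obtains A :: real where "A \<ge> 1"
    "\<And>h P S T. h \<in> L \<Longrightarrow> T \<in> mi_below P S \<Longrightarrow> norm (scf h P S T) \<le> A ^ (mabs P + mabs S)"
proof -
  obtain d B :: real where d: "d > 0" "B \<ge> 1"
    and low: "\<And>h m. h \<in> L \<Longrightarrow> d ^ m * fact m \<le> norm (pochhammer (1 / (2 * h)) m)"
    and up: "\<And>h m. h \<in> L \<Longrightarrow> norm (pochhammer (1 / (2 * h)) m) \<le> B ^ m * fact m"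
    using pochhammer_bounds[OF L] by blast
  \<comment> \<open>B / d is the ratio of the Pochhammer bounds; one factor 2 comes from
    \<open>mi_choose_le\<close> and the other from the binomial coefficient.\<close>
  define A where "A = max 1 (4 * B / d)"
  show ?thesis
  proof (rule that[of A])
    show "A \<ge> 1" by (simp add: A_def)
    fix h and P S T :: "'a mi" assume h: "h \<in> L" and T: "T \<in> mi_below P S"
    define M N t where "M = mabs P" and "N = mabs S" and "t = mabs T"
    have t: "t \<le> M + N"
      using mabs_mi_sub[of T P S] T by (simp add: mi_below_def M_def N_def t_def)
    have "norm (scf h P S T) = real (mi_fact T) * real (mi_choose P T) * real (mi_choose S T)
       * (norm (pochhammer (1 / (2 * h)) (M + N - t)) / (norm (pochhammer (1 / (2 * h)) M) * norm (pochhammer (1 / (2 * h)) N)))"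
      by (simp add: scf_def norm_mult norm_divide norm_power M_def N_def t_def)
    also have "\<dots> \<le> fact t * 2 ^ M * 2 ^ N * ((B ^ (M + N) * fact (M + N - t)) / ((d ^ M * fact M) * (d ^ N * fact N)))"
    proof (intro mult_mono frac_le)
      show "real (mi_fact T) \<le> fact t" using mi_fact_le[of T] unfolding t_def by (metis of_nat_fact of_nat_mono)
      show "real (mi_choose P T) \<le> 2 ^ M" using mi_choose_le[of P T] unfolding M_def by (metis of_nat_le_iff of_nat_numeral of_nat_power)
      show "real (mi_choose S T) \<le> 2 ^ N" using mi_choose_le[of S T] unfolding N_def by (metis of_nat_le_iff of_nat_numeral of_nat_power)
      have "norm (pochhammer (1 / (2 * h)) (M + N - t)) \<le> B ^ (M + N - t) * fact (M + N - t)" by (rule up[OF h])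
      also have "\<dots> \<le> B ^ (M + N) * fact (M + N - t)" using d by (intro mult_right_mono power_increasing) auto
      finally show "norm (pochhammer (1 / (2 * h)) (M + N - t)) \<le> B ^ (M + N) * fact (M + N - t)" .
    qed (use d low[OF h] in auto)
    also have "\<dots> = 2 ^ (M + N) * (B / d) ^ (M + N) * ((fact t * fact (M + N - t)) / (fact M * fact N))"
      by (simp add: power_add power_divide mult_ac)
    also have "(fact t * fact (M + N - t)) / (fact M * fact N) \<le> (2::real) ^ (M + N)"
    proof -
      have "(fact t * fact (M + N - t) :: nat) \<le> fact (M + N)"
        using dvd_imp_le[OF fact_fact_dvd_fact[of t "M + N - t"]] t by simp
      then have "(fact t * fact (M + N - t) :: real) \<le> fact (M + N)"
        by (metis of_nat_fact of_nat_le_iff of_nat_mult)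
      then have "(fact t * fact (M + N - t)) / (fact M * fact N) \<le> (fact (M + N) / (fact M * fact N) :: real)"
        by (intro divide_right_mono) auto
      also have "\<dots> = real ((M + N) choose M)" by (simp add: binomial_fact)
      also have "\<dots> \<le> 2 ^ (M + N)" using binomial_le_pow2[of "M + N" M] by (metis of_nat_le_iff of_nat_numeral of_nat_power)
      finally show ?thesis .
    qed
    also have "2 ^ (M + N) * (B / d) ^ (M + N) * 2 ^ (M + N) = (4 * B / d) ^ (M + N)"
      by (simp add: power_mult_distrib[symmetric])
    also have "\<dots> \<le> A ^ (M + N)" using d by (intro power_mono) (auto simp: A_def)
    finally show "norm (scf h P S T) \<le> A ^ (mabs P + mabs S)"
      using d by (simp add: M_def N_def mult_left_mono)
  qed
qed

lemma starP_bound: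
  fixes C :: "('n::finite pt \<times> 'n pt) set"
  assumes L: "compact L" "L \<subseteq> Hset" and C: "C \<in> cpts"
  obtains A :: real where "A \<ge> 1"
    "\<And>h k k'. h \<in> L \<Longrightarrow> sn C (starP h (fr (fst k) (snd k)) (fr (fst k') (snd k'))) \<le> A ^ deg k * A ^ deg k'"
proof -
  obtain A0 :: real where A0: "A0 \<ge> 1"
    "\<And>h (P::'n mi) S T. h \<in> L \<Longrightarrow> T \<in> mi_below P S \<Longrightarrow> norm (scf h P S T) \<le> A0 ^ (mabs P + mabs S)"
    using scf_bound[OF L] by blast
  obtain r where r: "r \<ge> 1" "\<And>P Q x. x \<in> C \<Longrightarrow> mabs P = mabs Q \<Longrightarrow> norm (fPh P Q x) \<le> r ^ mabs P"
    using fPh_bound[OF C] by blast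
  \<comment> \<open>Per degree: 2 for the number of indices T, A0 for the product coefficients, r
    for the functions f_{P,Q} on C.\<close>
  define A where "A = 2 * A0 * r"
  have A: "A \<ge> 1" using mult_mono[of 1 A0 1 r] A0 r by (simp add: A_def)
  show ?thesis
  proof (rule that[OF A])
    fix h and k k' :: "'n pmi" assume h: "h \<in> L"
    define P Q R S where "P = lift1 k" and "Q = lift2 k" and "R = lift1 k'" and "S = lift2 k'"
    have PQ: "mabs P = mabs Q" and RS: "mabs R = mabs S" by (simp_all add: P_def Q_def R_def S_def mabs_lift)
    have hH: "h \<in> Hset" using h L by blast
    have m: "mabs (mi_sub (mi_add P R) T) = mabs (mi_sub (mi_add Q S) T)"
      "mabs (mi_sub (mi_add P R) T) \<le> mabs P + mabs S" if "T \<in> mi_below P S" for T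
    proof -
      have "mi_add Q S = mi_add S Q" by (simp add: mi_add_def add.commute)
      then show "mabs (mi_sub (mi_add P R) T) = mabs (mi_sub (mi_add Q S) T)"
        "mabs (mi_sub (mi_add P R) T) \<le> mabs P + mabs S"
        using that mabs_mi_sub[of T P R] mabs_mi_sub[of T S Q] PQ RS by (auto simp: mi_below_def)
    qed
    have st: "starP h (fr (fst k) (snd k)) (fr (fst k') (snd k')) =
        (\<lambda>w. \<Sum>T\<in>mi_below P S. scf h P S T * fP (mi_sub (mi_add P R) T) (mi_sub (mi_add Q S) T) w)"
      unfolding fr_eq_fP P_def[symmetric] Q_def[symmetric] R_def[symmetric] S_def[symmetric]
      by (rule starP_fP[OF hH PQ RS])
    have hat: "hat (starP h (fr (fst k) (snd k)) (fr (fst k') (snd k'))) =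
        (\<lambda>x. \<Sum>T\<in>mi_below P S. scf h P S T * fPh (mi_sub (mi_add P R) T) (mi_sub (mi_add Q S) T) x)"
      unfolding st by (subst hat_sum) (auto intro!: ADn_cmult fP_ADn sum.cong simp: hat_cmult fP_ADn hat_fP m)
    have "sn C (starP h (fr (fst k) (snd k)) (fr (fst k') (snd k'))) \<le> A ^ (mabs P + mabs S)"
    proof (rule sn_least[OF C])
      fix x assume x: "x \<in> C"
      have "norm (\<Sum>T\<in>mi_below P S. scf h P S T * fPh (mi_sub (mi_add P R) T) (mi_sub (mi_add Q S) T) x)
          \<le> (\<Sum>T\<in>mi_below P S. A0 ^ (mabs P + mabs S) * r ^ (mabs P + mabs S))"
      proof (rule sum_norm_le)
        fix T assume T: "T \<in> mi_below P S"
        have "norm (fPh (mi_sub (mi_add P R) T) (mi_sub (mi_add Q S) T) x) \<le> r ^ mabs (mi_sub (mi_add P R) T)"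
          by (rule r(2)[OF x m(1)[OF T]])
        also have "\<dots> \<le> r ^ (mabs P + mabs S)" by (intro power_increasing m T r)
        finally show "norm (scf h P S T * fPh (mi_sub (mi_add P R) T) (mi_sub (mi_add Q S) T) x)
            \<le> A0 ^ (mabs P + mabs S) * r ^ (mabs P + mabs S)"
          unfolding norm_mult using A0 by (intro mult_mono A0(2)[OF h T]) auto
      qed
      also have "\<dots> = real (card (mi_below P S)) * (A0 * r) ^ (mabs P + mabs S)"
        by (simp add: power_mult_distrib)
      also have "\<dots> \<le> 2 ^ (mabs P + mabs S) * (A0 * r) ^ (mabs P + mabs S)"
      proof (intro mult_right_mono)
        have "card (mi_below P S) \<le> 2 ^ (mabs P + mabs S)"
          using card_mi_below[of P S] by (rule order_trans) (simp add: power_increasing)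
        then show "real (card (mi_below P S)) \<le> 2 ^ (mabs P + mabs S)"
          by (metis of_nat_le_iff of_nat_numeral of_nat_power)
      qed (use A0 r in auto)
      also have "\<dots> = A ^ (mabs P + mabs S)" by (simp add: A_def power_mult_distrib mult_ac)
      finally show "norm (hat (starP h (fr (fst k) (snd k)) (fr (fst k') (snd k'))) x) \<le> A ^ (mabs P + mabs S)"
        by (simp add: hat)
    qed
    also have "\<dots> \<le> A ^ (deg k + deg k')"
      using mabs_lift_le[of k] mabs_lift_le[of k'] A RS
      by (intro power_increasing) (auto simp: P_def R_def)
    finally show "sn C (starP h (fr (fst k) (snd k)) (fr (fst k') (snd k'))) \<le> A ^ deg k * A ^ deg k'"
      by (simp add: power_add)
  qed
qed

section \<open>The extended product\<close>

definition frs :: "complex \<Rightarrow> 'n::finite pmi \<times> 'n pmi \<Rightarrow> 'n fn" where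
  "frs h p = starP h (fr (fst (fst p)) (snd (fst p))) (fr (fst (snd p)) (snd (snd p)))"

text \<open>The double series itself serves as the definition, with pointwise sums over the disc;
  agreement with \<open>starP\<close> on polynomials is established afterwards.\<close>

definition starA :: "complex \<Rightarrow> 'n::finite fn \<Rightarrow> 'n fn \<Rightarrow> 'n fn" where
  "starA h a b = (\<lambda>w. \<Sum>\<^sub>\<infinity>p. coef a (fst p) * coef b (snd p) * frs h p w)"

lemma frs_ADn: "h \<in> Hset \<Longrightarrow> frs h p \<in> ADn"
  unfolding frs_def by (intro PD_ADn starP_PD fr_PD)

lemma coef_product_summable:
  assumes a: "a \<in> ADn" and b: "b \<in> ADn" and A: "A > 0"
  shows "(\<lambda>p. (norm (coef a (fst p)) * A ^ deg (fst p)) * (norm (coef b (snd p)) * A ^ deg (snd p))) summable_on UNIV"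
proof -
  have "(\<lambda>(k,k'). (norm (coef a k) * A ^ deg k) * (norm (coef b k') * A ^ deg k')) summable_on UNIV \<times> UNIV"
    by (rule summable_on_times_nonneg) (use coef_decay[OF a] coef_decay[OF b] A in \<open>auto simp: decay2_def\<close>)
  then show ?thesis by (simp add: case_prod_unfold)
qed

text \<open>The bound of \<open>starP_bound\<close> is uniform in h and factorises over the two
  indices, so the double family is dominated by a product of two summable families.\<close>

lemma frs_sup_summable:
  fixes a b :: "'n::finite fn"
  assumes a: "a \<in> ADn" and b: "b \<in> ADn" and L: "compact L" "L \<subseteq> Hset" "L \<noteq> {}" and C: "C \<in> cpts"
  shows "(\<lambda>p. norm (coef a (fst p) * coef b (snd p)) * (SUP h\<in>L. sn C (frs h p))) summable_on UNIV"
proof -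
  obtain A :: real where A: "A \<ge> 1" "\<And>h k k'. h \<in> L \<Longrightarrow>
      sn C (starP h (fr (fst k) (snd k)) (fr (fst k') (snd k'))) \<le> A ^ deg k * A ^ deg k'"
    using starP_bound[OF L(1,2) C] by blast
  have bd: "sn C (frs h p) \<le> A ^ deg (fst p) * A ^ deg (snd p)" if "h \<in> L" for h p
    unfolding frs_def by (rule A(2)[OF that])
  have sup: "(SUP h\<in>L. sn C (frs h p)) \<le> A ^ deg (fst p) * A ^ deg (snd p)" for p
    by (rule cSUP_least[OF L(3) bd])
  have sup0: "(SUP h\<in>L. sn C (frs h p)) \<ge> 0" for p
  proof -
    obtain h where h: "h \<in> L" using L(3) by blast
    have "bdd_above ((\<lambda>h. sn C (frs h p)) ` L)" using bd by (rule bdd_aboveI2)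
    then have "sn C (frs h p) \<le> (SUP h\<in>L. sn C (frs h p))" by (rule cSUP_upper[OF h])
    moreover have "sn C (frs h p) \<ge> 0" using h L(2) by (intro sn_nonneg frs_ADn C) auto
    ultimately show ?thesis by linarith
  qed
  have "A > 0" using A(1) by simp
  show ?thesis
  proof (rule summable_on_comparison_test[OF coef_product_summable[OF a b \<open>A > 0\<close>]])
    fix p
    show "norm (coef a (fst p) * coef b (snd p)) * (SUP h\<in>L. sn C (frs h p))
       \<le> norm (coef a (fst p)) * A ^ deg (fst p) * (norm (coef b (snd p)) * A ^ deg (snd p))"
      using mult_left_mono[OF sup, of "norm (coef a (fst p) * coef b (snd p))" p] by (simp add: norm_mult mult_ac)
  qed (use sup0 in auto)
qed

lemma starA_summable:
  assumes h: "h \<in> Hset" and a: "a \<in> ADn" and b: "b \<in> ADn" and C: "C \<in> cpts"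
  shows "(\<lambda>p. sn C (\<lambda>w. coef a (fst p) * coef b (snd p) * frs h p w)) summable_on UNIV"
proof (rule summable_on_comparison_test)
  show "(\<lambda>p. norm (coef a (fst p) * coef b (snd p)) * (SUP h\<in>{h}. sn C (frs h p))) summable_on UNIV"
    by (rule frs_sup_summable[OF a b _ _ _ C]) (use h in auto)
  show "sn C (\<lambda>w. coef a (fst p) * coef b (snd p) * frs h p w) \<le>
      norm (coef a (fst p) * coef b (snd p)) * (SUP h\<in>{h}. sn C (frs h p))" for p
    using sn_cmult[OF frs_ADn[OF h] C] by simp
  show "0 \<le> sn C (\<lambda>w. coef a (fst p) * coef b (snd p) * frs h p w)" for p
    by (intro sn_nonneg ADn_cmult frs_ADn h C)
qed

lemma ADn_pointwise_summable:
  fixes f :: "'i \<Rightarrow> 'n::finite fn"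
  assumes f: "\<And>i. f i \<in> ADn" and sm: "\<And>C. C \<in> cpts \<Longrightarrow> (\<lambda>i. sn C (f i)) summable_on UNIV"
  shows "(\<lambda>i. f i w) summable_on UNIV"
proof (cases "w \<in> ball 0 1")
  case True
  define x :: "'n pt \<times> 'n pt" where "x = ((1, w), (1, cnjv w))"
  have x: "x \<in> Uset" using emb_in_Uset[OF True] by (simp add: x_def)
  have fw: "f i w = hat (f i) x" for i
    using fun_cong[OF emb_hat[OF f], of i w] True by (simp add: emb_def x_def)
  have "(\<lambda>i. norm (f i w)) summable_on UNIV"
    unfolding fw
    by (rule summable_on_comparison_test[OF sm[OF single_cpts[OF x]]])
       (auto intro!: sn_upper f single_cpts x)
  then show ?thesis by (rule abs_summable_summable)
next
  case False
  have "f i w = 0" for i using fun_cong[OF emb_hat[OF f], of i w] False by (simp add: emb_def)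
  then show ?thesis by simp
qed

lemma starA_pointwise_summable:
  "h \<in> Hset \<Longrightarrow> a \<in> ADn \<Longrightarrow> b \<in> ADn \<Longrightarrow> (\<lambda>p. coef a (fst p) * coef b (snd p) * frs h p w) summable_on UNIV"
  by (rule ADn_pointwise_summable) (intro ADn_cmult frs_ADn starA_summable, assumption+)+

lemma starA_series:
  assumes "h \<in> Hset" "a \<in> ADn" "b \<in> ADn"
  shows starA_ADn: "starA h a b \<in> ADn"
    and starA_sn_le: "C \<in> cpts \<Longrightarrow> sn C (starA h a b) \<le> (\<Sum>\<^sub>\<infinity>p. sn C (\<lambda>w. coef a (fst p) * coef b (snd p) * frs h p w))"
    and starA_fconv: "fconv (starA h a b) (\<lambda>F w. \<Sum>p\<in>F. coef a (fst p) * coef b (snd p) * frs h p w)"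
proof -
  have *: "(\<lambda>w. coef a (fst p) * coef b (snd p) * frs h p w) \<in> ADn" for p
    by (intro ADn_cmult frs_ADn assms)
  note ** = starA_summable[OF assms]
  show "starA h a b \<in> ADn" unfolding starA_def by (rule ADn_series(1)[OF * **])
  show "C \<in> cpts \<Longrightarrow> sn C (starA h a b) \<le> (\<Sum>\<^sub>\<infinity>p. sn C (\<lambda>w. coef a (fst p) * coef b (snd p) * frs h p w))"
    unfolding starA_def by (rule ADn_series(3)[OF * **])
  show "fconv (starA h a b) (\<lambda>F w. \<Sum>p\<in>F. coef a (fst p) * coef b (snd p) * frs h p w)"
    unfolding starA_def by (rule ADn_series(4)[OF * **])
qed

lemma starA_lincomb_left:
  assumes "h \<in> Hset" "a \<in> ADn" "a' \<in> ADn" "b \<in> ADn"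
  shows "starA h (\<lambda>w. z * a w + a' w) b = (\<lambda>w. z * starA h a b w + starA h a' b w)"
proof
  fix w
  have "starA h (\<lambda>w. z * a w + a' w) b w =
     (\<Sum>\<^sub>\<infinity>p. z * (coef a (fst p) * coef b (snd p) * frs h p w) + coef a' (fst p) * coef b (snd p) * frs h p w)"
    unfolding starA_def coef_lincomb[OF assms(2,3)] by (intro infsum_cong) (simp add: algebra_simps)
  also have "\<dots> = z * starA h a b w + starA h a' b w"
    unfolding starA_def using assms
    by (simp add: infsum_add infsum_cmult_right' summable_on_cmult_right starA_pointwise_summable)
  finally show "starA h (\<lambda>w. z * a w + a' w) b w = z * starA h a b w + starA h a' b w" .
qed

lemma starA_lincomb_right:
  assumes "h \<in> Hset" "a \<in> ADn" "a' \<in> ADn" "b \<in> ADn"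
  shows "starA h b (\<lambda>w. z * a w + a' w) = (\<lambda>w. z * starA h b a w + starA h b a' w)"
proof
  fix w
  have "starA h b (\<lambda>w. z * a w + a' w) w =
     (\<Sum>\<^sub>\<infinity>p. z * (coef b (fst p) * coef a (snd p) * frs h p w) + coef b (fst p) * coef a' (snd p) * frs h p w)"
    unfolding starA_def coef_lincomb[OF assms(2,3)] by (intro infsum_cong) (simp add: algebra_simps)
  also have "\<dots> = z * starA h b a w + starA h b a' w"
    unfolding starA_def using assms
    by (simp add: infsum_add infsum_cmult_right' summable_on_cmult_right starA_pointwise_summable)
  finally show "starA h b (\<lambda>w. z * a w + a' w) w = z * starA h b a w + starA h b a' w" .
qed

text \<open>Because the majorant factorises, the double sum is a product of two single sums, each
  controlled by one seminorm through \<open>coef_sum_bound\<close>; K enters once per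
  factor.\<close>

lemma starA_continuous:
  fixes C :: "('n::finite pt \<times> 'n pt) set"
  assumes h: "h \<in> Hset" and C: "C \<in> cpts"
  obtains C' K where "C' \<in> cpts" "K \<ge> 0"
    "\<And>a b :: 'n fn. a \<in> ADn \<Longrightarrow> b \<in> ADn \<Longrightarrow> sn C (starA h a b) \<le> K * sn C' a * sn C' b"
proof -
  obtain A :: real where A: "A \<ge> 1" "\<And>h' k k'. h' \<in> {h} \<Longrightarrow>
      sn C (starP h' (fr (fst k) (snd k)) (fr (fst k') (snd k'))) \<le> A ^ deg k * A ^ deg k'"
    using starP_bound[of "{h}" C] h C by auto
  have A0: "A > 0" using A(1) by simp
  obtain K where K: "K \<ge> 0"
    "\<And>a :: 'n fn. a \<in> ADn \<Longrightarrow> (\<Sum>\<^sub>\<infinity>k. norm (coef a k) * A ^ deg k) \<le> K * sn (pdisc (2 * A)) a"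
    using coef_sum_bound[OF A0] by blast
  show ?thesis
  proof (rule that[of "pdisc (2 * A)" "K * K"])
    show C': "pdisc (2 * A) \<in> cpts" using A0 by (intro pdisc_cpts) simp
    show "K * K \<ge> 0" using K by simp
    fix a b :: "'n fn" assume ab: "a \<in> ADn" "b \<in> ADn"
    have "sn C (starA h a b) \<le> (\<Sum>\<^sub>\<infinity>p. sn C (\<lambda>w. coef a (fst p) * coef b (snd p) * frs h p w))"
      by (rule starA_sn_le[OF h ab C])
    also have "\<dots> \<le> (\<Sum>\<^sub>\<infinity>p. (norm (coef a (fst p)) * A ^ deg (fst p)) * (norm (coef b (snd p)) * A ^ deg (snd p)))"
    proof (rule infsum_mono[OF starA_summable[OF h ab C] coef_product_summable[OF ab A0]])
      fix p :: "'n pmi \<times> 'n pmi"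
      have "sn C (\<lambda>w. coef a (fst p) * coef b (snd p) * frs h p w) \<le> norm (coef a (fst p) * coef b (snd p)) * sn C (frs h p)"
        by (rule sn_cmult[OF frs_ADn[OF h] C])
      also have "\<dots> \<le> norm (coef a (fst p) * coef b (snd p)) * (A ^ deg (fst p) * A ^ deg (snd p))"
        unfolding frs_def by (intro mult_left_mono A(2)) auto
      finally show "sn C (\<lambda>w. coef a (fst p) * coef b (snd p) * frs h p w) \<le>
          (norm (coef a (fst p)) * A ^ deg (fst p)) * (norm (coef b (snd p)) * A ^ deg (snd p))"
        by (simp add: norm_mult mult_ac)
    qed
    also have "\<dots> = (\<Sum>\<^sub>\<infinity>k. norm (coef a k) * A ^ deg k) * (\<Sum>\<^sub>\<infinity>k. norm (coef b k) * A ^ deg k)"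
    proof -
      have "(\<lambda>(k,k'). (norm (coef a k) * A ^ deg k) * (norm (coef b k') * A ^ deg k')) summable_on UNIV \<times> UNIV"
        using coef_product_summable[OF ab A0] by (simp add: case_prod_unfold)
      from infsum_Sigma'_banach[OF this] show ?thesis
        by (simp add: case_prod_unfold infsum_cmult_right' infsum_cmult_left')
    qed
    also have "\<dots> \<le> (K * sn (pdisc (2 * A)) a) * (K * sn (pdisc (2 * A)) b)"
      using A0 K ab C' by (intro mult_mono K infsum_nonneg) (auto intro!: mult_nonneg_nonneg sn_nonneg)
    finally show "sn C (starA h a b) \<le> K * K * sn (pdisc (2 * A)) a * sn (pdisc (2 * A)) b"
      by (simp add: mult_ac)
  qed
qed

text \<open>The zero function is (-1) b + b, so linearity suffices.\<close>

lemma starP_zero: "h \<in> Hset \<Longrightarrow> b \<in> PD \<Longrightarrow> starP h (\<lambda>_. 0) b = (\<lambda>_. 0)" "h \<in> Hset \<Longrightarrow> b \<in> PD \<Longrightarrow> starP h b (\<lambda>_. 0) = (\<lambda>_. 0)"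
  using starP_lincomb_left[of h b b b "-1"] starP_lincomb_right[of h b b b "-1"] by simp_all

lemma PD_zero: "(\<lambda>_. 0) \<in> PD"
  unfolding PD_def by (intro CollectI exI[of _ "{}"]) auto

lemma PD_sum: "(\<And>i. i \<in> I \<Longrightarrow> f i \<in> PD) \<Longrightarrow> (\<lambda>w. \<Sum>i\<in>I. z i * f i w) \<in> PD"
proof (induction I rule: infinite_finite_induct)
  case (insert i I)
  then show ?case using PD_lincomb[of "f i" "\<lambda>w. \<Sum>i\<in>I. z i * f i w" "z i"] by simp
qed (auto simp: PD_zero)

lemma starP_sum_left:
  assumes "h \<in> Hset" "b \<in> PD" "\<And>i. i \<in> I \<Longrightarrow> f i \<in> PD"
  shows "starP h (\<lambda>w. \<Sum>i\<in>I. z i * f i w) b = (\<lambda>w. \<Sum>i\<in>I. z i * starP h (f i) b w)"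
  using assms(3)
proof (induction I rule: infinite_finite_induct)
  case (insert i I)
  then show ?case
    using starP_lincomb_left[OF assms(1) _ PD_sum[of I f z] assms(2), of "f i" "z i"] by simp
qed (simp_all add: starP_zero assms)

lemma starP_sum_right:
  assumes "h \<in> Hset" "b \<in> PD" "\<And>i. i \<in> I \<Longrightarrow> f i \<in> PD"
  shows "starP h b (\<lambda>w. \<Sum>i\<in>I. z i * f i w) = (\<lambda>w. \<Sum>i\<in>I. z i * starP h b (f i) w)"
  using assms(3)
proof (induction I rule: infinite_finite_induct)
  case (insert i I)
  then show ?case
    using starP_lincomb_right[OF assms(1) _ PD_sum[of I f z] assms(2), of "f i" "z i"] by simp
qed (simp_all add: starP_zero assms)

text \<open>Polynomials have finitely many coefficients with respect to the basis, so the series is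
  a finite double sum and bilinearity of \<open>starP\<close> reassembles it.\<close>

lemma starA_eq_starP:
  assumes h: "h \<in> Hset" and "a \<in> PD" "b \<in> PD"
  shows "starA h a b = starP h a b"
proof
  fix w
  obtain K n where K: "finite K" and a: "a = (\<lambda>w. \<Sum>j\<in>K. n j * fr (fst j) (snd j) w)" by (rule PD_span[OF assms(2)])
  obtain K' n' where K': "finite K'" and b: "b = (\<lambda>w. \<Sum>j\<in>K'. n' j * fr (fst j) (snd j) w)" by (rule PD_span[OF assms(3)])
  have "starA h a b w = (\<Sum>\<^sub>\<infinity>p\<in>K \<times> K'. n (fst p) * n' (snd p) * frs h p w)"
    unfolding starA_def a b coef_finite[OF K] coef_finite[OF K'] by (rule infsum_cong_neutral) auto
  also have "\<dots> = (\<Sum>k\<in>K. \<Sum>k'\<in>K'. n k * n' k' * frs h (k, k') w)"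
    using K K' by (simp add: sum.cartesian_product case_prod_unfold)
  also have "\<dots> = (\<Sum>k\<in>K. n k * (\<Sum>k'\<in>K'. n' k' * frs h (k, k') w))"
    by (simp add: sum_distrib_left mult.assoc)
  also have "\<dots> = starP h a b w"
    unfolding a using assms(3)
    by (simp add: starP_sum_left[OF h] fr_PD)
       (simp add: b starP_sum_right[OF h] fr_PD frs_def)
  finally show "starA h a b w = starP h a b w" .
qed

section \<open>Approximation by polynomials and associativity\<close>

definition trunc :: "'n::finite fn \<Rightarrow> 'n pmi set \<Rightarrow> 'n fn" where
  "trunc a F = (\<lambda>w. \<Sum>k\<in>F. coef a k * fr (fst k) (snd k) w)"

lemma trunc_PD: "trunc a F \<in> PD"
  unfolding trunc_def by (intro PD_sum fr_PD)

lemma coef_fr_summable: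
  assumes a: "a \<in> ADn" and C: "C \<in> cpts"
  shows "(\<lambda>k. sn C (\<lambda>w. coef a k * fr (fst k) (snd k) w)) summable_on UNIV"
proof -
  obtain r where r: "r \<ge> 1" "\<And>k x. x \<in> C \<Longrightarrow> norm (frh k x) \<le> r ^ deg k" using frh_bound[OF C] by blast
  have "(\<lambda>k. norm (coef a k) * r ^ deg k) summable_on UNIV"
    using coef_decay[OF a] r by (simp add: decay2_def)
  then show ?thesis
  proof (rule summable_on_comparison_test)
    fix k
    show "sn C (\<lambda>w. coef a k * fr (fst k) (snd k) w) \<le> norm (coef a k) * r ^ deg k"
      by (rule sn_least[OF C]) (simp add: hat_cmult fr_ADn hat_fr norm_mult mult_left_mono r)
    show "0 \<le> sn C (\<lambda>w. coef a k * fr (fst k) (snd k) w)" by (intro sn_nonneg ADn_cmult fr_ADn C)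
  qed
qed

text \<open>\<open>ADn_series\<close> gives convergence of the coefficient series to some element;
  its hat is the series representing \<open>hat a\<close>, so that element is a.\<close>

lemma trunc_tendsto:
  assumes a: "a \<in> ADn" and C: "C \<in> cpts"
  shows "((\<lambda>F. sn C (a - trunc a F)) \<longlongrightarrow> 0) (finite_subsets_at_top UNIV)"
proof -
  have f: "(\<lambda>w. coef a k * fr (fst k) (snd k) w) \<in> ADn" for k by (intro ADn_cmult fr_ADn)
  note series = ADn_series[OF f coef_fr_summable[OF a]]
  have H1: "hat a = (\<lambda>x. \<Sum>\<^sub>\<infinity>k. coef a k * frh k x)"
    using coef_represents[OF a] by (simp add: represents_def fun_eq_iff)
  have "hat (\<lambda>w. \<Sum>\<^sub>\<infinity>k. coef a k * fr (fst k) (snd k) w) =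
      (\<lambda>x. \<Sum>\<^sub>\<infinity>k. hat (\<lambda>w. coef a k * fr (fst k) (snd k) w) x)"
    by (rule series(2))
  then have H2: "hat (\<lambda>w. \<Sum>\<^sub>\<infinity>k. coef a k * fr (fst k) (snd k) w) = (\<lambda>x. \<Sum>\<^sub>\<infinity>k. coef a k * frh k x)"
    by (simp add: hat_cmult fr_ADn hat_fr)
  have "(\<lambda>w. \<Sum>\<^sub>\<infinity>k. coef a k * fr (fst k) (snd k) w) = a"
    by (rule ADn_eqI[OF series(1) a]) (assumption | rule fun_cong[OF trans[OF H2 H1[symmetric]]])+
  then have "fconv a (trunc a)" using series(4) by (simp add: trunc_def[abs_def])
  then show ?thesis using C unfolding fconv_def by blast
qed

text \<open>Rests on a b - u v = (a - u) b + a (b - v) - (a - u)(b - v), written with juxtaposition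
  for the product. In this form only seminorms of a, of b and of the errors occur, and each summand
  contains a factor tending to 0.\<close>

lemma starA_tendsto:
  assumes h: "h \<in> Hset" and ab: "a \<in> ADn" "b \<in> ADn" and uv: "\<And>F. u F \<in> ADn" "\<And>F. v F \<in> ADn"
    and u: "\<And>C. C \<in> cpts \<Longrightarrow> ((\<lambda>F. sn C (a - u F)) \<longlongrightarrow> 0) X"
    and v: "\<And>C. C \<in> cpts \<Longrightarrow> ((\<lambda>F. sn C (b - v F)) \<longlongrightarrow> 0) X" and C: "C \<in> cpts"
  shows "((\<lambda>F. sn C (starA h a b - starA h (u F) (v F))) \<longlongrightarrow> 0) X"
proof -
  obtain C' K where K: "C' \<in> cpts" "K \<ge> 0"
    "\<And>a b. a \<in> ADn \<Longrightarrow> b \<in> ADn \<Longrightarrow> sn C (starA h a b) \<le> K * sn C' a * sn C' b"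
    using starA_continuous[OF h C] by blast
  have du: "a - u F \<in> ADn" and dv: "b - v F \<in> ADn" for F by (intro ADn_diff ab uv)+
  have bound: "sn C (starA h a b - starA h (u F) (v F)) \<le>
      K * sn C' (a - u F) * sn C' b + (K * sn C' a * sn C' (b - v F) + K * sn C' (a - u F) * sn C' (b - v F))" for F
  proof -
    have vF: "(\<lambda>w. (-1) * (b - v F) w + b w) = v F" by auto
    have uF: "(\<lambda>w. (-1) * (a - u F) w + a w) = u F" by auto
    have 1: "starA h (u F) (v F) w = - starA h (u F) (b - v F) w + starA h (u F) b w" for w
      using fun_cong[OF starA_lincomb_right[OF h dv[of F] ab(2) uv(1)[of F], where z = "-1", unfolded vF], of w] by simp
    have 2: "starA h (u F) c w = - starA h (a - u F) c w + starA h a c w" if "c \<in> ADn" for c w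
      using fun_cong[OF starA_lincomb_left[OF h du[of F] ab(1) that, where z = "-1", unfolded uF], of w] by simp
    have eq: "starA h a b - starA h (u F) (v F) =
        (\<lambda>w. starA h (a - u F) b w + (starA h a (b - v F) w + (-1) * starA h (a - u F) (b - v F) w))"
      by (rule ext) (simp add: 1 2[OF dv] 2[OF ab(2)])
    have A: "starA h (a - u F) b \<in> ADn" "starA h a (b - v F) \<in> ADn" "starA h (a - u F) (b - v F) \<in> ADn"
      by (intro starA_ADn h ab du dv)+
    have "sn C (starA h a b - starA h (u F) (v F)) \<le> sn C (starA h (a - u F) b) +
        sn C (\<lambda>w. starA h a (b - v F) w + (-1) * starA h (a - u F) (b - v F) w)"
      unfolding eq by (intro sn_add ADn_add ADn_cmult A C)
    moreover have "sn C (\<lambda>w. starA h a (b - v F) w + (-1) * starA h (a - u F) (b - v F) w) \<le>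
        sn C (starA h a (b - v F)) + sn C (\<lambda>w. (-1) * starA h (a - u F) (b - v F) w)"
      by (intro sn_add ADn_cmult A C)
    moreover have "sn C (\<lambda>w. (-1) * starA h (a - u F) (b - v F) w) \<le> sn C (starA h (a - u F) (b - v F))"
      using sn_cmult[OF A(3) C, of "-1"] by simp
    moreover have "sn C (starA h (a - u F) b) \<le> K * sn C' (a - u F) * sn C' b"
      "sn C (starA h a (b - v F)) \<le> K * sn C' a * sn C' (b - v F)"
      "sn C (starA h (a - u F) (b - v F)) \<le> K * sn C' (a - u F) * sn C' (b - v F)"
      by (intro K ab du dv)+
    ultimately show ?thesis by linarith
  qed
  have lim: "((\<lambda>F. K * sn C' (a - u F) * sn C' b + (K * sn C' a * sn C' (b - v F) + K * sn C' (a - u F) * sn C' (b - v F)))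
      \<longlongrightarrow> K * 0 * sn C' b + (K * sn C' a * 0 + K * 0 * 0)) X"
    by (intro tendsto_intros u v K)
  show ?thesis
  proof (rule tendsto_sandwich)
    show "\<forall>\<^sub>F F in X. 0 \<le> sn C (starA h a b - starA h (u F) (v F))"
      by (intro always_eventually allI sn_nonneg ADn_diff starA_ADn h ab uv C)
    show "\<forall>\<^sub>F F in X. sn C (starA h a b - starA h (u F) (v F)) \<le>
        K * sn C' (a - u F) * sn C' b + (K * sn C' a * sn C' (b - v F) + K * sn C' (a - u F) * sn C' (b - v F))"
      by (intro always_eventually allI bound)
  qed (use lim in auto)
qed

text \<open>All three factors are truncated at the same finite set. Both bracketings are then limits
  of one and the same net of polynomials, and limits are unique because the seminorms separate
  points.\<close>

lemma starA_assoc: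
  assumes h: "h \<in> Hset" and a: "a \<in> ADn" and b: "b \<in> ADn" and c: "c \<in> ADn"
  shows "starA h (starA h a b) c = starA h a (starA h b c)"
proof -
  let ?X = "finite_subsets_at_top UNIV"
  let ?l = "starA h (starA h a b) c" and ?r = "starA h a (starA h b c)"
  let ?t = "\<lambda>F. starA h (starA h (trunc a F) (trunc b F)) (trunc c F)"
  have t: "trunc x F \<in> ADn" for x :: "'a fn" and F by (intro PD_ADn trunc_PD)
  have l: "((\<lambda>F. sn C (?l - ?t F)) \<longlongrightarrow> 0) ?X" if "C \<in> cpts" for C
    by (intro starA_tendsto starA_ADn h a b c t trunc_tendsto that)
  have r: "((\<lambda>F. sn C (?r - starA h (trunc a F) (starA h (trunc b F) (trunc c F)))) \<longlongrightarrow> 0) ?X" if "C \<in> cpts" for C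
    by (intro starA_tendsto starA_ADn h a b c t trunc_tendsto that)
  have eq: "starA h (trunc a F) (starA h (trunc b F) (trunc c F)) = ?t F" for F
    by (simp add: starA_eq_starP h trunc_PD starP_PD starP_assoc)
  have A: "?l \<in> ADn" "?r \<in> ADn" "?t F \<in> ADn" for F by (intro starA_ADn h a b c t)+
  have "?l - ?r = (\<lambda>_. 0)"
  proof (rule ADn_eq_zeroI[OF ADn_diff[OF A(1,2)]])
    fix C :: "('a pt \<times> 'a pt) set" assume C: "C \<in> cpts"
    have "sn C (?l - ?r) \<le> sn C (?l - ?t F) + norm (-1::complex) * sn C (?r - ?t F)" for F
    proof -
      have e: "?l - ?r = (\<lambda>w. (?l - ?t F) w + (-1) * (?r - ?t F) w)" by (auto simp: fun_eq_iff)
      have "sn C (?l - ?r) \<le> sn C (?l - ?t F) + sn C (\<lambda>w. (-1) * (?r - ?t F) w)"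
        unfolding e by (intro sn_add ADn_diff ADn_cmult A C)
      also have "\<dots> \<le> sn C (?l - ?t F) + norm (-1::complex) * sn C (?r - ?t F)"
        by (intro add_left_mono sn_cmult ADn_diff A C)
      finally show ?thesis .
    qed
    moreover have "((\<lambda>F. sn C (?l - ?t F) + norm (-1::complex) * sn C (?r - ?t F)) \<longlongrightarrow> 0 + norm (-1::complex) * 0) ?X"
      using r[OF C] unfolding eq by (intro tendsto_intros l[OF C])
    ultimately show "sn C (?l - ?r) \<le> 0"
      by (intro tendsto_lowerbound[where F = ?X and f = "\<lambda>F. sn C (?l - ?t F) + norm (-1::complex) * sn C (?r - ?t F)"])
         auto
  qed
  then show ?thesis by (simp add: fun_eq_iff)
qed

section \<open>The involution\<close>

text \<open>The antiholomorphic involution [p, q] |-> [conj q, conj p] of the complexified disc. It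
  fixes the embedded disc pointwise, so conjugating a pullback along it extends pointwise
  conjugation.\<close>

definition tau :: "'n::finite pt \<times> 'n pt \<Rightarrow> 'n pt \<times> 'n pt" where
  "tau x = ((cnj (fst (snd x)), cnjv (snd (snd x))), (cnj (fst (fst x)), cnjv (snd (fst x))))"

lemma bil_tau: "bil (fst (tau x)) (snd (tau x)) = cnj (bil (fst x) (snd x))"
  by (simp add: tau_def bil_def cnjv_def mult.commute)

lemma tau_Uset: "tau x \<in> Uset \<longleftrightarrow> x \<in> Uset"
  by (simp add: in_Uset bil_tau)

lemma bounded_linear_tau: "bounded_linear tau"
proof -
  have "linear tau"
    by (rule linearI; rule pt2_eqI) (simp_all add: tau_def cnjv_def)
  then show ?thesis by (simp add: linear_conv_bounded_linear)
qed

lemma tau_csc: "tau (csc \<i> v) = - csc \<i> (tau v)"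
  by (rule pt2_eqI) (simp_all add: tau_def cnjv_def)

definition cnjG :: "('n::finite pt \<times> 'n pt \<Rightarrow> complex) \<Rightarrow> 'n pt \<times> 'n pt \<Rightarrow> complex" where
  "cnjG G x = cnj (G (tau x))"

lemma cnjG_Ohat:
  assumes G: "G \<in> Ohat"
  shows "cnjG G \<in> Ohat"
  unfolding Ohat_def
proof (intro CollectI conjI allI impI)
  show "holo_on (cnjG G) Uset"
    unfolding holo_on_cdiff
  proof
    fix x :: "'a pt \<times> 'a pt" assume "x \<in> Uset"
    then obtain L where L: "(G has_derivative L) (at (tau x))" "\<And>v. L (csc \<i> v) = \<i> * L v"
      using OhatD(1)[OF G] tau_Uset[of x] unfolding holo_on_def by blast
    have lin: "linear L" using L(1) has_derivative_linear by blast
    have "((\<lambda>x. cnj (G (tau x))) has_derivative (\<lambda>v. cnj (L (tau v)))) (at x)"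
      using has_derivative_compose[OF bounded_linear_imp_has_derivative[OF bounded_linear_tau], of G L x] L(1)
      by (intro has_derivative_cnj) auto
    \<comment> \<open>Both \<open>tau\<close> and \<open>cnj\<close> are conjugate linear; the two
      sign changes cancel and the composite is again complex linear.\<close>
    moreover have "cnj (L (tau (csc \<i> v))) = \<i> * cnj (L (tau v))" for v
      by (simp add: tau_csc linear_neg[OF lin] L(2))
    ultimately show "cdiff (cnjG G) x" unfolding cdiff_def cnjG_def[abs_def] by blast
  qed
  show "cnjG G x = 0" if "x \<notin> Uset" for x
    using OhatD(2)[OF G, of "tau x"] that tau_Uset[of x] by (simp add: cnjG_def)
  fix p q :: "'a pt" and z u :: complex assume *: "(p, q) \<in> Uset" "z \<noteq> 0" "u \<noteq> 0"
  have "tau (sc z p, sc u q) = (sc (cnj u) (fst (tau (p, q))), sc (cnj z) (snd (tau (p, q))))"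
    by (rule pt2_eqI) (simp_all add: tau_def sc_def cnjv_def)
  then show "cnjG G (sc z p, sc u q) = cnjG G (p, q)"
    using OhatD(3)[OF G, of "fst (tau (p, q))" "snd (tau (p, q))" "cnj u" "cnj z"] * tau_Uset[of "(p, q)"]
    by (simp add: cnjG_def)
qed

lemma emb_cnjG: "emb (cnjG G) = cnjf (emb G)"
proof
  fix w :: "complex ^ 'a"
  have "tau ((1, w), (1, cnjv w)) = ((1, w), (1, cnjv w))"
    by (rule pt2_eqI) (simp_all add: tau_def cnjv_def)
  then show "emb (cnjG G) w = cnjf (emb G) w" by (simp add: emb_def cnjf_def cnjG_def)
qed

lemma cnjf_ADn: "a \<in> ADn \<Longrightarrow> cnjf a \<in> ADn"
  and hat_cnjf: "a \<in> ADn \<Longrightarrow> hat (cnjf a) = cnjG (hat a)"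
proof -
  assume a: "a \<in> ADn"
  have e: "cnjf a = emb (cnjG (hat a))" by (simp add: emb_cnjG emb_hat a)
  show "cnjf a \<in> ADn" unfolding ADn_def using e cnjG_Ohat[OF hat_Ohat[OF a]] by blast
  show "hat (cnjf a) = cnjG (hat a)" unfolding e by (rule hat_emb[OF cnjG_Ohat[OF hat_Ohat[OF a]]])
qed

lemma sn_cnjf:
  assumes C: "C \<in> cpts"
  obtains C' where "C' \<in> cpts" "\<And>a. a \<in> ADn \<Longrightarrow> sn C (cnjf a) \<le> sn C' a"
proof (rule that[of "tau ` C"])
  have "continuous_on C tau" by (rule linear_continuous_on[OF bounded_linear_tau])
  then show C': "tau ` C \<in> cpts"
    using C tau_Uset compact_continuous_image unfolding cpts_def by blast
  fix a :: "'a fn" assume a: "a \<in> ADn"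
  show "sn C (cnjf a) \<le> sn (tau ` C) a"
    by (rule sn_least[OF C]) (auto simp: hat_cnjf a cnjG_def intro!: sn_upper C')
qed

lemma wpow_cnj: "wpow (cnjv w) P = cnj (wpow w P)"
  by (simp add: wpow_def cnjv_def)

lemma cnjf_fP: "mabs P = mabs Q \<Longrightarrow> cnjf (fP P Q) = fP Q P"
proof
  fix w :: "complex ^ 'a" assume "mabs P = mabs Q"
  moreover have "cnj (wdot w) = wdot w" by (simp add: wdot_def mult.commute)
  ultimately show "cnjf (fP P Q) w = fP Q P w"
    by (simp add: cnjf_def fP_def wpow_cnj mult.commute)
qed

lemma cnjf_fr: "cnjf (fr P Q) = fr Q P"
proof -
  have "fr Q P = fP (lift2 (P, Q)) (lift1 (P, Q))"
    using fr_eq_fP[of "(Q, P)"] by (simp add: lift1_def lift2_def max.commute)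
  then show ?thesis
    using cnjf_fP[of "lift1 (P, Q)" "lift2 (P, Q)"] fr_eq_fP[of "(P, Q)"] by (simp add: mabs_lift)
qed

lemma coef_cnjf:
  fixes a :: "'n::finite fn"
  assumes a: "a \<in> ADn"
  shows "coef (cnjf a) k = cnj (coef a (prod.swap k))"
proof -
  have bsw: "bij (prod.swap :: 'n pmi \<Rightarrow> 'n pmi)" by (rule bij_swap)
  have frh: "cnj (frh (prod.swap k) (tau x)) = frh k x" for k and x :: "'n pt \<times> 'n pt"
  proof -
    have "cnjf (fr (snd k) (fst k)) = fr (fst k) (snd k)" by (rule cnjf_fr)
    then have "cnjG (frh (prod.swap k)) = frh k"
      using hat_cnjf[OF fr_ADn[of "snd k" "fst k"]] by (simp add: hat_fr prod.swap_def)
    then show ?thesis by (metis cnjG_def)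
  qed
  have rep: "decay2 (coef a)" "\<And>x. hat a x = (\<Sum>\<^sub>\<infinity>k. coef a k * frh k x)"
    using coef_represents[OF a] unfolding represents_def by blast+
  have "coef (cnjf a) = (\<lambda>k. cnj (coef a (prod.swap k)))"
  proof (rule coef_eqI, unfold represents_def, intro conjI allI)
    show "decay2 (\<lambda>k. cnj (coef a (prod.swap k)))"
      unfolding decay2_def
    proof (intro allI impI)
      fix R :: real assume "R > 0"
      then have "(\<lambda>k. norm (coef a k) * R ^ deg k) summable_on UNIV" using rep(1) by (simp add: decay2_def)
      then show "(\<lambda>k. norm (cnj (coef a (prod.swap k))) * R ^ deg k) summable_on UNIV"
        using summable_on_reindex_bij_betw[OF bsw, of "\<lambda>k. norm (coef a k) * R ^ deg k"]
        by (simp add: deg_def add.commute)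
    qed
    fix x
    have "hat (cnjf a) x = cnj (\<Sum>\<^sub>\<infinity>k. coef a k * frh k (tau x))"
      by (simp add: hat_cnjf a cnjG_def rep(2))
    also have "(\<Sum>\<^sub>\<infinity>k. coef a k * frh k (tau x)) = (\<Sum>\<^sub>\<infinity>k. coef a (prod.swap k) * frh (prod.swap k) (tau x))"
      by (rule infsum_reindex_bij_betw[OF bsw, symmetric])
    also have "cnj \<dots> = (\<Sum>\<^sub>\<infinity>k. cnj (coef a (prod.swap k)) * frh k x)"
      unfolding infsum_cnj[symmetric] by (simp add: frh)
    finally show "hat (cnjf a) x = (\<Sum>\<^sub>\<infinity>k. cnj (coef a (prod.swap k)) * frh k x)" .
  qed
  then show ?thesis by simp
qed

lemma cnj_pochhammer: "cnj (pochhammer z m) = pochhammer (cnj z) m"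
  by (simp add: pochhammer_prod)

text \<open>For real h the structure constants are real, and they are symmetric under exchanging P
  and S; conjugation exchanges the roles of these two multi-indices and thereby reverses the
  factors.\<close>

lemma cnjf_starP_fP:
  assumes h: "h \<in> Hset" "h \<in> \<real>" and PQ: "mabs P = mabs Q" and RS: "mabs R = mabs S"
  shows "cnjf (starP h (fP P Q) (fP R S)) = starP h (fP S R) (fP Q P)"
proof
  fix w
  have hc: "cnj h = h" using h(2) by (simp add: Reals_cnj_iff)
  have scf: "cnj (scf h P S T) = scf h S P T" for T
    by (simp add: scf_def cnj_pochhammer hc mult_ac add.commute)
  have b: "mi_below S P = mi_below P S" by (auto simp: mi_below_def)
  have "cnj (fP (mi_sub (mi_add P R) T) (mi_sub (mi_add Q S) T) w) = fP (mi_sub (mi_add S Q) T) (mi_sub (mi_add R P) T) w"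
    if "T \<in> mi_below P S" for T
  proof -
    have e: "mi_add Q S = mi_add S Q" "mi_add P R = mi_add R P" by (simp_all add: mi_add_def add.commute)
    have "mabs (mi_sub (mi_add P R) T) = mabs (mi_sub (mi_add S Q) T)"
      using that mabs_mi_sub[of T P R] mabs_mi_sub[of T S Q] PQ RS by (auto simp: mi_below_def)
    from cnjf_fP[OF this] show ?thesis by (simp add: cnjf_def fun_eq_iff e)
  qed
  then show "cnjf (starP h (fP P Q) (fP R S)) w = starP h (fP S R) (fP Q P) w"
    unfolding starP_fP[OF h(1) PQ RS] starP_fP[OF h(1) RS[symmetric] PQ[symmetric]]
    by (simp add: cnjf_def scf b)
qed

lemma cnjf_starA:
  fixes a b :: "'n::finite fn"
  assumes h: "h \<in> Hset" "h \<in> \<real>" and a: "a \<in> ADn" and b: "b \<in> ADn"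
  shows "cnjf (starA h a b) = starA h (cnjf b) (cnjf a)"
proof
  fix w
  \<comment> \<open>Conjugating the product exchanges the two factors and, within each index, P with
    Q; this involution of the index set does both, and the series is reindexed along it.\<close>
  define s :: "'n pmi \<times> 'n pmi \<Rightarrow> 'n pmi \<times> 'n pmi" where "s p = (prod.swap (snd p), prod.swap (fst p))" for p
  have s: "bij s" by (rule o_bij[of s s]) (auto simp: s_def fun_eq_iff)
  have frs: "cnj (frs h (s p) w) = frs h p w" for p
  proof -
    define k k' where "k = prod.swap (snd p)" and "k' = prod.swap (fst p)"
    have l: "lift2 k' = lift1 (fst p)" "lift1 k' = lift2 (fst p)" "lift2 k = lift1 (snd p)" "lift1 k = lift2 (snd p)"
      by (simp_all add: k_def k'_def lift1_def lift2_def max.commute)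
    have "cnjf (frs h (s p)) = starP h (fP (lift2 k') (lift1 k')) (fP (lift2 k) (lift1 k))"
      unfolding frs_def s_def fst_conv snd_conv k_def[symmetric] k'_def[symmetric] fr_eq_fP
      by (rule cnjf_starP_fP[OF h]) (simp_all add: mabs_lift)
    also have "\<dots> = frs h p" by (simp add: frs_def fr_eq_fP l)
    finally show ?thesis by (metis cnjf_def)
  qed
  have "cnjf (starA h a b) w = cnj (\<Sum>\<^sub>\<infinity>p. coef a (fst p) * coef b (snd p) * frs h p w)"
    by (simp add: cnjf_def starA_def)
  also have "(\<Sum>\<^sub>\<infinity>p. coef a (fst p) * coef b (snd p) * frs h p w) =
      (\<Sum>\<^sub>\<infinity>p. coef a (fst (s p)) * coef b (snd (s p)) * frs h (s p) w)"
    by (rule infsum_reindex_bij_betw[OF s, symmetric])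
  also have "cnj \<dots> = (\<Sum>\<^sub>\<infinity>p. cnj (coef b (prod.swap (fst p))) * cnj (coef a (prod.swap (snd p))) * frs h p w)"
    unfolding infsum_cnj[symmetric] complex_cnj_mult frs by (simp add: s_def mult_ac)
  also have "\<dots> = starA h (cnjf b) (cnjf a) w"
    by (simp add: starA_def coef_cnjf a b)
  finally show "cnjf (starA h a b) w = starA h (cnjf b) (cnjf a) w" .
qed

theorem theorem3p17:
  shows "(\<exists>m :: complex \<Rightarrow> 'n::finite fn \<Rightarrow> 'n fn \<Rightarrow> 'n fn.
     \<forall>h\<in>Hset.
       (\<forall>a\<in>ADn. \<forall>b\<in>ADn. m h a b \<in> ADn)
     \<and> (\<forall>a\<in>PD. \<forall>b\<in>PD. m h a b = starP h a b)
     \<and> (\<forall>a\<in>ADn. \<forall>a'\<in>ADn. \<forall>b\<in>ADn. \<forall>z::complex.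
          m h (\<lambda>w. z * a w + a' w) b = (\<lambda>w. z * m h a b w + m h a' b w)
        \<and> m h b (\<lambda>w. z * a w + a' w) = (\<lambda>w. z * m h b a w + m h b a' w))
     \<and> (\<forall>a\<in>ADn. \<forall>b\<in>ADn. \<forall>c\<in>ADn. m h (m h a b) c = m h a (m h b c))
     \<and> (\<forall>C\<in>cpts. \<exists>C'\<in>cpts. \<exists>K::real. \<forall>a\<in>ADn. \<forall>b\<in>ADn.
          sn C (m h a b) \<le> K * sn C' a * sn C' b)
     \<and> (\<forall>a\<in>ADn. \<forall>b\<in>ADn. \<forall>ca cb. schauder a ca \<longrightarrow> schauder b cb \<longrightarrow>
          fconv (m h a b) (\<lambda>F. \<lambda>w. \<Sum>((P,Q),(R,S))\<in>F.
              ca (P,Q) * cb (R,S) * starP h (fr P Q) (fr R S) w))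
     \<and> (h \<in> \<real> \<longrightarrow>
          (\<forall>a\<in>(ADn :: 'n fn set). cnjf a \<in> (ADn :: 'n fn set))
        \<and> (\<forall>a\<in>ADn. \<forall>b\<in>ADn. cnjf (m h a b) = m h (cnjf b) (cnjf a))
        \<and> (\<forall>C\<in>cpts. \<exists>C'\<in>cpts. \<exists>K::real. \<forall>a\<in>(ADn :: 'n fn set). sn C (cnjf a) \<le> K * sn C' a)))
   \<and> (\<forall>a\<in>(ADn :: 'n fn set). \<forall>b\<in>ADn. \<forall>ca cb. schauder a ca \<longrightarrow> schauder b cb \<longrightarrow>
       (\<forall>L. compact L \<and> L \<subseteq> Hset \<and> L \<noteq> {} \<longrightarrow>
         (\<forall>C\<in>cpts. (\<lambda>((P,Q),(R,S)). norm (ca (P,Q) * cb (R,S)) *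
              (SUP h\<in>L. sn C (starP h (fr P Q) (fr R S)))) summable_on UNIV)))"
proof (intro conjI exI[of _ starA] ballI allI impI)
  fix h :: complex assume h: "h \<in> Hset"
  fix a b :: "'n fn" assume ab: "a \<in> ADn" "b \<in> ADn"
  show "starA h a b \<in> ADn" by (rule starA_ADn[OF h ab])
next
  fix h :: complex assume h: "h \<in> Hset"
  fix a b :: "'n fn" assume ab: "a \<in> PD" "b \<in> PD"
  show "starA h a b = starP h a b" by (rule starA_eq_starP[OF h ab])
next
  fix h :: complex assume h: "h \<in> Hset"
  fix a a' b :: "'n fn" and z :: complex assume aab: "a \<in> ADn" "a' \<in> ADn" "b \<in> ADn"
  show "starA h (\<lambda>w. z * a w + a' w) b = (\<lambda>w. z * starA h a b w + starA h a' b w)"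
    by (rule starA_lincomb_left[OF h aab])
  show "starA h b (\<lambda>w. z * a w + a' w) = (\<lambda>w. z * starA h b a w + starA h b a' w)"
    by (rule starA_lincomb_right[OF h aab])
next
  fix h :: complex assume h: "h \<in> Hset"
  fix a b c :: "'n fn" assume abc: "a \<in> ADn" "b \<in> ADn" "c \<in> ADn"
  show "starA h (starA h a b) c = starA h a (starA h b c)" by (rule starA_assoc[OF h abc])
next
  fix h :: complex assume h: "h \<in> Hset"
  fix C :: "('n pt \<times> 'n pt) set" assume C: "C \<in> cpts"
  show "\<exists>C'\<in>cpts. \<exists>K. \<forall>a\<in>ADn. \<forall>b\<in>ADn. sn C (starA h a b) \<le> K * sn C' a * sn C' b"
    using starA_continuous[OF h C] by metis
next
  fix h :: complex assume h: "h \<in> Hset"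
  fix a b :: "'n fn" and ca cb assume ab: "a \<in> ADn" "b \<in> ADn" and s: "schauder a ca" "schauder b cb"
  \<comment> \<open>By \<open>schauder_coef\<close> the given expansions coincide with those used in
    the definition of \<open>starA\<close>.\<close>
  show "fconv (starA h a b) (\<lambda>F w. \<Sum>((P, Q), R, S)\<in>F. ca (P, Q) * cb (R, S) * starP h (fr P Q) (fr R S) w)"
    using starA_fconv[OF h ab] unfolding schauder_coef[OF ab(1) s(1)] schauder_coef[OF ab(2) s(2)]
    by (simp add: case_prod_unfold frs_def)
next
  fix h :: complex and a :: "'n fn" assume "a \<in> ADn"
  then show "cnjf a \<in> ADn" by (rule cnjf_ADn)
next
  fix h :: complex assume h: "h \<in> Hset" "h \<in> \<real>"
  fix a b :: "'n fn" assume ab: "a \<in> ADn" "b \<in> ADn"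
  show "cnjf (starA h a b) = starA h (cnjf b) (cnjf a)" by (rule cnjf_starA[OF h ab])
next
  fix C :: "('n pt \<times> 'n pt) set" assume C: "C \<in> cpts"
  obtain C' where "C' \<in> cpts" "\<And>a. a \<in> ADn \<Longrightarrow> sn C (cnjf a) \<le> sn C' a" using sn_cnjf[OF C] by blast
  then show "\<exists>C'\<in>cpts. \<exists>K. \<forall>a\<in>ADn. sn C (cnjf a) \<le> K * sn C' a"
    by (intro bexI[of _ C'] exI[of _ 1]) auto
next
  fix a b :: "'n fn" and ca cb L and C :: "('n pt \<times> 'n pt) set"
  assume ab: "a \<in> ADn" "b \<in> ADn" and s: "schauder a ca" "schauder b cb"
    and L: "compact L \<and> L \<subseteq> Hset \<and> L \<noteq> {}" and C: "C \<in> cpts"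
  show "(\<lambda>((P, Q), R, S). norm (ca (P, Q) * cb (R, S)) * (SUP h\<in>L. sn C (starP h (fr P Q) (fr R S)))) summable_on UNIV"
    using frs_sup_summable[OF ab _ _ _ C, of L] L
    unfolding schauder_coef[OF ab(1) s(1)] schauder_coef[OF ab(2) s(2)]
    by (simp add: case_prod_unfold frs_def)
qed

end
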